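(* Let $V:\mathbb{R}\to\mathbb{R}$ be integrable with compact support contained in $[-1,1]$. If $\lambda=0$ is not an eigenvalue of the operator $\mathcal{N}$, then the family $S_\varepsilon$ converges in the norm resolvent sense as $\varepsilon\to 0$ to $S_-\oplus S_+$.
   Context: For $\varepsilon>0$, $S_\varepsilon=-\frac{d^2}{dx^2}+\frac{1}{\varepsilon^2}V\left(\frac{x}{\varepsilon}\right)$ is the Schr\"odinger operator on the real line, acting in $L_2(\mathbb{R})$, with domain $\operatorname{dom}S_\varepsilon=W_2^2(\mathbb{R})$. $\mathcal{N}$ is the Sturm--Liouville operator given by $\mathcal{N}y=-y''+Vy$ on the interval $[-1,1]$ subject to the Neumann boundary conditions $y'(-1)=y'(1)=0$. For an open set $\Omega\subset\mathbb{R}$, $W_2^2(\Omega)$ is the Sobolev space of functions on $\Omega$ that belong to $L_2(\Omega)$ together with their derivatives up to order $2$. $S_-\oplus S_+$ is the direct sum, in $L_2(\mathbb{R})=L_2(\mathbb{R}_-)\oplus L_2(\mathbb{R}_+)$, of the unperturbed half-line Schr\"odinger operators $S_\pm=-d^2/dx^2$ on $\mathbb{R}_\pm$ subject to the Dirichlet boundary condition at $x=0$, i.e. with domains $\{y\in W_2^2(\mathbb{R}_\pm): y(0\pm)=0\}$, where $\mathbb{R}_-=(-\infty,0)$ and $\mathbb{R}_+=(0,\infty)$. Norm resolvent convergence of $S_\varepsilon$ to $S$ means $\|(S_\varepsilon-z)^{-1}-(S-z)^{-1}\|\to0$ in the operator norm on $L_2(\mathbb{R})$ for $z\in\mathbb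{C}\setminus\mathbb{R}$.
   Formalization: For merely integrable V, S_ε need not map W_2^2(R) into L_2; its domain is read as all y in L_2 with y, y' locally absolutely continuous, y' in L_2 and -y''+ε^{-2}V(x/ε)y in L_2, which equals W_2^2(R) when V is square integrable. *)

theory Defs
  imports "HOL-Analysis.Analysis"
begin

section \<open>The Hilbert space of square integrable functions on the real line\<close>

definition square_integrable :: "(real \<Rightarrow> complex) \<Rightarrow> bool" where
  "square_integrable f \<longleftrightarrow>
     f \<in> borel_measurable lebesgue \<and> integrable lebesgue (\<lambda>x. (norm (f x))\<^sup>2)"

lemma square_integrable_zero: "square_integrable (\<lambda>x. 0)"
  by (simp add: square_integrable_def)

lemma square_integrable_add:
  assumes "square_integrable f" "square_integrable g"
  shows "square_integrable (\<lambda>x. f x + g x)"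
  unfolding square_integrable_def
proof
  show m: "(\<lambda>x. f x + g x) \<in> borel_measurable lebesgue"
    using assms by (auto simp: square_integrable_def)
  show "integrable lebesgue (\<lambda>x. (norm (f x + g x))\<^sup>2)"
  proof (rule Bochner_Integration.integrable_bound)
    show "integrable lebesgue (\<lambda>x. 2 * (norm (f x))\<^sup>2 + 2 * (norm (g x))\<^sup>2)"
      using assms by (auto simp: square_integrable_def)
    show "(\<lambda>x. (norm (f x + g x))\<^sup>2) \<in> borel_measurable lebesgue"
      using m by measurable
    have "(norm (a + b))\<^sup>2 \<le> 2 * (norm a)\<^sup>2 + 2 * (norm b)\<^sup>2" for a b :: complex
    proof -
      have "(norm (a + b))\<^sup>2 \<le> (norm a + norm b)\<^sup>2"
        by (intro power_mono norm_triangle_ineq) simp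
      also have "\<dots> \<le> 2 * (norm a)\<^sup>2 + 2 * (norm b)\<^sup>2"
        using zero_le_power2[of "norm a - norm b"] by (simp add: power2_sum power2_diff)
      finally show ?thesis .
    qed
    then show "AE x in lebesgue. norm ((norm (f x + g x))\<^sup>2)
        \<le> norm (2 * (norm (f x))\<^sup>2 + 2 * (norm (g x))\<^sup>2)"
      by (intro AE_I2) (simp add: order_trans[OF _ abs_ge_self])
  qed
qed

lemma square_integrable_cmult:
  assumes "square_integrable f"
  shows "square_integrable (\<lambda>x. c * f x)"
  using assms by (auto simp: square_integrable_def norm_mult power_mult_distrib)

lemma square_integrable_scaleR:
  assumes "square_integrable f"
  shows "square_integrable (\<lambda>x. r *\<^sub>R f x)"
  using square_integrable_cmult[OF assms, of "of_real r"] by (simp add: scaleR_conv_of_real)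

lemma square_integrable_uminus:
  assumes "square_integrable f"
  shows "square_integrable (\<lambda>x. - f x)"
  using square_integrable_cmult[OF assms, of "-1"] by simp

lemma square_integrable_diff:
  assumes "square_integrable f" "square_integrable g"
  shows "square_integrable (\<lambda>x. f x - g x)"
  using square_integrable_add[OF assms(1) square_integrable_uminus[OF assms(2)]] by simp

lemma square_integrable_inner:
  assumes "square_integrable f" "square_integrable g"
  shows "integrable lebesgue (\<lambda>x. f x \<bullet> g x)"
proof (rule Bochner_Integration.integrable_bound)
  show "integrable lebesgue (\<lambda>x. (norm (f x))\<^sup>2 + (norm (g x))\<^sup>2)"
    using assms by (auto simp: square_integrable_def)
  show "(\<lambda>x. f x \<bullet> g x) \<in> borel_measurable lebesgue"
    using assms by (auto simp: square_integrable_def)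
  have "\<bar>a \<bullet> b\<bar> \<le> (norm a)\<^sup>2 + (norm b)\<^sup>2" for a b :: complex
  proof -
    have "\<bar>a \<bullet> b\<bar> \<le> norm a * norm b" by (rule Cauchy_Schwarz_ineq2)
    also have "\<dots> \<le> (norm a)\<^sup>2 + (norm b)\<^sup>2"
      using zero_le_power2[of "norm a - norm b"]
        mult_nonneg_nonneg[OF norm_ge_zero[of a] norm_ge_zero[of b]]
      unfolding power2_diff by linarith
    finally show ?thesis .
  qed
  then show "AE x in lebesgue. norm (f x \<bullet> g x) \<le> norm ((norm (f x))\<^sup>2 + (norm (g x))\<^sup>2)"
    by (intro AE_I2) (simp add: order_trans[OF _ abs_ge_self])
qed

quotient_type L2 = "real \<Rightarrow> complex" / partial:
  "\<lambda>f g. square_integrable f \<and> square_integrable g \<and> (AE x in lebesgue. f x = g x)"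
proof (rule part_equivpI)
  show "\<exists>f. square_integrable f \<and> square_integrable f \<and> (AE x in lebesgue. f x = f x)"
    using square_integrable_zero by auto
  show "symp (\<lambda>f g. square_integrable f \<and> square_integrable g \<and> (AE x in lebesgue. f x = g x))"
    by (rule sympI) (simp add: eq_commute)
  show "transp (\<lambda>f g. square_integrable f \<and> square_integrable g \<and> (AE x in lebesgue. f x = g x))"
  proof (rule transpI, elim conjE, intro conjI)
    fix f g h :: "real \<Rightarrow> complex"
    assume "AE x in lebesgue. f x = g x" "AE x in lebesgue. g x = h x"
    then show "AE x in lebesgue. f x = h x" by (rule eventually_elim2) simp
  qed
qed

instantiation L2 :: real_vector
begin

lift_definition zero_L2 :: L2 is "\<lambda>x. 0"
  by (simp add: square_integrable_zero)

lift_definition plus_L2 :: "L2 \<Rightarrow> L2 \<Rightarrow> L2" is "\<lambda>f g x. f x + g x"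
  by (elim conjE, intro conjI square_integrable_add, assumption+) (erule (1) eventually_elim2, simp)

lift_definition minus_L2 :: "L2 \<Rightarrow> L2 \<Rightarrow> L2" is "\<lambda>f g x. f x - g x"
  by (elim conjE, intro conjI square_integrable_diff, assumption+) (erule (1) eventually_elim2, simp)

lift_definition uminus_L2 :: "L2 \<Rightarrow> L2" is "\<lambda>f x. - f x"
  by (elim conjE, intro conjI square_integrable_uminus, assumption+) (erule eventually_mono, simp)

lift_definition scaleR_L2 :: "real \<Rightarrow> L2 \<Rightarrow> L2" is "\<lambda>r f x. r *\<^sub>R f x"
  by (elim conjE, intro conjI square_integrable_scaleR, assumption+) (erule eventually_mono, simp)

instance
proof
  fix a b c :: L2 and r s :: real
  show "a + b + c = a + (b + c)"
    by transfer (simp add: square_integrable_add add.assoc)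
  show "a + b = b + a"
    by transfer (simp add: square_integrable_add add.commute)
  show "0 + a = a" by transfer simp
  show "- a + a = 0"
    by transfer (simp add: square_integrable_zero)
  show "a - b = a + - b"
    by transfer (simp add: square_integrable_diff)
  show "r *\<^sub>R (a + b) = r *\<^sub>R a + r *\<^sub>R b"
    by transfer (simp add: square_integrable_add square_integrable_scaleR scaleR_add_right)
  show "(r + s) *\<^sub>R a = r *\<^sub>R a + s *\<^sub>R a"
    by transfer (simp add: square_integrable_add square_integrable_scaleR scaleR_add_left)
  show "r *\<^sub>R s *\<^sub>R a = (r * s) *\<^sub>R a"
    by transfer (simp add: square_integrable_scaleR)
  show "1 *\<^sub>R a = a" by transfer simp
qed

end

instantiation L2 :: real_inner
begin

text \<open>
  On complex numbers, \<open>a \<bullet> b\<close> is the real part of \<open>a\<close> times the conjugate of \<open>b\<close>; so this is the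
  real part of the usual complex inner product, and it induces the usual norm.
\<close>
lift_definition inner_L2 :: "L2 \<Rightarrow> L2 \<Rightarrow> real" is "\<lambda>f g. integral\<^sup>L lebesgue (\<lambda>x. f x \<bullet> g x)"
proof -
  fix f f' g g' :: "real \<Rightarrow> complex"
  assume a: "square_integrable f \<and> square_integrable f' \<and> (AE x in lebesgue. f x = f' x)"
    and b: "square_integrable g \<and> square_integrable g' \<and> (AE x in lebesgue. g x = g' x)"
  show "integral\<^sup>L lebesgue (\<lambda>x. f x \<bullet> g x) = integral\<^sup>L lebesgue (\<lambda>x. f' x \<bullet> g' x)"
  proof (rule integral_cong_AE)
    show "(\<lambda>x. f x \<bullet> g x) \<in> borel_measurable lebesgue"
         "(\<lambda>x. f' x \<bullet> g' x) \<in> borel_measurable lebesgue"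
      using a b by (auto simp: square_integrable_def)
    show "AE x in lebesgue. f x \<bullet> g x = f' x \<bullet> g' x"
      by (rule eventually_elim2[OF conjunct2[OF conjunct2[OF a]] conjunct2[OF conjunct2[OF b]]]) simp
  qed
qed

definition norm_L2 :: "L2 \<Rightarrow> real" where "norm_L2 u = sqrt (u \<bullet> u)"
definition dist_L2 :: "L2 \<Rightarrow> L2 \<Rightarrow> real" where "dist_L2 u v = norm (u - v)"
definition sgn_L2 :: "L2 \<Rightarrow> L2" where "sgn_L2 u = u /\<^sub>R norm u"
definition uniformity_L2 :: "(L2 \<times> L2) filter" where
  "uniformity_L2 = (INF e\<in>{0<..}. principal {(u, v). dist u v < e})"
definition open_L2 :: "L2 set \<Rightarrow> bool" where
  "open_L2 U \<longleftrightarrow> (\<forall>u\<in>U. eventually (\<lambda>(u', v). u' = u \<longrightarrow> v \<in> U) uniformity)"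

instance
proof
  fix a b c :: L2 and r :: real and U :: "L2 set"
  show "dist a b = norm (a - b)" by (rule dist_L2_def)
  show "sgn a = a /\<^sub>R norm a" by (rule sgn_L2_def)
  show "uniformity = (INF e\<in>{0<..}. principal {(u :: L2, v). dist u v < e})"
    by (rule uniformity_L2_def)
  show "open U \<longleftrightarrow> (\<forall>u\<in>U. eventually (\<lambda>(u', v). u' = u \<longrightarrow> v \<in> U) uniformity)"
    by (rule open_L2_def)
  show "a \<bullet> b = b \<bullet> a" by transfer (simp add: inner_commute)
  show "(a + b) \<bullet> c = a \<bullet> c + b \<bullet> c"
    by transfer (simp add: inner_add_left square_integrable_inner)
  show "(r *\<^sub>R a) \<bullet> b = r * (a \<bullet> b)"
    by transfer simp
  show "0 \<le> a \<bullet> a" by transfer simp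
  show "a \<bullet> a = 0 \<longleftrightarrow> a = 0"
  proof transfer
    fix f :: "real \<Rightarrow> complex"
    assume "square_integrable f \<and> square_integrable f \<and> (AE x in lebesgue. f x = f x)"
    then have f: "square_integrable f" by simp
    have "integral\<^sup>L lebesgue (\<lambda>x. f x \<bullet> f x) = 0 \<longleftrightarrow> (AE x in lebesgue. f x \<bullet> f x = 0)"
      by (rule integral_nonneg_eq_0_iff_AE[OF square_integrable_inner[OF f f]]) simp
    then show "integral\<^sup>L lebesgue (\<lambda>x. f x \<bullet> f x) = 0 \<longleftrightarrow>
        square_integrable f \<and> square_integrable (\<lambda>x. 0) \<and> (AE x in lebesgue. f x = 0)"
      using f by (simp add: square_integrable_zero)
  qed
  show "norm a = sqrt (a \<bullet> a)" by (rule norm_L2_def)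
qed

end

lift_definition scaleC_L2 :: "complex \<Rightarrow> L2 \<Rightarrow> L2"  (infixr "*\<^sub>C" 75) is "\<lambda>c f x. c * f x"
  by (elim conjE, intro conjI square_integrable_cmult, assumption+) (erule eventually_mono, simp)

text \<open>
  For a measurable set \<open>\<Omega>\<close>, the space \<open>L\<^sub>2(\<Omega>)\<close> is identified with the subspace of those
  elements of \<open>L\<^sub>2(\<real>)\<close> that vanish almost everywhere outside \<open>\<Omega>\<close> (extension by zero).
  Under this identification, \<open>L2_class \<Omega> f\<close> is the class in \<open>L\<^sub>2(\<Omega>)\<close> of a function
  \<open>f\<close> with \<open>L2_fun \<Omega> f\<close>; the values of \<open>f\<close> outside \<open>\<Omega>\<close> are irrelevant.
\<close>
definition L2_fun :: "real set \<Rightarrow> (real \<Rightarrow> complex) \<Rightarrow> bool" where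
  "L2_fun \<Omega> f \<longleftrightarrow> square_integrable (\<lambda>x. indicator \<Omega> x *\<^sub>R f x)"

definition L2_class :: "real set \<Rightarrow> (real \<Rightarrow> complex) \<Rightarrow> L2" where
  "L2_class \<Omega> f = abs_L2 (\<lambda>x. indicator \<Omega> x *\<^sub>R f x)"


section \<open>Sobolev functions\<close>

text \<open>
  \<open>f\<close> is absolutely continuous on every compact interval contained in \<open>\<Omega>\<close> and \<open>g\<close> is its
  derivative almost everywhere. For open \<open>\<Omega>\<close> this says that \<open>g\<close> is the locally integrable
  distributional derivative of \<open>f\<close> and that \<open>f\<close> is the continuous representative of its class.
\<close>
definition has_ac_derivative :: "(real \<Rightarrow> complex) \<Rightarrow> (real \<Rightarrow> complex) \<Rightarrow> real set \<Rightarrow> bool" where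
  "has_ac_derivative f g \<Omega> \<longleftrightarrow>
     (\<forall>a b. a \<le> b \<and> {a..b} \<subseteq> \<Omega> \<longrightarrow>
        g absolutely_integrable_on {a..b} \<and> (g has_integral (f b - f a)) {a..b})"

definition W22_fun ::
  "real set \<Rightarrow> (real \<Rightarrow> complex) \<Rightarrow> (real \<Rightarrow> complex) \<Rightarrow> (real \<Rightarrow> complex) \<Rightarrow> bool" where
  "W22_fun \<Omega> y y' y'' \<longleftrightarrow>
     has_ac_derivative y y' \<Omega> \<and> has_ac_derivative y' y'' \<Omega> \<and>
     L2_fun \<Omega> y \<and> L2_fun \<Omega> y' \<and> L2_fun \<Omega> y''"

definition W22 :: "real set \<Rightarrow> L2 set" where
  "W22 \<Omega> = {L2_class \<Omega> y | y y' y''. W22_fun \<Omega> y y' y''}"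


section \<open>Unbounded operators, given by their graphs\<close>

type_synonym L2_operator = "(L2 \<times> L2) set"

definition eigenvalue :: "L2_operator \<Rightarrow> complex \<Rightarrow> bool" where
  "eigenvalue A z \<longleftrightarrow> (\<exists>u. u \<noteq> 0 \<and> (u, z *\<^sub>C u) \<in> A)"

text \<open>
  \<open>(u, f + z *\<^sub>C u) \<in> A\<close> says that \<open>u\<close> is in the domain of \<open>A\<close> and \<open>(A - z) u = f\<close>.
\<close>
definition resolvent :: "L2_operator \<Rightarrow> complex \<Rightarrow> L2 \<Rightarrow> L2" where
  "resolvent A z f = (THE u. (u, f + z *\<^sub>C u) \<in> A)"

definition resolvent_set :: "L2_operator \<Rightarrow> complex set" where
  "resolvent_set A =
     {z. (\<forall>f. \<exists>!u. (u, f + z *\<^sub>C u) \<in> A) \<and> bounded_linear (resolvent A z)}"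

definition norm_resolvent_convergent :: "(real \<Rightarrow> L2_operator) \<Rightarrow> L2_operator \<Rightarrow> bool" where
  "norm_resolvent_convergent S S\<^sub>0 \<longleftrightarrow>
     (\<forall>z. z \<notin> \<real> \<longrightarrow>
        z \<in> resolvent_set S\<^sub>0 \<and>
        (\<forall>\<epsilon>>0. z \<in> resolvent_set (S \<epsilon>)) \<and>
        ((\<lambda>\<epsilon>. onorm (\<lambda>f. resolvent (S \<epsilon>) z f - resolvent S\<^sub>0 z f)) \<longlongrightarrow> 0) (at_right 0))"

definition direct_sum :: "L2_operator \<Rightarrow> L2_operator \<Rightarrow> L2_operator" where
  "direct_sum A B = {(u + v, f + g) | u v f g. (u, f) \<in> A \<and> (v, g) \<in> B}"


section \<open>The Schroedinger and Sturm-Liouville operators\<close>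

text \<open>
  \<open>SL_fun \<Omega> Q y y' y''\<close>: the function \<open>y\<close> lies in the domain of the differential expression
  \<open>- y'' + Q y\<close> in \<open>L\<^sub>2(\<Omega>)\<close>. When \<open>Q\<close> is merely integrable, neither \<open>y''\<close> nor \<open>Q y\<close> need be
  square integrable, and square integrability of the second derivative in the definition of
  \<open>W\<^sub>2\<^sup>2\<close> has to be read as square integrability of \<open>- y'' + Q y\<close>. If \<open>Q\<close> is square integrable with
  compact support, the domain on the real line is exactly \<open>W\<^sub>2\<^sup>2(\<real>)\<close>; see the lemma
  \<open>Domain_schroedinger\<close> below.
\<close>
definition SL_fun :: "real set \<Rightarrow> (real \<Rightarrow> real) \<Rightarrow>
    (real \<Rightarrow> complex) \<Rightarrow> (real \<Rightarrow> complex) \<Rightarrow> (real \<Rightarrow> complex) \<Rightarrow> bool" where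
  "SL_fun \<Omega> Q y y' y'' \<longleftrightarrow>
     has_ac_derivative y y' \<Omega> \<and> has_ac_derivative y' y'' \<Omega> \<and>
     L2_fun \<Omega> y \<and> L2_fun \<Omega> y' \<and> L2_fun \<Omega> (\<lambda>x. - y'' x + of_real (Q x) * y x)"

definition schroedinger :: "(real \<Rightarrow> real) \<Rightarrow> L2_operator" where
  "schroedinger Q =
     {(L2_class UNIV y, L2_class UNIV (\<lambda>x. - y'' x + of_real (Q x) * y x)) | y y' y''.
        SL_fun UNIV Q y y' y''}"

definition S_eps :: "(real \<Rightarrow> real) \<Rightarrow> real \<Rightarrow> L2_operator" where
  "S_eps V \<epsilon> = schroedinger (\<lambda>x. 1 / \<epsilon>\<^sup>2 * V (x / \<epsilon>))"

text \<open>On the closed interval, \<open>y'\<close> is continuous up to the end points and \<open>y' (-1)\<close>, \<open>y' 1\<close> are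
  the one-sided derivatives of \<open>y\<close>.\<close>
definition neumann :: "(real \<Rightarrow> real) \<Rightarrow> L2_operator" where
  "neumann V =
     {(L2_class {-1..1} y, L2_class {-1..1} (\<lambda>x. - y'' x + of_real (V x) * y x)) | y y' y''.
        SL_fun {-1..1} V y y' y'' \<and> y' (-1) = 0 \<and> y' 1 = 0}"

definition S_minus :: L2_operator where
  "S_minus = {(L2_class {..<0} y, L2_class {..<0} (\<lambda>x. - y'' x)) | y y' y''.
     W22_fun {..<0} y y' y'' \<and> (y \<longlongrightarrow> 0) (at_left 0)}"

definition S_plus :: L2_operator where
  "S_plus = {(L2_class {0<..} y, L2_class {0<..} (\<lambda>x. - y'' x)) | y y' y''.
     W22_fun {0<..} y y' y'' \<and> (y \<longlongrightarrow> 0) (at_right 0)}"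


lemma has_ac_derivative_continuous:
  assumes "has_ac_derivative f g UNIV"
  shows "continuous_on {a..b} f"
proof (cases "a \<le> b")
  case True
  have *: "f x = f a + integral {a..x} g" if "a \<le> x" for x
  proof -
    have "(g has_integral (f x - f a)) {a..x}"
      using assms that unfolding has_ac_derivative_def by simp
    then have "integral {a..x} g = f x - f a" by (rule integral_unique)
    then show ?thesis by simp
  qed
  have "g integrable_on {a..b}"
    using assms True unfolding has_ac_derivative_def by (auto intro: has_integral_integrable)
  then have "continuous_on {a..b} (\<lambda>x. f a + integral {a..x} g)"
    by (intro continuous_intros indefinite_integral_continuous_1)
  then show ?thesis
    by (rule continuous_on_eq) (rule *[symmetric], simp)
qed simp

lemma Domain_schroedinger:
  assumes Q: "Q \<in> borel_measurable lebesgue" "integrable lebesgue (\<lambda>x. (Q x)\<^sup>2)"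
    and supp: "\<And>x. x \<notin> {a..b} \<Longrightarrow> Q x = 0"
  shows "Domain (schroedinger Q) = W22 UNIV"
proof -
  have prod: "square_integrable (\<lambda>x. of_real (Q x) * y x)"
    if y: "has_ac_derivative y y' UNIV" "L2_fun UNIV y" for y y'
  proof -
    have ym: "y \<in> borel_measurable lebesgue"
      using y(2) by (simp add: L2_fun_def square_integrable_def)
    have "compact (y ` {a..b})"
      by (intro compact_continuous_image has_ac_derivative_continuous[OF y(1)] compact_Icc)
    then obtain C where C: "\<And>x. x \<in> {a..b} \<Longrightarrow> norm (y x) \<le> C"
      by (meson bounded_iff compact_imp_bounded imageI)
    have m: "(\<lambda>x. of_real (Q x) * y x) \<in> borel_measurable lebesgue"
      using Q(1) ym by measurable
    have "integrable lebesgue (\<lambda>x. (norm (of_real (Q x) * y x))\<^sup>2)"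
    proof (rule Bochner_Integration.integrable_bound)
      show "integrable lebesgue (\<lambda>x. C\<^sup>2 * (Q x)\<^sup>2)" using Q(2) by simp
      show "(\<lambda>x. (norm (of_real (Q x) * y x))\<^sup>2) \<in> borel_measurable lebesgue"
        using m by measurable
      have "(norm (of_real (Q x) * y x))\<^sup>2 \<le> C\<^sup>2 * (Q x)\<^sup>2" for x
      proof (cases "x \<in> {a..b}")
        case True
        have "(norm (y x))\<^sup>2 \<le> C\<^sup>2" using C[OF True] by (intro power_mono) auto
        then show ?thesis
          using mult_left_mono[of "(norm (y x))\<^sup>2" "C\<^sup>2" "(Q x)\<^sup>2"]
          by (simp add: norm_mult power_mult_distrib mult.commute)
      qed (simp add: supp)
      then show "AE x in lebesgue. norm ((norm (of_real (Q x) * y x))\<^sup>2) \<le> norm (C\<^sup>2 * (Q x)\<^sup>2)"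
        by (intro AE_I2) simp
    qed
    with m show ?thesis by (simp add: square_integrable_def)
  qed
  have "SL_fun UNIV Q y y' y'' \<longleftrightarrow> W22_fun UNIV y y' y''" for y y' y''
  proof -
    have "square_integrable (\<lambda>x. - y'' x + of_real (Q x) * y x) \<longleftrightarrow> square_integrable y''"
      if "has_ac_derivative y y' UNIV" "L2_fun UNIV y"
      using square_integrable_diff[OF prod[OF that],
          of "\<lambda>x. - y'' x + of_real (Q x) * y x"]
        square_integrable_add[OF square_integrable_uminus prod[OF that], of y'']
      by auto
    then show ?thesis
      by (auto simp: SL_fun_def W22_fun_def L2_fun_def)
  qed
  then show ?thesis
    by (auto simp: schroedinger_def W22_def Domain_iff)
qed

end

theory Submission
  imports Defs
begin

text \<open>
  Fix a non-real \<open>z\<close> and write \<open>z = - k\<^sup>2\<close> with \<open>Re k > 0\<close>. For \<open>f\<close> in \<open>L\<^sub>2\<close> let \<open>y\<close> be the free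
  solution of \<open>- y'' + k\<^sup>2 y = f\<close> on the whole line (\<open>free_resolvent_exists\<close>); it obeys
  \<open>|y|, |y'| \<le> c \<parallel>f\<parallel>\<close>. Both resolvents are corrections of \<open>y\<close> by decaying exponentials:
  the decoupled Dirichlet resolvent is \<open>v x = y x - y 0 e\<^bsup>-k|x|\<^esup>\<close>, while the resolvent of
  \<open>S\<^sub>\<epsilon>\<close> is a function \<open>u\<close> that equals \<open>y\<close> plus a multiple of \<open>e\<^bsup>-k|x|\<^esup>\<close> on either side of
  \<open>[-\<epsilon>, \<epsilon>]\<close> and solves the equation inside, the matching being the Robin conditions
  \<open>u' \<plusminus> k u = y' \<plusminus> k y\<close> at \<open>\<plusminus>\<epsilon>\<close>.

  Outside \<open>[-\<epsilon>, \<epsilon>]\<close> the difference \<open>u - v\<close> is therefore a single exponential whose coefficient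
  is governed by the values of \<open>u\<close> and \<open>v\<close> at \<open>\<plusminus>\<epsilon>\<close>, and inside it lives on a set of
  measure \<open>2 \<epsilon>\<close>. So everything reduces to the bound \<open>|u| \<le> C \<epsilon> \<parallel>f\<parallel>\<close> on \<open>[-\<epsilon>, \<epsilon>]\<close>, and this is where the Neumann
  operator enters. The rescaled function \<open>Y t = u (\<epsilon> t)\<close> satisfies \<open>Y'' = V Y + r\<close> on \<open>[-1, 1]\<close>,
  where \<open>r\<close> carries a factor \<open>\<epsilon>\<^sup>2\<close>, and \<open>Y' (\<plusminus>1) = \<epsilon> u' (\<plusminus>\<epsilon>)\<close> is of order
  \<open>\<epsilon> (\<parallel>f\<parallel> + sup |u|)\<close> by the Robin conditions. If \<open>0\<close> is not a Neumann eigenvalue, then \<open>Y\<close> is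
  controlled by its Neumann data and \<open>r\<close> (\<open>neumann_data_bound\<close>), and for small \<open>\<epsilon>\<close> the terms
  containing \<open>sup |u|\<close> are absorbed (\<open>inner_solution_bound\<close>). Altogether
  \<open>\<parallel>u - v\<parallel> \<le> K \<surd>\<epsilon> \<parallel>f\<parallel>\<close> (\<open>resolvent_difference_bound\<close>).

  That \<open>u\<close> and \<open>v\<close> really are the resolvents, and that these are bounded, needs only Green's
  formula: \<open>Im \<langle>g, u\<rangle> = 0\<close> for \<open>(u, g)\<close> in the graph gives \<open>|Im z| \<parallel>u\<parallel> \<le> \<parallel>g - z u\<parallel>\<close>, hence
  uniqueness and boundedness, and surjectivity is the explicit construction
  (\<open>symmetric_graph_resolvent_set\<close>). The same inequality shows that the Robin problem inside is
  solvable (\<open>outgoing_solution_nonzero\<close>). As \<open>V\<close> is merely integrable, the differential equations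
  are understood in the sense of absolutely continuous functions, and the initial value problem
  is solved through its Volterra integral equation (\<open>initial_value_exists\<close>).
\<close>


section \<open>Calculus of absolutely continuous functions\<close>

lemma has_ac_derivative_subset:
  "has_ac_derivative f g A \<Longrightarrow> B \<subseteq> A \<Longrightarrow> has_ac_derivative f g B"
  unfolding has_ac_derivative_def by blast

lemma has_ac_derivative_cong:
  assumes "has_ac_derivative f g A"
    and "\<And>x. x \<in> A \<Longrightarrow> f' x = f x" "\<And>x. x \<in> A \<Longrightarrow> g' x = g x"
  shows "has_ac_derivative f' g' A"
  unfolding has_ac_derivative_def
proof (intro allI impI)
  fix a b :: real assume ab: "a \<le> b \<and> {a..b} \<subseteq> A"
  then have "g absolutely_integrable_on {a..b}" "(g has_integral (f b - f a)) {a..b}"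
    using assms(1) by (auto simp: has_ac_derivative_def)
  moreover have ends: "f' a = f a" "f' b = f b" using ab assms(2) by auto
  have eq: "\<And>x. x \<in> {a..b} \<Longrightarrow> g x = g' x" using ab assms(3) by fastforce
  have "(g' has_integral y) {a..b}" if "(g has_integral y) {a..b}" for y
    using that by (rule has_integral_eq[rotated]) (rule eq)
  moreover have "set_integrable lebesgue {a..b} g = set_integrable lebesgue {a..b} g'"
    by (rule set_integrable_cong) (simp_all add: eq)
  ultimately show "g' absolutely_integrable_on {a..b} \<and> (g' has_integral (f' b - f' a)) {a..b}"
    by (simp add: ends)
qed

lemma has_ac_derivativeD:
  assumes "has_ac_derivative f g A" "a \<le> b" "{a..b} \<subseteq> A"
  shows "g absolutely_integrable_on {a..b}" "(g has_integral (f b - f a)) {a..b}"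
  using assms by (auto simp: has_ac_derivative_def)

text \<open>
  The derivative only matters almost everywhere. When two solutions are joined at a point, the
  differential equation may fail at that point, because the potential need not vanish there.
\<close>
lemma has_ac_derivative_spike:
  assumes f: "has_ac_derivative f g A" and N: "negligible N" and eq: "\<And>x. x \<in> A - N \<Longrightarrow> g' x = g x"
  shows "has_ac_derivative f g' A"
  unfolding has_ac_derivative_def
proof (intro allI impI conjI)
  fix a b :: real assume ab: "a \<le> b \<and> {a..b} \<subseteq> A"
  then have eq': "g' x = g x" if "x \<in> {a..b} - N" for x using eq that by blast
  have D: "g absolutely_integrable_on {a..b}" "(g has_integral (f b - f a)) {a..b}"
    using has_ac_derivativeD[OF f, of a b] ab by auto
  show "g' absolutely_integrable_on {a..b}" by (rule absolutely_integrable_spike[OF D(1) N eq'])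
  show "(g' has_integral (f b - f a)) {a..b}" by (rule has_integral_spike[OF N eq' D(2)])
qed

lemma has_ac_derivative_absolutely_integrable:
  assumes "has_ac_derivative f g A" "{a..b} \<subseteq> A"
  shows "g absolutely_integrable_on {a..b}"
  using assms by (cases "a \<le> b") (auto simp: has_ac_derivative_def)

lemma has_ac_derivative_integral:
  assumes "has_ac_derivative f g A" "{a..b} \<subseteq> A" "a \<le> b"
  shows "f b - f a = integral {a..b} g"
proof -
  have "(g has_integral (f b - f a)) {a..b}" using assms by (simp add: has_ac_derivative_def)
  then show ?thesis by (simp add: integral_unique)
qed

lemma has_ac_derivativeI:
  assumes "\<And>a b. a \<le> b \<Longrightarrow> {a..b} \<subseteq> A \<Longrightarrow> g absolutely_integrable_on {a..b}"
    and "\<And>a b. a \<le> b \<Longrightarrow> {a..b} \<subseteq> A \<Longrightarrow> f b - f a = integral {a..b} g"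
  shows "has_ac_derivative f g A"
  unfolding has_ac_derivative_def
proof (intro allI impI)
  fix a b :: real assume ab: "a \<le> b \<and> {a..b} \<subseteq> A"
  then have "g absolutely_integrable_on {a..b}" using assms(1) by simp
  moreover from this have "g integrable_on {a..b}" by (simp add: absolutely_integrable_on_def)
  ultimately show "g absolutely_integrable_on {a..b} \<and> (g has_integral (f b - f a)) {a..b}"
    using assms(2) ab by (simp add: has_integral_iff)
qed

lemma has_ac_derivative_continuous_on_Icc:
  assumes "has_ac_derivative f g A" "{a..b} \<subseteq> A"
  shows "continuous_on {a..b} f"
proof (cases "a \<le> b")
  case True
  have "g integrable_on {a..b}"
    using has_ac_derivative_absolutely_integrable[OF assms] by (simp add: absolutely_integrable_on_def)
  then have "continuous_on {a..b} (\<lambda>x. f a + integral {a..x} g)"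
    by (intro continuous_intros indefinite_integral_continuous_1)
  then show ?thesis
  proof (rule continuous_on_eq)
    fix x assume x: "x \<in> {a..b}"
    then have "{a..x} \<subseteq> A" using assms(2) by auto
    then have "f x - f a = integral {a..x} g"
      using x by (intro has_ac_derivative_integral[OF assms(1)]) auto
    then show "f a + integral {a..x} g = f x" by (simp add: algebra_simps)
  qed
qed simp

lemma has_ac_derivative_continuous_UNIV:
  assumes "has_ac_derivative f g UNIV"
  shows "continuous_on UNIV f"
proof (rule continuous_at_imp_continuous_on, rule ballI)
  fix x :: real
  have "continuous_on {x-1..x+1} f" by (rule has_ac_derivative_continuous_on_Icc[OF assms]) simp
  then show "isCont f x" by (rule continuous_on_interior) simp
qed

lemma has_ac_derivative_norm_le:
  assumes "has_ac_derivative f g A" "{a..b} \<subseteq> A" "a \<le> b"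
    and "h integrable_on {a..b}" "\<And>x. x \<in> {a..b} \<Longrightarrow> norm (g x) \<le> h x"
  shows "norm (f b - f a) \<le> integral {a..b} h"
proof -
  have "g integrable_on {a..b}"
    using has_ac_derivative_absolutely_integrable[OF assms(1,2)] by (simp add: absolutely_integrable_on_def)
  then show ?thesis
    unfolding has_ac_derivative_integral[OF assms(1-3)]
    by (rule integral_norm_bound_integral[OF _ assms(4,5)])
qed

lemma has_ac_derivative_bounded:
  assumes h: "has_ac_derivative f g A" and J: "is_interval J" "J \<subseteq> A"
    and i: "set_integrable lebesgue J g"
  shows "\<exists>B. \<forall>x\<in>J. norm (f x) \<le> B"
proof (cases "J = {}")
  case False
  then obtain c where c: "c \<in> J" by blast
  define I where "I = integral J (\<lambda>x. norm (g x))"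
  have iJ: "(\<lambda>x. norm (g x)) integrable_on J" using i by (simp add: absolutely_integrable_on_def)
  have *: "norm (f v - f u) \<le> I" if uv: "u \<le> v" "u \<in> J" "v \<in> J" for u v
  proof -
    have sub: "{u..v} \<subseteq> J" by (auto intro: mem_is_interval_1_I[OF J(1) uv(2,3)])
    have iu: "(\<lambda>x. norm (g x)) integrable_on {u..v}" using iJ sub by (rule integrable_on_subinterval)
    have "norm (f v - f u) \<le> integral {u..v} (\<lambda>x. norm (g x))"
      by (rule has_ac_derivative_norm_le[OF h]) (use sub J(2) uv iu in auto)
    also have "\<dots> \<le> I" unfolding I_def by (rule integral_subset_le[OF sub iu iJ]) simp
    finally show ?thesis .
  qed
  have "norm (f x) \<le> norm (f c) + I" if "x \<in> J" for x
  proof -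
    have "norm (f x - f c) \<le> I"
      using *[of x c] *[of c x] c that by (cases "x \<le> c") (auto simp: norm_minus_commute)
    then show ?thesis using norm_triangle_ineq2[of "f x" "f c"] by linarith
  qed
  then show ?thesis by blast
qed simp

lemma has_ac_derivative_add:
  assumes "has_ac_derivative f f' A" "has_ac_derivative g g' A"
  shows "has_ac_derivative (\<lambda>x. f x + g x) (\<lambda>x. f' x + g' x) A"
  unfolding has_ac_derivative_def
proof (intro allI impI conjI)
  fix a b :: real assume ab: "a \<le> b \<and> {a..b} \<subseteq> A"
  then show "(\<lambda>x. f' x + g' x) absolutely_integrable_on {a..b}"
    using assms by (auto simp: has_ac_derivative_def)
  have "((\<lambda>x. f' x + g' x) has_integral (f b - f a) + (g b - g a)) {a..b}"
    using ab assms by (intro has_integral_add) (auto simp: has_ac_derivative_def)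
  then show "((\<lambda>x. f' x + g' x) has_integral (f b + g b - (f a + g a))) {a..b}"
    by (simp add: algebra_simps)
qed

lemma has_ac_derivative_cmult:
  assumes "has_ac_derivative f f' A"
  shows "has_ac_derivative (\<lambda>x. c * f x) (\<lambda>x. c * f' x) A"
  unfolding has_ac_derivative_def
proof (intro allI impI conjI)
  fix a b :: real assume ab: "a \<le> b \<and> {a..b} \<subseteq> A"
  then show "(\<lambda>x. c * f' x) absolutely_integrable_on {a..b}"
    using assms by (auto simp: has_ac_derivative_def)
  have "((\<lambda>x. c * f' x) has_integral c * (f b - f a)) {a..b}"
    using ab assms by (intro has_integral_mult_right) (auto simp: has_ac_derivative_def)
  then show "((\<lambda>x. c * f' x) has_integral (c * f b - c * f a)) {a..b}"
    by (simp add: algebra_simps)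
qed

lemma has_ac_derivative_diff:
  assumes "has_ac_derivative f f' A" "has_ac_derivative g g' A"
  shows "has_ac_derivative (\<lambda>x. f x - g x) (\<lambda>x. f' x - g' x) A"
  using has_ac_derivative_add[OF assms(1) has_ac_derivative_cmult[OF assms(2), of "-1"]] by simp

lemma has_ac_derivative_cnj:
  assumes "has_ac_derivative f f' A"
  shows "has_ac_derivative (\<lambda>x. cnj (f x)) (\<lambda>x. cnj (f' x)) A"
  unfolding has_ac_derivative_def
proof (intro allI impI conjI)
  fix a b :: real assume ab: "a \<le> b \<and> {a..b} \<subseteq> A"
  have f': "f' absolutely_integrable_on {a..b}" "(f' has_integral (f b - f a)) {a..b}"
    using ab assms by (auto simp: has_ac_derivative_def)
  show "(\<lambda>x. cnj (f' x)) absolutely_integrable_on {a..b}"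
    using absolutely_integrable_linear[OF f'(1) bounded_linear_cnj] by (simp add: o_def)
  show "((\<lambda>x. cnj (f' x)) has_integral (cnj (f b) - cnj (f a))) {a..b}"
    using has_integral_linear[OF f'(2) bounded_linear_cnj] by (simp add: o_def)
qed

lemma has_ac_derivative_C1:
  assumes "\<And>x. (f has_vector_derivative f' x) (at x)" "continuous_on UNIV f'"
  shows "has_ac_derivative f f' A"
  unfolding has_ac_derivative_def
proof (intro allI impI conjI)
  fix a b :: real assume ab: "a \<le> b \<and> {a..b} \<subseteq> A"
  show "f' absolutely_integrable_on {a..b}"
    using assms(2) by (intro absolutely_integrable_continuous_real continuous_on_subset[OF assms(2)]) auto
  show "(f' has_integral (f b - f a)) {a..b}"
    using ab assms(1) by (intro fundamental_theorem_of_calculus)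
      (auto intro: has_vector_derivative_at_within)
qed

lemma has_ac_derivative_exp:
  "has_ac_derivative (\<lambda>x. exp (c * of_real x)) (\<lambda>x. c * exp (c * of_real x)) A"
proof (rule has_ac_derivative_C1)
  fix x :: real
  have "((\<lambda>w. exp (c * w)) has_field_derivative c * exp (c * of_real x)) (at (of_real x))"
    by (auto intro!: derivative_eq_intros)
  then show "((\<lambda>x. exp (c * of_real x)) has_vector_derivative c * exp (c * of_real x)) (at x)"
    by (rule has_vector_derivative_real_field)
qed (intro continuous_intros)

text \<open>
  The exponential has a derivative of modulus at most \<open>|k|\<close> on the half line.
\<close>
lemma norm_one_minus_exp_le:
  assumes k: "Re k \<ge> 0" and e: "e \<ge> 0"
  shows "norm (1 - exp (- (k * of_real e))) \<le> norm k * e"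
proof -
  have "norm (exp ((-k) * of_real e) - exp ((-k) * of_real 0)) \<le> integral {0..e} (\<lambda>_. norm k)"
  proof (rule has_ac_derivative_norm_le[OF has_ac_derivative_exp[of "-k" UNIV]])
    fix x assume "x \<in> {0..e}"
    then have "norm (exp ((-k) * of_real x)) \<le> 1" using k by (simp add: norm_exp_eq_Re)
    then show "norm ((-k) * exp ((-k) * of_real x)) \<le> norm k"
      using mult_left_mono[of "norm (exp ((-k) * of_real x))" 1 "norm k"] by (simp add: norm_mult)
  qed (use e in auto)
  then show ?thesis using e by (simp add: norm_minus_commute mult.commute)
qed

lemma absolutely_integrable_continuous_mult:
  fixes f g :: "real \<Rightarrow> complex"
  assumes "continuous_on {a..b} f" "g absolutely_integrable_on {a..b}"
  shows "(\<lambda>x. f x * g x) absolutely_integrable_on {a..b}"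
proof (rule absolutely_integrable_bounded_measurable_product[where h = "(*)", OF _ _ _ _ assms(2)])
  show "bilinear ((*) :: complex \<Rightarrow> complex \<Rightarrow> complex)"
    by (simp add: bilinear_conv_bounded_bilinear bounded_bilinear_mult)
  show "f \<in> borel_measurable (lebesgue_on {a..b})"
    by (intro continuous_imp_measurable_on_sets_lebesgue assms(1)) auto
  show "bounded (f ` {a..b})"
    by (intro compact_imp_bounded compact_continuous_image assms(1)) auto
qed auto

text \<open>
  The increment of \<open>f g\<close> over a short interval differs from the integral of \<open>f' g + f g'\<close> by at
  most the oscillation of \<open>f\<close> and \<open>g\<close> times the integral of \<open>|f'| + |g'|\<close>. Such a bound adds up
  over adjacent intervals, so the bisection principle \<open>Bolzano\<close> extends it to the whole interval
  with an arbitrarily small constant.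
\<close>
lemma has_ac_derivative_mult:
  assumes "has_ac_derivative f f' A" "has_ac_derivative g g' A"
  shows "has_ac_derivative (\<lambda>x. f x * g x) (\<lambda>x. f' x * g x + f x * g' x) A"
proof (rule has_ac_derivativeI)
  fix a b :: real assume ab: "a \<le> b" "{a..b} \<subseteq> A"
  let ?F = "\<lambda>x. f' x * g x + f x * g' x"
  have f: "has_ac_derivative f f' {a..b}" and g: "has_ac_derivative g g' {a..b}"
    using assms ab(2) by (auto intro: has_ac_derivative_subset)
  have cf: "continuous_on {a..b} f" and cg: "continuous_on {a..b} g"
    using has_ac_derivative_continuous_on_Icc[OF f order_refl]
      has_ac_derivative_continuous_on_Icc[OF g order_refl] by auto
  have if': "f' absolutely_integrable_on {a..b}" and ig': "g' absolutely_integrable_on {a..b}"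
    using has_ac_derivative_absolutely_integrable[OF f order_refl]
      has_ac_derivative_absolutely_integrable[OF g order_refl] by auto
  show F: "?F absolutely_integrable_on {a..b}"
    using absolutely_integrable_continuous_mult[OF cf ig']
      absolutely_integrable_continuous_mult[OF cg if']
    by (simp add: mult.commute)
  let ?h = "\<lambda>x. norm (f' x) + norm (g' x)"
  have h: "?h integrable_on {a..b}"
    using if' ig' by (auto simp: absolutely_integrable_on_def intro: integrable_add)
  have sub: "u integrable_on {x..y}" if "u integrable_on {a..b}" "{x..y} \<subseteq> {a..b}"
    for u :: "real \<Rightarrow> 'z::banach" and x y
    using that integrable_on_subinterval by blast
  let ?D = "\<lambda>x y. f y * g y - f x * g x - integral {x..y} ?F"
  have key: "norm (?D a b) \<le> e * integral {a..b} ?h" if e: "e > 0" for e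
  proof -
    let ?P = "\<lambda>x y. {x..y} \<subseteq> {a..b} \<longrightarrow> norm (?D x y) \<le> e * integral {x..y} ?h"
    have "?P a b" 
    proof (rule Bolzano[where P = ?P, OF ab(1)])
      fix x y z assume trans: "?P x y" "?P y z" "x \<le> y" "y \<le> z"
      show "?P x z"
      proof
        assume xz: "{x..z} \<subseteq> {a..b}"
        then have P: "norm (?D x y) \<le> e * integral {x..y} ?h" "norm (?D y z) \<le> e * integral {y..z} ?h"
          using trans by auto
        have "integral {x..y} ?F + integral {y..z} ?F = integral {x..z} ?F"
          by (intro Henstock_Kurzweil_Integration.integral_combine trans sub[OF _ xz])
            (use F in \<open>simp add: absolutely_integrable_on_def\<close>)
        then have "?D x z = ?D x y + ?D y z" by (simp add: algebra_simps)
        then have "norm (?D x z) \<le> norm (?D x y) + norm (?D y z)"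
          by (simp only: norm_triangle_ineq)
        also have "\<dots> \<le> e * (integral {x..y} ?h + integral {y..z} ?h)"
          using P by (simp add: distrib_left)
        also have "integral {x..y} ?h + integral {y..z} ?h = integral {x..z} ?h"
          by (intro Henstock_Kurzweil_Integration.integral_combine trans sub[OF h xz])
        finally show "norm (?D x z) \<le> e * integral {x..z} ?h" .
      qed
    next
      fix c assume "a \<le> c" "c \<le> b"
      then have c: "c \<in> {a..b}" by simp
      obtain d1 where d1: "d1 > 0" "\<And>x. x \<in> {a..b} \<Longrightarrow> dist x c < d1 \<Longrightarrow> dist (f x) (f c) < e/2"
        using cf c half_gt_zero[OF e] unfolding continuous_on_iff by blast
      obtain d2 where d2: "d2 > 0" "\<And>x. x \<in> {a..b} \<Longrightarrow> dist x c < d2 \<Longrightarrow> dist (g x) (g c) < e/2"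
        using cg c half_gt_zero[OF e] unfolding continuous_on_iff by blast
      show "\<exists>d>0. \<forall>x y. x \<le> c \<and> c \<le> y \<and> y - x < d \<longrightarrow> ?P x y"
      proof (intro exI conjI allI impI)
        show "min d1 d2 > 0" using d1 d2 by simp
        fix x y assume xy: "x \<le> c \<and> c \<le> y \<and> y - x < min d1 d2" and sxy: "{x..y} \<subseteq> {a..b}"
        have le: "x \<le> y" using xy by simp
        have close: "norm (f s - f t) \<le> e" "norm (g s - g t) \<le> e" if "s \<in> {x..y}" "t \<in> {x..y}" for s t
        proof -
          have "s \<in> {a..b}" "t \<in> {a..b}" "dist s c < d1" "dist t c < d1" "dist s c < d2" "dist t c < d2"
            using that sxy xy by (auto simp: dist_real_def)
          then have "dist (f s) (f c) < e/2" "dist (f t) (f c) < e/2"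
              "dist (g s) (g c) < e/2" "dist (g t) (g c) < e/2"
            using d1 d2 by auto
          then have "dist (f s) (f t) < e" "dist (g s) (g t) < e"
            by (metis dist_triangle_half_l dist_commute)+
          then show "norm (f s - f t) \<le> e" "norm (g s - g t) \<le> e" by (auto simp: dist_norm)
        qed
        have i1: "(f' has_integral (f y - f x)) {x..y}" "(g' has_integral (g y - g x)) {x..y}"
          using f g le sxy by (auto simp: has_ac_derivative_def)
        have iF: "(?F has_integral integral {x..y} ?F) {x..y}"
          by (intro integrable_integral sub[OF _ sxy]) (use F in \<open>simp add: absolutely_integrable_on_def\<close>)
        \<comment> \<open>Freezing one factor at an end point makes the increment of the product an integral.\<close>
        have "((\<lambda>t. f' t * g y + f x * g' t - ?F t) has_integral
            ((f y - f x) * g y + f x * (g y - g x) - integral {x..y} ?F)) {x..y}"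
          by (rule has_integral_diff[OF has_integral_add[OF has_integral_mult_left[OF i1(1)]
                has_integral_mult_right[OF i1(2)]] iF])
        then have D: "((\<lambda>t. f' t * (g y - g t) + (f x - f t) * g' t) has_integral ?D x y) {x..y}"
          by (simp add: algebra_simps)
        have "norm (integral {x..y} (\<lambda>t. f' t * (g y - g t) + (f x - f t) * g' t))
            \<le> integral {x..y} (\<lambda>t. e * ?h t)"
        proof (rule integral_norm_bound_integral)
          show "(\<lambda>t. f' t * (g y - g t) + (f x - f t) * g' t) integrable_on {x..y}" using D by blast
          show "(\<lambda>t. e * ?h t) integrable_on {x..y}"
            using integrable_cmul[OF sub[OF h sxy], of e] by simp
          fix t assume t: "t \<in> {x..y}"
          have "norm (f' t * (g y - g t) + (f x - f t) * g' t)
              \<le> norm (f' t) * norm (g y - g t) + norm (f x - f t) * norm (g' t)"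
            by (metis norm_mult norm_triangle_ineq)
          also have "\<dots> \<le> norm (f' t) * e + e * norm (g' t)"
            using t le e by (intro add_mono mult_mono close) auto
          finally show "norm (f' t * (g y - g t) + (f x - f t) * g' t) \<le> e * ?h t"
            by (simp add: algebra_simps)
        qed
        then show "norm (?D x y) \<le> e * integral {x..y} ?h"
          using D by (simp add: integral_unique)
      qed
    qed
    then show ?thesis by simp
  qed
  have "norm (?D a b) \<le> 0"
  proof (rule field_le_epsilon)
    fix e :: real assume e: "e > 0"
    have I: "integral {a..b} ?h \<ge> 0" by (intro integral_nonneg h) simp
    have "norm (?D a b) \<le> e / (integral {a..b} ?h + 1) * integral {a..b} ?h"
      using e I by (intro key) simp
    also have "\<dots> \<le> e" using e I by (simp add: field_simps)
    finally show "norm (?D a b) \<le> 0 + e" by simp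
  qed
  then show "f b * g b - f a * g a = integral {a..b} ?F" by simp
qed

lemma has_ac_derivative_glue:
  assumes l: "has_ac_derivative f g (A \<inter> {..c})" and r: "has_ac_derivative f g (A \<inter> {c..})"
  shows "has_ac_derivative f g A"
  unfolding has_ac_derivative_def
proof (intro allI impI)
  fix a b :: real assume ab: "a \<le> b \<and> {a..b} \<subseteq> A"
  consider "b \<le> c" | "c \<le> a" | "a \<le> c" "c \<le> b" by linarith
  then show "g absolutely_integrable_on {a..b} \<and> (g has_integral (f b - f a)) {a..b}"
  proof cases
    case 1
    then have "{a..b} \<subseteq> A \<inter> {..c}" using ab by auto
    then show ?thesis using has_ac_derivativeD[OF l] ab by blast
  next
    case 2
    then have "{a..b} \<subseteq> A \<inter> {c..}" using ab by auto
    then show ?thesis using has_ac_derivativeD[OF r] ab by blast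
  next
    case 3
    have "{a..c} \<subseteq> {a..b}" "{c..b} \<subseteq> {a..b}" using 3 by auto
    then have *: "{a..c} \<subseteq> A \<inter> {..c}" "{c..b} \<subseteq> A \<inter> {c..}" using ab by auto
    have L: "g absolutely_integrable_on {a..c}" "(g has_integral (f c - f a)) {a..c}"
      using has_ac_derivativeD[OF l 3(1) *(1)] .
    have R: "g absolutely_integrable_on {c..b}" "(g has_integral (f b - f c)) {c..b}"
      using has_ac_derivativeD[OF r 3(2) *(2)] .
    have "g absolutely_integrable_on {a..b}"
      using absolutely_integrable_on_combine[OF L(1) R(1) 3] .
    moreover have "(g has_integral (f c - f a) + (f b - f c)) {a..b}"
      using has_integral_combine[OF 3 L(2) R(2)] .
    ultimately show ?thesis by simp
  qed
qed

lemma has_ac_derivative_scale: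
  assumes f: "has_ac_derivative f g A" and m: "m > 0" and sub: "\<And>x. x \<in> B \<Longrightarrow> m * x \<in> A"
    and conv: "is_interval A"
  shows "has_ac_derivative (\<lambda>x. f (m * x)) (\<lambda>x. of_real m * g (m * x)) B"
  unfolding has_ac_derivative_def
proof (intro allI impI conjI)
  fix a b :: real assume ab: "a \<le> b \<and> {a..b} \<subseteq> B"
  have "a \<in> {a..b}" "b \<in> {a..b}" using ab by auto
  then have "a \<in> B" "b \<in> B" using ab by blast+
  then have mA: "m * a \<in> A" "m * b \<in> A" by (auto intro: sub)
  then have s: "{m*a..m*b} \<subseteq> A" by (auto intro: mem_is_interval_1_I[OF conv mA])
  have le: "m*a \<le> m*b" using ab m by simp
  have g: "g absolutely_integrable_on {m*a..m*b}" "(g has_integral (f (m*b) - f (m*a))) {m*a..m*b}"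
    using has_ac_derivativeD[OF f le s] by auto
  have im: "(\<lambda>x. x / m) ` {m*a..m*b} = {a..b}"
    using m by (simp add: image_divide_atLeastAtMost)
  have "(\<lambda>x. g (m * x)) integrable_on {a..b}" "(\<lambda>x. norm (g (m * x))) integrable_on {a..b}"
    using integrable_stretch_real[of g "m*a" "m*b" m] integrable_stretch_real[of "\<lambda>x. norm (g x)" "m*a" "m*b" m] g(1) m
    unfolding im absolutely_integrable_on_def by auto
  then have "(\<lambda>x. g (m * x)) absolutely_integrable_on {a..b}" by (simp add: absolutely_integrable_on_def)
  then show "(\<lambda>x. of_real m * g (m * x)) absolutely_integrable_on {a..b}" by simp
  have "((\<lambda>x. of_real m * g (m * x)) has_integral of_real m * ((1/m) *\<^sub>R (f (m*b) - f (m*a)))) {a..b}"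
    using has_integral_mult_right[OF has_integral_stretch_real[OF g(2), of m], of "of_real m"] m
    unfolding im by simp
  then show "((\<lambda>x. of_real m * g (m * x)) has_integral f (m*b) - f (m*a)) {a..b}"
    using m by (simp add: scaleR_conv_of_real)
qed

lemma has_ac_derivative_reflect:
  assumes f: "has_ac_derivative f g A"
  shows "has_ac_derivative (\<lambda>x. f (- x)) (\<lambda>x. - g (- x)) {x. - x \<in> A}"
  unfolding has_ac_derivative_def
proof (intro allI impI conjI)
  fix a b :: real assume ab: "a \<le> b \<and> {a..b} \<subseteq> {x. - x \<in> A}"
  have "x \<in> A" if "x \<in> {-b..-a}" for x
  proof -
    have "- x \<in> {a..b}" using that by auto
    then have "- x \<in> {x. - x \<in> A}" using ab by blast
    then show ?thesis by simp
  qed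
  then have "{-b..-a} \<subseteq> A" by blast
  then have g: "g absolutely_integrable_on {-b..-a}" "(g has_integral (f (-a) - f (-b))) {-b..-a}"
    using has_ac_derivativeD[OF f, of "-b" "-a"] ab by auto
  have "(\<lambda>x. g (-x)) absolutely_integrable_on {a..b}"
    using g(1) absolutely_integrable_reflect_real[where f = g and a = "-b" and b = "-a"] by simp
  then have "(\<lambda>x. (-1) * g (-x)) absolutely_integrable_on {a..b}" by (rule set_integrable_mult_right)
  then show "(\<lambda>x. - g (-x)) absolutely_integrable_on {a..b}" by simp
  have "((\<lambda>x. g (-x)) has_integral (f (-a) - f (-b))) {a..b}"
    using has_integral_reflect_real[where f = g and i = "f (-a) - f (-b)" and a = "-b" and b = "-a"] g(2) by simp
  from has_integral_neg[OF this] show "((\<lambda>x. - g (-x)) has_integral (f (-b) - f (-a))) {a..b}" by simp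
qed


section \<open>The initial value problem with integrable coefficients\<close>

lemma has_ac_derivative_indefinite_integral:
  fixes m :: "real \<Rightarrow> complex"
  assumes "m absolutely_integrable_on {a..b}"
  shows "has_ac_derivative (\<lambda>x. c + integral {a..x} m) m {a..b}"
proof (rule has_ac_derivativeI)
  fix u v :: real assume uv: "u \<le> v" "{u..v} \<subseteq> {a..b}"
  then show "m absolutely_integrable_on {u..v}"
    by (meson absolutely_integrable_on_subinterval assms)
  have "a \<le> u" "v \<le> b" using uv by auto
  then have "{a..v} \<subseteq> {a..b}" by auto
  then have "m integrable_on {a..v}"
    using assms integrable_on_subinterval unfolding absolutely_integrable_on_def by blast
  then have "integral {a..u} m + integral {u..v} m = integral {a..v} m"
    using \<open>a \<le> u\<close> uv by (intro Henstock_Kurzweil_Integration.integral_combine)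
  then show "c + integral {a..v} m - (c + integral {a..u} m) = integral {u..v} m"
    by (simp add: algebra_simps)
qed

text \<open>
  The product rule for \<open>t \<mapsto> (x - t) y' t\<close>. It turns a second order equation for \<open>y\<close> into a
  Volterra integral equation.
\<close>
lemma has_ac_derivative_taylor:
  assumes y: "has_ac_derivative y y' {a..b}" "has_ac_derivative y' y'' {a..b}" and x: "x \<in> {a..b}"
  shows "((\<lambda>t. of_real (x - t) * y'' t) has_integral y x - (y a + of_real (x - a) * y' a)) {a..x}"
proof -
  have sub: "{a..x} \<subseteq> {a..b}" and ax: "a \<le> x" using x by auto
  have lin: "has_ac_derivative (\<lambda>t. of_real (x - t)) (\<lambda>_. -1) {a..b}"
    by (rule has_ac_derivative_C1) (auto intro!: derivative_eq_intros simp: has_vector_derivative_def scaleR_conv_of_real)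
  have "((\<lambda>t. -1 * y' t + of_real (x - t) * y'' t) has_integral
      (of_real (x - x) * y' x - of_real (x - a) * y' a)) {a..x}"
    using has_ac_derivativeD(2)[OF has_ac_derivative_mult[OF lin y(2)] ax sub] by simp
  from has_integral_add[OF this has_ac_derivativeD(2)[OF y(1) ax sub]]
  show ?thesis by (simp add: algebra_simps)
qed

text \<open>
  The Volterra kernel \<open>x - t\<close>, weighted by \<open>e\<^bsup>-L(x-t)\<^esup>\<close>, is at most \<open>1 / L\<close>. For
  large \<open>L\<close> this makes the Volterra operator a contraction for any integrable coefficient.
\<close>
lemma mult_exp_minus_le:
  fixes s L :: real
  assumes "L > 0"
  shows "s * exp (- (L * s)) \<le> 1 / L"
proof -
  have "L * s \<le> exp (L * s)" using exp_ge_add_one_self[of "L * s"] by linarith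
  then have "L * s * exp (- (L * s)) \<le> exp (L * s) * exp (- (L * s))" by (rule mult_right_mono) simp
  also have "\<dots> = 1" by (simp add: exp_minus_inverse)
  finally show ?thesis using assms by (simp add: field_simps)
qed

text \<open>
  The contraction estimate behind both the a priori bound and the existence proof below: in the
  norm \<open>sup e\<^bsup>-L(x-a)\<^esup> |w x|\<close>, integrating twice gains a factor \<open>1 / L\<close>. In the applications
  \<open>n = |q|\<close> for the coefficient \<open>q\<close> of the equation.
\<close>
lemma weighted_double_integral_bound:
  assumes w: "has_ac_derivative w w' {a..b}" "has_ac_derivative w' m {a..b}" and 0: "w a = 0" "w' a = 0"
    and m: "\<And>t. t \<in> {a..b} \<Longrightarrow> norm (m t) \<le> n t * (exp (L * (t - a)) * D)"
    and n: "n absolutely_integrable_on {a..b}" "\<And>t. t \<in> {a..b} \<Longrightarrow> 0 \<le> n t"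
    and L: "L > 0" and D: "D \<ge> 0" and x: "x \<in> {a..b}"
  shows "exp (- (L * (x - a))) * norm (w x) \<le> D / L * integral {a..b} n"
proof -
  have sub: "{a..x} \<subseteq> {a..b}" using x by auto
  have ni: "n integrable_on {a..b}" using n by (simp add: absolutely_integrable_on_def)
  then have nx: "n integrable_on {a..x}" using integrable_on_subinterval sub by blast
  have I: "((\<lambda>t. of_real (x - t) * m t) has_integral w x) {a..x}"
    using has_ac_derivative_taylor[OF w x] 0 by simp
  have "((\<lambda>t. of_real (exp (- (L * (x - a)))) * (of_real (x - t) * m t)) has_integral
      of_real (exp (- (L * (x - a)))) * w x) {a..x}"
    by (rule has_integral_mult_right[OF I])
  then have eq: "integral {a..x} (\<lambda>t. of_real (exp (- (L * (x - a)))) * (of_real (x - t) * m t))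
      = of_real (exp (- (L * (x - a)))) * w x"
    and int: "(\<lambda>t. of_real (exp (- (L * (x - a)))) * (of_real (x - t) * m t)) integrable_on {a..x}"
    by (rule integral_unique, rule has_integral_integrable)
  have "norm (of_real (exp (- (L * (x - a)))) * w x) \<le> integral {a..x} (\<lambda>t. D / L * n t)"
    unfolding eq[symmetric]
  proof (rule integral_norm_bound_integral[OF int])
    show "(\<lambda>t. D / L * n t) integrable_on {a..x}" using integrable_cmul[OF nx, of "D / L"] by simp
    fix t assume t: "t \<in> {a..x}"
    then have tb: "t \<in> {a..b}" using sub by blast
    have "norm (of_real (exp (- (L * (x - a)))) * (of_real (x - t) * m t))
        = exp (- (L * (x - a))) * ((x - t) * norm (m t))"
      using t by (simp add: norm_mult del: of_real_diff)
    also have "\<dots> \<le> exp (- (L * (x - a))) * ((x - t) * (n t * (exp (L * (t - a)) * D)))"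
      using t by (intro mult_left_mono m tb) auto
    also have "\<dots> = (x - t) * (exp (- (L * (x - a))) * exp (L * (t - a))) * (D * n t)"
      by (simp add: algebra_simps)
    also have "exp (- (L * (x - a))) * exp (L * (t - a)) = exp (- (L * (x - t)))"
      by (simp add: exp_add[symmetric] algebra_simps)
    also have "(x - t) * exp (- (L * (x - t))) * (D * n t) \<le> 1 / L * (D * n t)"
      using D n(2)[OF tb] by (intro mult_right_mono mult_exp_minus_le L) auto
    finally show "norm (of_real (exp (- (L * (x - a)))) * (of_real (x - t) * m t)) \<le> D / L * n t"
      by simp
  qed
  also have "\<dots> = D / L * integral {a..x} n" by simp
  also have "\<dots> \<le> D / L * integral {a..b} n"
    using D L n(2) by (intro mult_left_mono integral_subset_le sub nx ni) auto
  finally show ?thesis by (simp add: norm_mult)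
qed

text \<open>
  Split \<open>y = w + (y - w)\<close>, where \<open>w\<close> has zero initial data and \<open>w'' = q y\<close>. The weighted
  supremum \<open>M\<close> of \<open>y\<close> satisfies \<open>M \<le> M / 2 + c\<close>: the part \<open>w\<close> contributes \<open>M / 2\<close> by the
  contraction estimate, and \<open>y - w\<close> is bounded by Taylor's formula in terms of the initial data
  and \<open>r\<close>.
\<close>
lemma initial_value_bound:
  assumes y: "has_ac_derivative y y' {a..b}" "has_ac_derivative y' y'' {a..b}"
    and eq: "\<And>t. t \<in> {a..b} \<Longrightarrow> y'' t = q t * y t + r t"
    and q: "q absolutely_integrable_on {a..b}" and r: "r absolutely_integrable_on {a..b}"
    and ab: "a \<le> b" and x: "x \<in> {a..b}"
  shows "norm (y x) \<le> 2 * exp ((2 * integral {a..b} (\<lambda>t. norm (q t)) + 1) * (b - a)) *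
    (norm (y a) + (b - a) * norm (y' a) + (b - a) * integral {a..b} (\<lambda>t. norm (r t)))"
proof -
  define n where "n = (\<lambda>t. norm (q t))"
  define L where "L = 2 * integral {a..b} n + 1"
  define c where "c = norm (y a) + (b - a) * norm (y' a) + (b - a) * integral {a..b} (\<lambda>t. norm (r t))"
  have n: "n absolutely_integrable_on {a..b}" unfolding n_def using q by (rule absolutely_integrable_norm[unfolded o_def])
  have N0: "integral {a..b} n \<ge> 0" by (rule integral_nonneg) (use n in \<open>auto simp: absolutely_integrable_on_def n_def\<close>)
  then have L: "L \<ge> 1" by (simp add: L_def)
  have half: "integral {a..b} n / L \<le> 1/2" using N0 by (simp add: L_def)
  have cy: "continuous_on {a..b} y" by (rule has_ac_derivative_continuous_on_Icc[OF y(1) order_refl])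
  let ?g = "\<lambda>x. exp (- (L * (x - a))) * norm (y x)"
  have "\<exists>x\<in>{a..b}. \<forall>t\<in>{a..b}. ?g t \<le> ?g x"
    using ab by (intro continuous_attains_sup continuous_intros cy) auto
  then obtain s where s: "s \<in> {a..b}" "\<And>t. t \<in> {a..b} \<Longrightarrow> ?g t \<le> ?g s" by blast
  define M where "M = ?g s"
  have M0: "M \<ge> 0" by (simp add: M_def)
  have M: "norm (y t) \<le> exp (L * (t - a)) * M" if "t \<in> {a..b}" for t
  proof -
    have "exp (L * (t - a)) * ?g t \<le> exp (L * (t - a)) * M"
      using s(2)[OF that] by (simp add: M_def)
    then show ?thesis by (simp add: mult.assoc[symmetric] exp_add[symmetric])
  qed
  \<comment> \<open>The part \<open>w\<close> of \<open>y\<close> that is generated by the coefficient \<open>q\<close>.\<close>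
  define m where "m = (\<lambda>t. q t * y t)"
  have m: "m absolutely_integrable_on {a..b}"
    unfolding m_def using absolutely_integrable_continuous_mult[OF cy q] by (simp add: mult.commute)
  define w' where "w' = (\<lambda>x. 0 + integral {a..x} m)"
  have w': "has_ac_derivative w' m {a..b}" unfolding w'_def by (rule has_ac_derivative_indefinite_integral[OF m])
  have w'i: "w' absolutely_integrable_on {a..b}"
    by (intro absolutely_integrable_continuous_real has_ac_derivative_continuous_on_Icc[OF w' order_refl])
  define w where "w = (\<lambda>x. 0 + integral {a..x} w')"
  have w: "has_ac_derivative w w' {a..b}" unfolding w_def by (rule has_ac_derivative_indefinite_integral[OF w'i])
  have w0: "w a = 0" "w' a = 0" by (auto simp: w_def w'_def)
  have W: "exp (- (L * (s - a))) * norm (w s) \<le> M / L * integral {a..b} n"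
  proof (rule weighted_double_integral_bound[OF w w' w0 _ n])
    show "norm (m t) \<le> n t * (exp (L * (t - a)) * M)" if "t \<in> {a..b}" for t
      unfolding m_def n_def norm_mult by (intro mult_left_mono M that) simp
  qed (use L M0 s in \<open>auto simp: n_def\<close>)
  also have "\<dots> \<le> M * (1/2)"
    using mult_left_mono[OF half M0] by simp
  finally have W: "exp (- (L * (s - a))) * norm (w s) \<le> M * (1/2)" .
  have R: "norm (y s - w s) \<le> c"
  proof -
    have sub: "{a..s} \<subseteq> {a..b}" using s by auto
    have d: "has_ac_derivative (\<lambda>x. y x - w x) (\<lambda>x. y' x - w' x) {a..b}"
      "has_ac_derivative (\<lambda>x. y' x - w' x) (\<lambda>x. y'' x - m x) {a..b}"
      using y w w' by (auto intro: has_ac_derivative_diff)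
    have I: "((\<lambda>t. of_real (s - t) * (y'' t - m t)) has_integral
        (y s - w s) - (y a + of_real (s - a) * y' a)) {a..s}"
      using has_ac_derivative_taylor[OF d s(1)] w0 by simp
    have rn: "(\<lambda>t. norm (r t)) integrable_on {a..b}" using r by (simp add: absolutely_integrable_on_def)
    then have rs: "(\<lambda>t. norm (r t)) integrable_on {a..s}" using integrable_on_subinterval sub by blast
    have "norm (integral {a..s} (\<lambda>t. of_real (s - t) * (y'' t - m t))) \<le> integral {a..s} (\<lambda>t. (b - a) * norm (r t))"
    proof (rule integral_norm_bound_integral)
      show "(\<lambda>t. of_real (s - t) * (y'' t - m t)) integrable_on {a..s}" using I by blast
      show "(\<lambda>t. (b - a) * norm (r t)) integrable_on {a..s}" using integrable_cmul[OF rs, of "b - a"] by simp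
      fix t assume t: "t \<in> {a..s}"
      then have "t \<in> {a..b}" using sub by blast
      then have "y'' t - m t = r t" by (simp add: eq m_def)
      then show "norm (of_real (s - t) * (y'' t - m t)) \<le> (b - a) * norm (r t)"
        using t s(1) by (auto simp: norm_mult simp del: of_real_diff intro!: mult_right_mono)
    qed
    also have "integral {a..s} (\<lambda>t. of_real (s - t) * (y'' t - m t)) = (y s - w s) - (y a + of_real (s - a) * y' a)"
      using I by (rule integral_unique)
    also have "integral {a..s} (\<lambda>t. (b - a) * norm (r t)) = (b - a) * integral {a..s} (\<lambda>t. norm (r t))" by simp
    also have "\<dots> \<le> (b - a) * integral {a..b} (\<lambda>t. norm (r t))"
      using ab by (intro mult_left_mono integral_subset_le sub rs rn) auto
    finally have 1: "norm ((y s - w s) - (y a + of_real (s - a) * y' a)) \<le> (b - a) * integral {a..b} (\<lambda>t. norm (r t))" .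
    have "norm (of_real (s - a) * y' a) \<le> (b - a) * norm (y' a)"
      using s(1) by (auto simp: norm_mult simp del: of_real_diff intro!: mult_right_mono)
    then have 2: "norm (y a + of_real (s - a) * y' a) \<le> norm (y a) + (b - a) * norm (y' a)"
      using norm_triangle_ineq[of "y a" "of_real (s - a) * y' a"] by linarith
    have "norm (y s - w s) \<le> norm ((y s - w s) - (y a + of_real (s - a) * y' a)) + norm (y a + of_real (s - a) * y' a)"
      by (metis diff_add_cancel norm_triangle_ineq)
    with 1 2 show ?thesis unfolding c_def by linarith
  qed
  have "M \<le> exp (- (L * (s - a))) * (norm (y s - w s) + norm (w s))"
    unfolding M_def by (intro mult_left_mono) (metis diff_add_cancel norm_triangle_ineq, simp)
  also have "\<dots> \<le> 1 * c + M * (1/2)"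
    unfolding distrib_left using s(1) L by (intro add_mono mult_mono W R) auto
  finally have "M \<le> 2 * c" by simp
  then have "exp (L * (x - a)) * M \<le> exp (L * (b - a)) * (2 * c)"
    using x L M0 by (intro mult_mono) auto
  with M[OF x] have "norm (y x) \<le> 2 * exp (L * (b - a)) * c" by simp
  then show ?thesis unfolding c_def L_def n_def .
qed

lemma initial_value_derivative_bound:
  assumes y: "has_ac_derivative y' y'' {a..b}"
    and eq: "\<And>t. t \<in> {a..b} \<Longrightarrow> y'' t = q t * y t + r t"
    and q: "q absolutely_integrable_on {a..b}" and r: "r absolutely_integrable_on {a..b}"
    and M: "\<And>t. t \<in> {a..b} \<Longrightarrow> norm (y t) \<le> M" and ab: "a \<le> b"
  shows "norm (y' b) \<le> norm (y' a) + integral {a..b} (\<lambda>t. norm (q t)) * M + integral {a..b} (\<lambda>t. norm (r t))"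
proof -
  have qi: "(\<lambda>t. norm (q t)) integrable_on {a..b}" and ri: "(\<lambda>t. norm (r t)) integrable_on {a..b}"
    using q r by (auto simp: absolutely_integrable_on_def)
  have qM: "(\<lambda>t. norm (q t) * M) integrable_on {a..b}"
    using integrable_cmul[OF qi, of M] by (simp add: mult.commute)
  have "norm (y' b - y' a) \<le> integral {a..b} (\<lambda>t. norm (q t) * M + norm (r t))"
  proof (rule has_ac_derivative_norm_le[OF y order_refl ab])
    show "(\<lambda>t. norm (q t) * M + norm (r t)) integrable_on {a..b}"
      by (intro integrable_add ri qM)
    fix t assume t: "t \<in> {a..b}"
    have "norm (y'' t) \<le> norm (q t) * norm (y t) + norm (r t)"
      unfolding eq[OF t] by (metis norm_mult norm_triangle_ineq)
    also have "\<dots> \<le> norm (q t) * M + norm (r t)"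
      using mult_left_mono[OF M[OF t], of "norm (q t)"] by simp
    finally show "norm (y'' t) \<le> norm (q t) * M + norm (r t)" .
  qed
  also have "\<dots> = integral {a..b} (\<lambda>t. norm (q t)) * M + integral {a..b} (\<lambda>t. norm (r t))"
    using integral_add[OF qM ri] by simp
  finally show ?thesis using norm_triangle_ineq2[of "y' b" "y' a"] by linarith
qed

text \<open>
  The function \<open>Z x = e\<^bsup>-L(x-a)\<^esup> y x\<close> is obtained as the fixed point of the weighted Volterra
  operator on bounded continuous functions. These live on the whole line, so functions on
  \<open>[a, b]\<close> are extended to it by their end point values.
\<close>
lemma initial_value_exists:
  fixes q r :: "real \<Rightarrow> complex"
  assumes q: "q absolutely_integrable_on {a..b}" and r: "r absolutely_integrable_on {a..b}" and ab: "a \<le> b"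
  obtains y y' where "has_ac_derivative y y' {a..b}" "has_ac_derivative y' (\<lambda>x. q x * y x + r x) {a..b}"
    "y a = \<alpha>" "y' a = \<beta>"
proof -
  define n where "n = (\<lambda>t. norm (q t))"
  have n: "n absolutely_integrable_on {a..b}" unfolding n_def using q by (rule absolutely_integrable_norm[unfolded o_def])
  have N0: "integral {a..b} n \<ge> 0" by (rule integral_nonneg) (use n in \<open>auto simp: absolutely_integrable_on_def n_def\<close>)
  define L where "L = 2 * integral {a..b} n + 1"
  have L: "L \<ge> 1" using N0 by (simp add: L_def)
  have half: "integral {a..b} n / L \<le> 1/2" using N0 by (simp add: L_def)
  define h' where "h' = (\<lambda>x. \<beta> + integral {a..x} r)"
  have h': "has_ac_derivative h' r {a..b}" unfolding h'_def by (rule has_ac_derivative_indefinite_integral[OF r])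
  define h where "h = (\<lambda>x. \<alpha> + integral {a..x} h')"
  have h: "has_ac_derivative h h' {a..b}" unfolding h_def
    by (intro has_ac_derivative_indefinite_integral absolutely_integrable_continuous_real
        has_ac_derivative_continuous_on_Icc[OF h' order_refl])
  define m where "m = (\<lambda>(Z :: real \<Rightarrow>\<^sub>C complex) t. q t * (of_real (exp (L * (t - a))) * Z t))"
  have m: "m Z absolutely_integrable_on {a..b}" for Z
    unfolding m_def
    using absolutely_integrable_continuous_mult[OF _ q, of "\<lambda>t. of_real (exp (L * (t - a))) * Z t"]
    by (simp add: mult.commute[of "q _"] continuous_intros)
  define w' where "w' = (\<lambda>Z x. 0 + integral {a..x} (m Z))"
  have w': "has_ac_derivative (w' Z) (m Z) {a..b}" for Z
    unfolding w'_def by (rule has_ac_derivative_indefinite_integral[OF m])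
  define w where "w = (\<lambda>Z x. 0 + integral {a..x} (w' Z))"
  have w: "has_ac_derivative (w Z) (w' Z) {a..b}" for Z
    unfolding w_def by (intro has_ac_derivative_indefinite_integral absolutely_integrable_continuous_real
        has_ac_derivative_continuous_on_Icc[OF w' order_refl])
  have w0: "w Z a = 0" "w' Z a = 0" for Z by (auto simp: w_def w'_def)
  define F where "F = (\<lambda>Z x. of_real (exp (- (L * (x - a)))) * (h x + w Z x))"
  have "\<exists>g :: real \<Rightarrow>\<^sub>C complex. (\<forall>x \<in> {a..b}. g x = F Z x) \<and> (\<forall>x. g x = F Z (clamp a b x))" for Z
  proof -
    have "continuous_on (cbox a b) (F Z)"
      unfolding F_def using has_ac_derivative_continuous_on_Icc[OF h order_refl]
        has_ac_derivative_continuous_on_Icc[OF w order_refl]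
      by (auto intro!: continuous_intros)
    from continuous_on_cbox_bcontfunE[OF this] show ?thesis by (metis box_real(2))
  qed
  then obtain T :: "(real \<Rightarrow>\<^sub>C complex) \<Rightarrow> (real \<Rightarrow>\<^sub>C complex)"
    where T: "\<And>Z x. x \<in> {a..b} \<Longrightarrow> T Z x = F Z x" "\<And>Z x. T Z x = F Z (clamp a b x)" by metis
  have "dist (T X) (T Y) \<le> 1/2 * dist X Y" for X Y
  proof (rule dist_bound)
    fix x
    define c where "c = clamp a b x"
    have c: "c \<in> {a..b}" unfolding c_def using clamp_in_interval[of a b x] ab by simp
    have "exp (- (L * (c - a))) * norm (w X c - w Y c) \<le> dist X Y / L * integral {a..b} n"
    proof (rule weighted_double_integral_bound[OF has_ac_derivative_diff[OF w w] has_ac_derivative_diff[OF w' w'] _ _ _ n])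
      fix t
      have "m X t - m Y t = q t * (of_real (exp (L * (t - a))) * (X t - Y t))"
        by (simp add: m_def algebra_simps)
      then have "norm (m X t - m Y t) = n t * (exp (L * (t - a)) * dist (X t) (Y t))"
        by (simp add: n_def norm_mult dist_norm)
      also have "\<dots> \<le> n t * (exp (L * (t - a)) * dist X Y)"
        by (intro mult_left_mono dist_bounded) (auto simp: n_def)
      finally show "norm (m X t - m Y t) \<le> n t * (exp (L * (t - a)) * dist X Y)" .
    qed (use L c w0 in \<open>auto simp: n_def\<close>)
    also have "\<dots> \<le> 1/2 * dist X Y"
      using mult_left_mono[OF half zero_le_dist[of X Y]] by simp
    finally have "exp (- (L * (c - a))) * norm (w X c - w Y c) \<le> 1/2 * dist X Y" .
    moreover have "T X x - T Y x = of_real (exp (- (L * (c - a)))) * (w X c - w Y c)"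
      unfolding T(2) c_def[symmetric] F_def right_diff_distrib[symmetric] by simp
    ultimately show "dist (T X x) (T Y x) \<le> 1/2 * dist X Y"
      by (simp add: dist_norm norm_mult)
  qed
  then have "\<exists>!Z. T Z = Z" by (intro banach_fix_type[of "1/2"]) auto
  then obtain Z where Z: "T Z = Z" by blast
  define y where "y = (\<lambda>x. h x + w Z x)"
  define y' where "y' = (\<lambda>x. h' x + w' Z x)"
  \<comment> \<open>Undoing the weight turns the fixed point equation into the Volterra equation for \<open>y\<close>.\<close>
  have yZ: "of_real (exp (L * (x - a))) * Z x = y x" if "x \<in> {a..b}" for x
  proof -
    have "Z x = of_real (exp (- (L * (x - a)))) * y x" using T(1)[OF that, of Z] by (simp add: Z F_def y_def)
    then show ?thesis by (simp add: mult.assoc[symmetric] exp_add[symmetric] flip: of_real_mult)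
  qed
  show thesis
  proof (rule that[of y y'])
    show "has_ac_derivative y y' {a..b}" unfolding y_def y'_def by (intro has_ac_derivative_add h w)
    have "has_ac_derivative y' (\<lambda>x. r x + m Z x) {a..b}" unfolding y'_def by (intro has_ac_derivative_add h' w')
    then show "has_ac_derivative y' (\<lambda>x. q x * y x + r x) {a..b}"
      by (rule has_ac_derivative_cong) (auto simp: m_def yZ)
    show "y a = \<alpha>" "y' a = \<beta>" by (auto simp: y_def y'_def h_def h'_def w0)
  qed
qed


section \<open>Control of solutions by their Neumann data\<close>

text \<open>
  Stability of the inhomogeneous Neumann problem for \<open>y'' = q y + r\<close>: the solution depends on
  its data continuously from the integral norm of \<open>r\<close> to the supremum norm of \<open>y\<close>.
\<close>
definition neumann_estimate :: "(real \<Rightarrow> complex) \<Rightarrow> real \<Rightarrow> bool" where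
  "neumann_estimate q C \<longleftrightarrow>
     (\<forall>y y' r. has_ac_derivative y y' {-1..1} \<and> has_ac_derivative y' (\<lambda>x. q x * y x + r x) {-1..1} \<and>
        r absolutely_integrable_on {-1..1} \<longrightarrow>
        (\<forall>x\<in>{-1..1}. norm (y x) \<le>
          C * (norm (y' (-1)) + norm (y' 1) + integral {-1..1} (\<lambda>t. norm (r t)))))"

text \<open>
  Let \<open>\<phi>\<close> be the solution with \<open>\<phi> (-1) = 1\<close>, \<open>\<phi>' (-1) = 0\<close>. The function \<open>y - y (-1) \<phi>\<close>
  vanishes at \<open>-1\<close>, so the initial value bounds estimate it by \<open>y' (-1)\<close> and \<open>r\<close> alone.
  Comparing derivatives at \<open>1\<close> then determines \<open>y (-1)\<close>, since \<open>\<phi>' 1 \<noteq> 0\<close>.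
\<close>
lemma neumann_data_bound:
  fixes q :: "real \<Rightarrow> complex"
  assumes q: "q absolutely_integrable_on {-1..1}"
    and inj: "\<And>\<phi> \<phi>'. has_ac_derivative \<phi> \<phi>' {-1..1} \<Longrightarrow> has_ac_derivative \<phi>' (\<lambda>x. q x * \<phi> x) {-1..1}
      \<Longrightarrow> \<phi> (-1) = 1 \<Longrightarrow> \<phi>' (-1) = 0 \<Longrightarrow> \<phi>' 1 \<noteq> 0"
  obtains C where "C > 0" "neumann_estimate q C"
proof -
  define N where "N = integral {-1..1} (\<lambda>t. norm (q t))"
  have N0: "N \<ge> 0" unfolding N_def by (rule integral_nonneg) (use q in \<open>auto simp: absolutely_integrable_on_def\<close>)
  define K where "K = 2 * exp ((2 * N + 1) * 2)"
  have K0: "K > 0" by (simp add: K_def)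
  obtain \<phi> \<phi>' where "has_ac_derivative \<phi> \<phi>' {-1..1}" "has_ac_derivative \<phi>' (\<lambda>x. q x * \<phi> x + 0) {-1..1}"
    and \<phi>0: "\<phi> (-1) = 1" "\<phi>' (-1) = 0"
    by (rule initial_value_exists[OF q, of "\<lambda>_. 0"]) auto
  then have \<phi>: "has_ac_derivative \<phi> \<phi>' {-1..1}" "has_ac_derivative \<phi>' (\<lambda>x. q x * \<phi> x) {-1..1}" by simp_all
  define d where "d = norm (\<phi>' 1)"
  have d: "d > 0" using inj[OF \<phi> \<phi>0] by (simp add: d_def)
  define C where "C = K * ((1 + 2 * K * N) / d + 2)"
  show thesis
  proof (rule that[of C])
    show "C > 0" using K0 N0 d by (auto simp: C_def intro!: mult_pos_pos add_nonneg_pos)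
    show "neumann_estimate q C"
      unfolding neumann_estimate_def
    proof (intro allI impI ballI, elim conjE)
      fix y y' r and x :: real assume y: "has_ac_derivative y y' {-1..1}" "has_ac_derivative y' (\<lambda>x. q x * y x + r x) {-1..1}"
        and r: "r absolutely_integrable_on {-1..1}" and x: "x \<in> {-1..1}"
      define \<rho> where "\<rho> = integral {-1..1} (\<lambda>t. norm (r t))"
      define s where "s = norm (y' (-1)) + norm (y' 1) + \<rho>"
      have bound: "norm (u t) \<le> K * (norm (u (-1)) + 2 * norm (u' (-1)) + 2 * \<rho>)"
        if "has_ac_derivative u u' {-1..1}" "has_ac_derivative u' (\<lambda>x. q x * u x + r x) {-1..1}" "t \<in> {-1..1}" for u u' t
        using initial_value_bound[OF that(1,2) refl q r _ that(3)] by (simp add: K_def N_def \<rho>_def)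
      define U where "U = (\<lambda>x. y x - y (-1) * \<phi> x)"
      define U' where "U' = (\<lambda>x. y' x - y (-1) * \<phi>' x)"
      have U: "has_ac_derivative U U' {-1..1}" unfolding U_def U'_def
        by (intro has_ac_derivative_diff has_ac_derivative_cmult y \<phi>)
      have "has_ac_derivative U' (\<lambda>x. (q x * y x + r x) - y (-1) * (q x * \<phi> x)) {-1..1}"
        unfolding U'_def by (intro has_ac_derivative_diff has_ac_derivative_cmult y \<phi>)
      then have U': "has_ac_derivative U' (\<lambda>x. q x * U x + r x) {-1..1}"
        by (rule has_ac_derivative_cong) (auto simp: U_def algebra_simps)
      have U0: "U (-1) = 0" "U' (-1) = y' (-1)" by (auto simp: U_def U'_def \<phi>0)
      have Ub: "norm (U t) \<le> 2 * K * (norm (y' (-1)) + \<rho>)" if "t \<in> {-1..1}" for t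
        using bound[OF U U' that] by (simp add: U0 algebra_simps)
      have "norm (U' 1) \<le> norm (y' (-1)) + N * (2 * K * (norm (y' (-1)) + \<rho>)) + \<rho>"
        using initial_value_derivative_bound[OF U' refl q r Ub] by (simp add: U0 N_def \<rho>_def)
      also have "\<dots> = (1 + 2 * K * N) * (norm (y' (-1)) + \<rho>)" by (simp add: algebra_simps)
      finally have U1: "norm (U' 1) \<le> (1 + 2 * K * N) * (norm (y' (-1)) + \<rho>)" .
      have "norm (y (-1)) * d = norm (y' 1 - U' 1)" by (simp add: d_def U'_def norm_mult)
      also have "\<dots> \<le> norm (y' 1) + norm (U' 1)" by (rule norm_triangle_ineq4)
      also have "\<dots> \<le> (1 + 2 * K * N) * norm (y' 1) + (1 + 2 * K * N) * (norm (y' (-1)) + \<rho>)"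
        using U1 K0 N0 mult_right_mono[of 1 "1 + 2 * K * N" "norm (y' 1)"] by simp
      also have "\<dots> = (1 + 2 * K * N) * s" by (simp add: s_def algebra_simps)
      finally have y1: "norm (y (-1)) \<le> (1 + 2 * K * N) / d * s" using d by (simp add: field_simps)
      have "norm (y x) \<le> K * (norm (y (-1)) + 2 * norm (y' (-1)) + 2 * \<rho>)" by (rule bound[OF y x])
      also have "\<dots> \<le> K * ((1 + 2 * K * N) / d * s + 2 * s)"
      proof (rule mult_left_mono)
        have "2 * norm (y' (-1)) + 2 * \<rho> \<le> 2 * s" by (simp add: s_def)
        with y1 show "norm (y (-1)) + 2 * norm (y' (-1)) + 2 * \<rho> \<le> (1 + 2 * K * N) / d * s + 2 * s" by linarith
      qed (use K0 in simp)
      also have "\<dots> = C * s" by (simp add: C_def algebra_simps)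
      finally show "norm (y x) \<le> C * (norm (y' (-1)) + norm (y' 1) + integral {-1..1} (\<lambda>t. norm (r t)))"
        by (simp add: s_def \<rho>_def)
    qed
  qed
qed


section \<open>Representatives of square integrable classes\<close>

lemma L2_class_UNIV: "L2_class UNIV f = abs_L2 f" by (simp add: L2_class_def)

lemma L2_fun_UNIV: "L2_fun UNIV f \<longleftrightarrow> square_integrable f" by (simp add: L2_fun_def)

lemma L2_cases:
  obtains f where "square_integrable f" "u = L2_class UNIV f"
proof -
  have "\<exists>f. square_integrable f \<and> u = L2_class UNIV f"
    unfolding L2_class_UNIV by (induction u rule: L2.abs_induct) auto
  then show ?thesis using that by blast
qed

lemma L2_class_eq_iff:
  assumes "L2_fun A f" "L2_fun B g"
  shows "L2_class A f = L2_class B g \<longleftrightarrow>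
    (AE x in lebesgue. indicator A x *\<^sub>R f x = indicator B x *\<^sub>R g x)"
  using assms Quotient_rel[OF Quotient_L2, of "\<lambda>x. indicator A x *\<^sub>R f x" "\<lambda>x. indicator B x *\<^sub>R g x"]
  by (simp add: L2_class_def L2_fun_def)

lemma L2_class_cong: "(\<And>x. x \<in> A \<Longrightarrow> f x = g x) \<Longrightarrow> L2_class A f = L2_class A g"
  unfolding L2_class_def by (rule arg_cong[where f = abs_L2]) (auto simp: fun_eq_iff indicator_def)

lemma L2_fun_add: "L2_fun A f \<Longrightarrow> L2_fun A g \<Longrightarrow> L2_fun A (\<lambda>x. f x + g x)"
  unfolding L2_fun_def by (simp add: scaleR_add_right square_integrable_add)

lemma L2_fun_cmult: "L2_fun A f \<Longrightarrow> L2_fun A (\<lambda>x. c * f x)"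
  unfolding L2_fun_def using square_integrable_cmult[of "\<lambda>x. indicator A x *\<^sub>R f x" c] by simp

lemma L2_fun_cong: "(\<And>x. x \<in> A \<Longrightarrow> f x = g x) \<Longrightarrow> L2_fun A f = L2_fun A g"
  unfolding L2_fun_def by (rule arg_cong[where f = square_integrable]) (auto simp: fun_eq_iff indicator_def)

lemma L2_fun_cnj: "L2_fun A f \<Longrightarrow> L2_fun A (\<lambda>x. cnj (f x))"
proof -
  assume "L2_fun A f"
  then have "square_integrable (\<lambda>x. cnj (indicator A x *\<^sub>R f x))"
    by (auto simp: L2_fun_def square_integrable_def complex_mod_cnj simp del: complex_cnj_scaleR
      intro!: borel_measurable_continuous_on[OF continuous_on_cnj[OF continuous_on_id]])
  then show "L2_fun A (\<lambda>x. cnj (f x))" by (simp add: L2_fun_def)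
qed

lemma square_integrable_indicator:
  assumes "square_integrable f" "A \<in> sets lebesgue"
  shows "square_integrable (\<lambda>x. indicator A x *\<^sub>R f x)"
  unfolding square_integrable_def
proof
  show m: "(\<lambda>x. indicator A x *\<^sub>R f x) \<in> borel_measurable lebesgue"
    using assms by (auto simp: square_integrable_def)
  show "integrable lebesgue (\<lambda>x. (norm (indicator A x *\<^sub>R f x))\<^sup>2)"
  proof (rule Bochner_Integration.integrable_bound)
    show "integrable lebesgue (\<lambda>x. (norm (f x))\<^sup>2)" using assms by (simp add: square_integrable_def)
    show "(\<lambda>x. (norm (indicator A x *\<^sub>R f x))\<^sup>2) \<in> borel_measurable lebesgue" using m by measurable
  qed (auto simp: indicator_def)
qed

lemma square_integrable_reflect: "square_integrable f \<Longrightarrow> square_integrable (\<lambda>x. f (- x))"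
  unfolding square_integrable_def
  using borel_measurable_affine[of f "-1" 0] lebesgue_integrable_real_affine[of "\<lambda>x. (norm (f x))\<^sup>2" "-1" 0]
  by simp

lemma L2_fun_subset:
  assumes "L2_fun A f" "B \<subseteq> A" "B \<in> sets lebesgue"
  shows "L2_fun B f"
proof -
  have "(\<lambda>x. indicator B x *\<^sub>R indicator A x *\<^sub>R f x) = (\<lambda>x. indicator B x *\<^sub>R f x)"
    using assms(2) by (auto simp: fun_eq_iff split: split_indicator)
  then show ?thesis
    using square_integrable_indicator[OF assms(1)[unfolded L2_fun_def] assms(3)] by (simp add: L2_fun_def)
qed

lemma L2_class_add: "L2_fun A f \<Longrightarrow> L2_fun A g \<Longrightarrow> L2_class A f + L2_class A g = L2_class A (\<lambda>x. f x + g x)"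
  unfolding L2_class_def L2_fun_def by (simp add: plus_L2.abs_eq scaleR_add_right)

lemma L2_class_diff: "L2_fun A f \<Longrightarrow> L2_fun A g \<Longrightarrow> L2_class A f - L2_class A g = L2_class A (\<lambda>x. f x - g x)"
  unfolding L2_class_def L2_fun_def by (simp add: minus_L2.abs_eq scaleR_diff_right)

lemma L2_class_scaleC: "L2_fun A f \<Longrightarrow> c *\<^sub>C L2_class A f = L2_class A (\<lambda>x. c * f x)"
  unfolding L2_class_def L2_fun_def by (simp add: scaleC_L2.abs_eq)

lemma L2_class_scaleR: "L2_fun A f \<Longrightarrow> r *\<^sub>R L2_class A f = L2_class A (\<lambda>x. of_real r * f x)"
  unfolding L2_class_def L2_fun_def by (simp add: scaleR_L2.abs_eq scaleR_conv_of_real mult_ac)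

lemma L2_class_add_scaleC:
  "square_integrable f \<Longrightarrow> square_integrable u \<Longrightarrow>
    L2_class UNIV (\<lambda>x. f x + c * u x) = L2_class UNIV f + c *\<^sub>C L2_class UNIV u"
  by (simp add: L2_class_scaleC L2_class_add L2_fun_UNIV square_integrable_cmult)

lemma L2_class_zero: "L2_class A (\<lambda>x. 0) = 0"
  by (simp add: L2_class_def zero_L2_def)

lemma L2_class_disjoint_add:
  assumes "L2_fun A f" "L2_fun B f" "A \<inter> B = {}"
  shows "L2_class A f + L2_class B f = L2_class (A \<union> B) f"
proof -
  have "(\<lambda>x. indicator A x *\<^sub>R f x + indicator B x *\<^sub>R f x) = (\<lambda>x. indicator (A \<union> B) x *\<^sub>R f x)"
    using assms(3) by (auto simp: fun_eq_iff split: split_indicator)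
  then show ?thesis
    using assms(1,2) unfolding L2_class_def L2_fun_def by (simp add: plus_L2.abs_eq)
qed

lemma inner_L2_class:
  "L2_fun A f \<Longrightarrow> L2_fun B g \<Longrightarrow> L2_class A f \<bullet> L2_class B g =
    integral\<^sup>L lebesgue (\<lambda>x. (indicator A x *\<^sub>R f x) \<bullet> (indicator B x *\<^sub>R g x))"
  unfolding L2_class_def L2_fun_def by (simp add: inner_L2.abs_eq)

lemma inner_L2_class_disjoint:
  assumes "L2_fun A f" "L2_fun B g" "A \<inter> B = {}"
  shows "L2_class A f \<bullet> L2_class B g = 0"
proof -
  have "(\<lambda>x. (indicator A x *\<^sub>R f x) \<bullet> (indicator B x *\<^sub>R g x)) = (\<lambda>x. 0)"
    using assms(3) by (auto simp: fun_eq_iff split: split_indicator)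
  then show ?thesis by (simp only: inner_L2_class[OF assms(1,2)]) simp
qed

lemma norm_L2_class_UNIV:
  "square_integrable f \<Longrightarrow> (norm (L2_class UNIV f))\<^sup>2 = integral\<^sup>L lebesgue (\<lambda>x. (norm (f x))\<^sup>2)"
  using inner_L2_class[of UNIV f UNIV f] by (simp add: L2_fun_UNIV power2_norm_eq_inner)

lemma norm_L2_class_reflect:
  assumes "square_integrable f"
  shows "norm (L2_class UNIV (\<lambda>x. f (- x))) = norm (L2_class UNIV f)"
proof -
  have "(norm (L2_class UNIV (\<lambda>x. f (- x))))\<^sup>2 = (norm (L2_class UNIV f))\<^sup>2"
    using assms square_integrable_reflect[OF assms]
      lebesgue_integral_real_affine[of "-1" "\<lambda>x. (norm (f x))\<^sup>2" 0]
    by (simp add: norm_L2_class_UNIV)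
  then show ?thesis by simp
qed

lemma integrable_norm_mult_square_integrable:
  assumes "square_integrable f" "square_integrable g"
  shows "integrable lebesgue (\<lambda>x. norm (f x) * norm (g x))"
proof (rule Bochner_Integration.integrable_bound)
  show "integrable lebesgue (\<lambda>x. (norm (f x))\<^sup>2 + (norm (g x))\<^sup>2)"
    using assms by (auto simp: square_integrable_def)
  show "(\<lambda>x. norm (f x) * norm (g x)) \<in> borel_measurable lebesgue"
    using assms by (auto simp: square_integrable_def)
  have "a * b \<le> a\<^sup>2 + b\<^sup>2" if "a \<ge> 0" "b \<ge> 0" for a b :: real
    using zero_le_power2[of "a - b"] mult_nonneg_nonneg[OF that] unfolding power2_diff by linarith
  then show "AE x in lebesgue. norm (norm (f x) * norm (g x)) \<le> norm ((norm (f x))\<^sup>2 + (norm (g x))\<^sup>2)"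
    by (intro AE_I2) simp
qed

lemma integrable_mult_square_integrable:
  assumes "square_integrable f" "square_integrable g"
  shows "integrable lebesgue (\<lambda>x. f x * g x)"
proof (rule Bochner_Integration.integrable_bound[OF integrable_norm_mult_square_integrable[OF assms]])
  show "(\<lambda>x. f x * g x) \<in> borel_measurable lebesgue"
    using assms by (auto simp: square_integrable_def)
qed (simp add: norm_mult)

lemma set_integrable_mult_L2_fun:
  assumes "L2_fun A f" "L2_fun A g"
  shows "set_integrable lebesgue A (\<lambda>x. f x * g x)"
proof -
  have "(\<lambda>x. (indicator A x *\<^sub>R f x) * (indicator A x *\<^sub>R g x)) = (\<lambda>x. indicator A x *\<^sub>R (f x * g x))"
    by (auto simp: fun_eq_iff split: split_indicator)
  with integrable_mult_square_integrable[OF assms[unfolded L2_fun_def]] show ?thesis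
    by (simp add: set_integrable_def)
qed

lemma L2_fun_set_integrable_bounded:
  assumes "L2_fun A f" "J \<subseteq> A" "J \<in> lmeasurable"
  shows "set_integrable lebesgue J f"
proof -
  have J: "J \<in> sets lebesgue" using assms(3) by blast
  have f: "square_integrable (\<lambda>x. indicator J x *\<^sub>R f x)"
    using L2_fun_subset[OF assms(1,2) J] by (simp add: L2_fun_def)
  have o: "square_integrable (\<lambda>x. indicator J x *\<^sub>R 1)"
    unfolding square_integrable_def
  proof
    show "(\<lambda>x. indicat_real J x *\<^sub>R (1::complex)) \<in> borel_measurable lebesgue"
      using J by (intro borel_measurable_scaleR) auto
    have "(\<lambda>x. (norm (indicat_real J x *\<^sub>R (1::complex)))\<^sup>2) = indicat_real J"
      by (auto simp: fun_eq_iff split: split_indicator)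
    then show "integrable lebesgue (\<lambda>x. (norm (indicat_real J x *\<^sub>R (1::complex)))\<^sup>2)"
      using assms(3) by (simp add: lmeasurable_iff_integrable)
  qed
  have "(\<lambda>x. (indicator J x *\<^sub>R f x) * (indicator J x *\<^sub>R 1)) = (\<lambda>x. indicator J x *\<^sub>R f x)"
    by (auto simp: fun_eq_iff split: split_indicator)
  with integrable_mult_square_integrable[OF f o] show ?thesis by (simp add: set_integrable_def)
qed

text \<open>
  This is the inequality of the inner product space applied to the classes of \<open>|f|\<close> and \<open>|g|\<close>.
\<close>
lemma integral_Cauchy_Schwarz:
  assumes f: "square_integrable f" and g: "square_integrable g"
  shows "integral\<^sup>L lebesgue (\<lambda>x. norm (f x) * norm (g x)) \<le> norm (L2_class UNIV f) * norm (L2_class UNIV g)"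
proof -
  define F G where "F = (\<lambda>x. complex_of_real (norm (f x)))" and "G = (\<lambda>x. complex_of_real (norm (g x)))"
  have F: "square_integrable F" and G: "square_integrable G"
    using f g by (auto simp: square_integrable_def F_def G_def)
  have "(norm (L2_class UNIV F))\<^sup>2 = (norm (L2_class UNIV f))\<^sup>2" "(norm (L2_class UNIV G))\<^sup>2 = (norm (L2_class UNIV g))\<^sup>2"
    unfolding norm_L2_class_UNIV[OF f] norm_L2_class_UNIV[OF F] norm_L2_class_UNIV[OF g] norm_L2_class_UNIV[OF G]
    by (simp_all add: F_def G_def)
  then have n: "norm (L2_class UNIV F) = norm (L2_class UNIV f)" "norm (L2_class UNIV G) = norm (L2_class UNIV g)"
    by auto
  have "integral\<^sup>L lebesgue (\<lambda>x. norm (f x) * norm (g x)) = L2_class UNIV F \<bullet> L2_class UNIV G"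
    using F G by (simp add: inner_L2_class L2_fun_UNIV) (simp add: F_def G_def inner_complex_def)
  also have "\<dots> \<le> norm (L2_class UNIV F) * norm (L2_class UNIV G)" by (rule norm_cauchy_schwarz)
  finally show ?thesis by (simp add: n)
qed

lemma integral_norm_symmetric_interval_le:
  assumes f: "square_integrable f" and e: "e \<ge> 0"
  shows "(\<lambda>x. norm (f x)) integrable_on {-e..e}"
    "integral {-e..e} (\<lambda>x. norm (f x)) \<le> sqrt (2 * e) * norm (L2_class UNIV f)"
proof -
  let ?o = "\<lambda>x. indicator {-e..e} x *\<^sub>R (1::complex)"
  have sq: "(\<lambda>x. (norm (?o x))\<^sup>2) = indicat_real {-e..e}"
    by (auto simp: fun_eq_iff split: split_indicator)
  have ind: "integrable lebesgue (indicat_real {-e..e})"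
    by (intro lmeasurable_iff_integrable[THEN iffD1] bounded_set_imp_lmeasurable) auto
  have o: "square_integrable ?o"
    unfolding square_integrable_def sq
    by (intro conjI ind borel_measurable_scaleR borel_measurable_integrable[OF ind]) auto
  have "(norm (L2_class UNIV ?o))\<^sup>2 = 2 * e"
    unfolding norm_L2_class_UNIV[OF o] sq using e by simp
  then have no: "norm (L2_class UNIV ?o) = sqrt (2 * e)" by (metis norm_ge_zero real_sqrt_unique)
  have "set_integrable lebesgue {-e..e} f"
    by (rule L2_fun_set_integrable_bounded[of UNIV]) (use f in \<open>auto simp: L2_fun_UNIV intro: bounded_set_imp_lmeasurable\<close>)
  then have i: "set_integrable lebesgue {-e..e} (\<lambda>x. norm (f x))" by (rule set_integrable_norm)
  then show "(\<lambda>x. norm (f x)) integrable_on {-e..e}" by (rule set_lebesgue_integral_eq_integral(1))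
  have "integral {-e..e} (\<lambda>x. norm (f x)) = integral\<^sup>L lebesgue (\<lambda>x. norm (?o x) * norm (f x))"
    using set_lebesgue_integral_eq_integral(2)[OF i] by (simp add: set_lebesgue_integral_def)
  also have "\<dots> \<le> sqrt (2 * e) * norm (L2_class UNIV f)"
    using integral_Cauchy_Schwarz[OF o f] by (simp only: no)
  finally show "integral {-e..e} (\<lambda>x. norm (f x)) \<le> sqrt (2 * e) * norm (L2_class UNIV f)" .
qed


section \<open>Resolvents of symmetric operators\<close>

lemma scaleC_add_right: "c *\<^sub>C (u + v) = c *\<^sub>C u + c *\<^sub>C v"
proof -
  obtain f g where "square_integrable f" "u = L2_class UNIV f" "square_integrable g" "v = L2_class UNIV g"
    using L2_cases by metis
  then show ?thesis
    by (simp add: L2_class_add L2_class_scaleC L2_fun_UNIV square_integrable_cmult square_integrable_add distrib_left)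
qed

lemma scaleC_scaleR: "c *\<^sub>C (r *\<^sub>R u) = r *\<^sub>R (c *\<^sub>C u)"
proof -
  obtain f where "square_integrable f" "u = L2_class UNIV f" using L2_cases .
  then show ?thesis
    by (simp add: L2_class_scaleR L2_class_scaleC L2_fun_UNIV square_integrable_cmult mult.left_commute)
qed

lemma inner_scaleC_ii: "(z *\<^sub>C u) \<bullet> (\<i> *\<^sub>C u) = Im z * (u \<bullet> u)"
proof (rule L2_cases[of u])
  fix f assume f: "square_integrable f" and u: "u = L2_class UNIV f"
  have "(z * w) \<bullet> (\<i> * w) = Im z * (w \<bullet> w)" for w
    by (simp add: inner_complex_def algebra_simps)
  then show ?thesis
    using f by (simp add: u L2_class_scaleC inner_L2_class L2_fun_UNIV square_integrable_cmult)
qed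

lemma norm_scaleC_ii: "norm (\<i> *\<^sub>C u) = norm u"
  using inner_scaleC_ii[of \<i> u] by (simp add: norm_eq_sqrt_inner)

text \<open>
  The real inner product with \<open>\<i> u\<close> is the imaginary part of the complex inner product with \<open>u\<close>,
  so the second condition says that the quadratic form of the operator is real.
\<close>
definition symmetric_graph :: "L2_operator \<Rightarrow> bool" where
  "symmetric_graph A \<longleftrightarrow> subspace A \<and> (\<forall>(u, g) \<in> A. g \<bullet> (\<i> *\<^sub>C u) = 0)"

text \<open>
  Test \<open>g - z u\<close> against \<open>\<i> u\<close>: the contribution of \<open>g\<close> vanishes, and the rest is
  \<open>- Im z \<parallel>u\<parallel>\<^sup>2\<close>.
\<close>
lemma symmetric_graph_lower_bound:
  assumes "symmetric_graph A" "(u, g) \<in> A"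
  shows "\<bar>Im z\<bar> * norm u \<le> norm (g - z *\<^sub>C u)"
proof (cases "u = 0")
  case False
  have "(g - z *\<^sub>C u) \<bullet> (\<i> *\<^sub>C u) = - (Im z * (u \<bullet> u))"
    using assms by (auto simp: symmetric_graph_def inner_diff_left inner_scaleC_ii)
  then have "\<bar>Im z\<bar> * (norm u * norm u) = \<bar>(g - z *\<^sub>C u) \<bullet> (\<i> *\<^sub>C u)\<bar>"
    by (simp add: abs_mult power2_norm_eq_inner[symmetric] power2_eq_square)
  also have "\<dots> \<le> norm (g - z *\<^sub>C u) * norm u"
    using Cauchy_Schwarz_ineq2[of "g - z *\<^sub>C u" "\<i> *\<^sub>C u"] by (simp add: norm_scaleC_ii)
  finally have "(\<bar>Im z\<bar> * norm u) * norm u \<le> norm (g - z *\<^sub>C u) * norm u" by (simp add: mult.assoc)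
  then show ?thesis using False by simp
qed simp

lemma symmetric_graph_resolvent_unique:
  assumes A: "symmetric_graph A" and z: "Im z \<noteq> 0"
    and u: "(u, f + z *\<^sub>C u) \<in> A" and v: "(v, f + z *\<^sub>C v) \<in> A"
  shows "u = v"
proof -
  have s: "subspace A" using A by (simp add: symmetric_graph_def)
  have zz: "z *\<^sub>C (u - v) = z *\<^sub>C u - z *\<^sub>C v"
    using scaleC_add_right[of z "u - v" v] by (simp add: algebra_simps)
  have "(u - v, z *\<^sub>C (u - v)) \<in> A"
    using subspace_diff[OF s u v] by (simp add: zz)
  from symmetric_graph_lower_bound[OF A this, of z] z show ?thesis by (simp add: mult_le_0_iff)
qed

lemma symmetric_graph_resolvent_eq:
  assumes "symmetric_graph A" "Im z \<noteq> 0" "(u, f + z *\<^sub>C u) \<in> A"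
  shows "resolvent A z f = u"
  unfolding resolvent_def
proof (rule the_equality)
  show "v = u" if "(v, f + z *\<^sub>C v) \<in> A" for v
    by (rule symmetric_graph_resolvent_unique[OF assms(1,2) that assms(3)])
qed (rule assms(3))

text \<open>
  Since the lower bound supplies injectivity and boundedness of the inverse, a non-real \<open>z\<close> is in
  the resolvent set as soon as \<open>A - z\<close> is onto.
\<close>
lemma symmetric_graph_resolvent_set:
  assumes A: "symmetric_graph A" and z: "Im z \<noteq> 0" and ex: "\<And>f. \<exists>u. (u, f + z *\<^sub>C u) \<in> A"
  shows "z \<in> resolvent_set A"
proof -
  have s: "subspace A" using A by (simp add: symmetric_graph_def)
  have R: "(resolvent A z f, f + z *\<^sub>C resolvent A z f) \<in> A" for f
  proof -
    obtain u where u: "(u, f + z *\<^sub>C u) \<in> A" using ex by blast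
    then show ?thesis by (simp add: symmetric_graph_resolvent_eq[OF A z u])
  qed
  have "bounded_linear (resolvent A z)"
  proof (rule bounded_linear_intro[where K = "1 / \<bar>Im z\<bar>"])
    fix f g
    show "resolvent A z (f + g) = resolvent A z f + resolvent A z g"
    proof (rule symmetric_graph_resolvent_eq[OF A z])
      show "(resolvent A z f + resolvent A z g, f + g + z *\<^sub>C (resolvent A z f + resolvent A z g)) \<in> A"
        using subspace_add[OF s R[of f] R[of g]] by (simp add: scaleC_add_right add_ac)
    qed
  next
    fix r f
    show "resolvent A z (r *\<^sub>R f) = r *\<^sub>R resolvent A z f"
    proof (rule symmetric_graph_resolvent_eq[OF A z])
      show "(r *\<^sub>R resolvent A z f, r *\<^sub>R f + z *\<^sub>C (r *\<^sub>R resolvent A z f)) \<in> A"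
        using subspace_scale[OF s R[of f], of r] by (simp add: scaleC_scaleR scaleR_add_right)
    qed
  next
    fix f
    show "norm (resolvent A z f) \<le> norm f * (1 / \<bar>Im z\<bar>)"
      using symmetric_graph_lower_bound[OF A R[of f], of z] z by (simp add: field_simps)
  qed
  moreover have "\<exists>!u. (u, f + z *\<^sub>C u) \<in> A" for f
    using ex[of f] symmetric_graph_resolvent_unique[OF A z] by blast
  ultimately show ?thesis by (simp add: resolvent_set_def)
qed


section \<open>Green's formula and symmetry of the operators\<close>

text \<open>
  The integral over \<open>[a n, b n]\<close> is \<open>h (b n) - h (a n)\<close>, and it converges to the integral over
  \<open>A\<close>. The sequences leave room for the end at infinity, where an integrable \<open>h\<close> takes
  arbitrarily small values.
\<close>
lemma has_ac_derivative_integral_eq_zero: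
  assumes h: "has_ac_derivative h h' A" and i: "set_integrable lebesgue A h'"
    and ab: "\<And>n::nat. a n \<le> b n" "\<And>n. {a n..b n} \<subseteq> A"
    and ex: "\<And>x. x \<in> A \<Longrightarrow> eventually (\<lambda>n. x \<in> {a n..b n}) sequentially"
    and lim: "(\<lambda>n. h (a n)) \<longlonglongrightarrow> 0" "(\<lambda>n. h (b n)) \<longlonglongrightarrow> 0"
  shows "(LINT x:A|lebesgue. h' x) = 0"
proof -
  let ?f = "\<lambda>x. indicator A x *\<^sub>R h' x"
  let ?s = "\<lambda>n x. indicator {a n..b n} x *\<^sub>R ?f x"
  have i': "integrable lebesgue ?f" using i by (simp add: set_integrable_def)
  have eq: "integral\<^sup>L lebesgue (?s n) = h (b n) - h (a n)" for n
  proof -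
    have "?s n = (\<lambda>x. indicator {a n..b n} x *\<^sub>R h' x)"
      using ab(2)[of n] by (auto simp: fun_eq_iff split: split_indicator)
    then have "integral\<^sup>L lebesgue (?s n) = (LINT x:{a n..b n}|lebesgue. h' x)"
      by (simp add: set_lebesgue_integral_def)
    also have "\<dots> = integral {a n..b n} h'"
      by (intro set_lebesgue_integral_eq_integral has_ac_derivativeD[OF h] ab)
    also have "\<dots> = h (b n) - h (a n)"
      using has_ac_derivative_integral[OF h ab(2,1)] by simp
    finally show ?thesis .
  qed
  have "(\<lambda>n. integral\<^sup>L lebesgue (?s n)) \<longlonglongrightarrow> integral\<^sup>L lebesgue ?f"
  proof (rule integral_dominated_convergence[where w = "\<lambda>x. norm (?f x)"])
    show "?f \<in> borel_measurable lebesgue" using i' by simp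
    then show "?s n \<in> borel_measurable lebesgue" for n
      by - (rule borel_measurable_scaleR[OF borel_measurable_indicator], auto)
    show "integrable lebesgue (\<lambda>x. norm (?f x))" using i' by (rule integrable_norm)
    show "AE x in lebesgue. (\<lambda>n. ?s n x) \<longlonglongrightarrow> ?f x"
    proof (rule AE_I2)
      fix x
      show "(\<lambda>n. ?s n x) \<longlonglongrightarrow> ?f x"
      proof (cases "x \<in> A")
        case True
        from ex[OF True] show ?thesis
          by (rule tendsto_eventually[OF eventually_mono]) auto
      qed auto
    qed
    show "AE x in lebesgue. norm (?s n x) \<le> norm (?f x)" for n
      by (rule AE_I2) (auto split: split_indicator)
  qed
  moreover have "(\<lambda>n. integral\<^sup>L lebesgue (?s n)) \<longlonglongrightarrow> 0 - 0"
    unfolding eq by (intro tendsto_diff lim)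
  ultimately show ?thesis
    using LIMSEQ_unique by (fastforce simp: set_lebesgue_integral_def)
qed

text \<open>
  If \<open>|h|\<close> stayed above a positive constant near infinity, its integral would be infinite.
\<close>
lemma integrable_small_values:
  fixes h :: "real \<Rightarrow> complex"
  assumes "set_integrable lebesgue {c<..} h"
  shows "\<exists>b::nat \<Rightarrow> real. (\<forall>n. b n \<ge> real n \<and> b n > c) \<and> (\<lambda>n. h (b n)) \<longlonglongrightarrow> 0"
proof -
  let ?f = "\<lambda>x. indicator {c<..} x *\<^sub>R h x"
  have i: "integrable lebesgue (\<lambda>x. norm (?f x))" using assms unfolding set_integrable_def by (rule integrable_norm)
  have *: "\<exists>x>N. norm (h x) \<le> e" if e: "e > 0" and N: "N \<ge> c" for e N
  proof (rule ccontr)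
    assume "\<not> ?thesis"
    then have big: "norm (h x) > e" if "x > N" for x using that by force
    define I where "I = integral\<^sup>L lebesgue (\<lambda>x. norm (?f x))"
    have I0: "I \<ge> 0" by (simp add: I_def)
    define M where "M = I / e + 1"
    have M: "M > 0" using I0 e by (simp add: M_def add_nonneg_pos)
    have "integral\<^sup>L lebesgue (\<lambda>x. indicator {N<..N+M} x *\<^sub>R e) \<le> I"
      unfolding I_def
    proof (rule integral_mono[OF _ i])
      show "integrable lebesgue (\<lambda>x. indicator {N<..N+M} x *\<^sub>R e)" 
        by (intro integrable_scaleR_left lmeasurable_iff_integrable[THEN iffD1] bounded_set_imp_lmeasurable) auto
      show "indicator {N<..N+M} x *\<^sub>R e \<le> norm (?f x)" for x
        using big[of x] N by (auto simp: less_imp_le split: split_indicator)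
    qed
    moreover have "integral\<^sup>L lebesgue (\<lambda>x. indicator {N<..N+M} x *\<^sub>R e) = M * e" using M by simp
    ultimately have "M * e \<le> I" by (simp only:)
    then show False using mult_pos_pos[OF e e] e by (simp add: M_def field_simps)
  qed
  have "\<exists>x. x > max c (real n) \<and> norm (h x) \<le> 1 / (real n + 1)" for n
    using *[of "1 / (real n + 1)" "max c (real n)"] by auto
  then obtain b where b: "\<And>n. b n > max c (real n) \<and> norm (h (b n)) \<le> 1 / (real n + 1)" by metis
  have "(\<lambda>n. h (b n)) \<longlonglongrightarrow> 0"
  proof (rule Lim_null_comparison)
    show "(\<lambda>n. 1 / (real n + 1)) \<longlonglongrightarrow> 0" using LIMSEQ_inverse_real_of_nat by (simp add: inverse_eq_divide add.commute)
  qed (use b in auto)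
  then show ?thesis using b by (intro exI[of _ b]) (auto simp: less_imp_le)
qed

lemma integrable_small_values_left:
  fixes h :: "real \<Rightarrow> complex"
  assumes "set_integrable lebesgue {..<c} h"
  shows "\<exists>a::nat \<Rightarrow> real. (\<forall>n. a n \<le> - real n \<and> a n < c) \<and> (\<lambda>n. h (a n)) \<longlonglongrightarrow> 0"
proof -
  have "(\<lambda>x. indicator {..<c} (-x) *\<^sub>R h (-x)) = (\<lambda>x. indicator {-c<..} x *\<^sub>R h (-x))"
    by (auto simp: fun_eq_iff split: split_indicator)
  then have "set_integrable lebesgue {-c<..} (\<lambda>x. h (-x))"
    using assms lebesgue_integrable_real_affine[of "\<lambda>x. indicator {..<c} x *\<^sub>R h x" "-1" 0]
    by (simp add: set_integrable_def)
  from integrable_small_values[OF this] obtain b :: "nat \<Rightarrow> real"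
    where b: "\<And>n. b n \<ge> real n \<and> b n > - c" "(\<lambda>n. h (- b n)) \<longlonglongrightarrow> 0" by blast
  then show ?thesis by (intro exI[of _ "\<lambda>n. - b n"]) (auto simp: minus_less_iff)
qed

text \<open>
  With \<open>g = - y'' + Q y\<close>, the Wronskian \<open>h\<close> of \<open>y\<close> and its conjugate has derivative
  \<open>h' = - 2 \<i> Im (g y\<^sup>*)\<close>, because \<open>Q\<close> is real; the possibly non-integrable terms \<open>Q |y|\<^sup>2\<close>
  and \<open>y'' y\<^sup>*\<close> have disappeared. If \<open>h\<close> tends to zero at both ends, the integral of \<open>h'\<close>
  vanishes.
\<close>
lemma SL_fun_energy:
  fixes Q :: "real \<Rightarrow> real"
  assumes y: "SL_fun A Q y y' y''"
    and ab: "\<And>n::nat. a n \<le> b n" "\<And>n. {a n..b n} \<subseteq> A"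
    and ex: "\<And>x. x \<in> A \<Longrightarrow> eventually (\<lambda>n. x \<in> {a n..b n}) sequentially"
    and lim: "(\<lambda>n. y' (a n) * cnj (y (a n)) - y (a n) * cnj (y' (a n))) \<longlonglongrightarrow> 0"
      "(\<lambda>n. y' (b n) * cnj (y (b n)) - y (b n) * cnj (y' (b n))) \<longlonglongrightarrow> 0"
  shows "L2_class A (\<lambda>x. - y'' x + of_real (Q x) * y x) \<bullet> (\<i> *\<^sub>C L2_class A y) = 0"
proof -
  define g where "g = (\<lambda>x. - y'' x + of_real (Q x) * y x)"
  have ac: "has_ac_derivative y y' A" "has_ac_derivative y' y'' A"
    and l2: "L2_fun A y" "L2_fun A y'" "L2_fun A g" using y by (auto simp: SL_fun_def g_def)
  define h where "h = (\<lambda>x. y' x * cnj (y x) - y x * cnj (y' x))"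
  define h' where "h' = (\<lambda>x. y x * cnj (g x) - g x * cnj (y x))"
  have "has_ac_derivative h (\<lambda>x. (y'' x * cnj (y x) + y' x * cnj (y' x)) - (y' x * cnj (y' x) + y x * cnj (y'' x))) A"
    unfolding h_def by (intro has_ac_derivative_diff has_ac_derivative_mult has_ac_derivative_cnj ac)
  then have h: "has_ac_derivative h h' A"
    by (rule has_ac_derivative_cong) (auto simp: h'_def g_def algebra_simps)
  have i: "set_integrable lebesgue A h'"
    unfolding h'_def by (intro set_integral_diff set_integrable_mult_L2_fun L2_fun_cnj l2)
  have "(LINT x:A|lebesgue. h' x) = 0"
    by (rule has_ac_derivative_integral_eq_zero[OF h i ab ex]) (use lim in \<open>auto simp: h_def\<close>)
  then have 0: "integral\<^sup>L lebesgue (\<lambda>x. indicator A x *\<^sub>R h' x) = 0"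
    by (simp add: set_lebesgue_integral_def)
  have i': "integrable lebesgue (\<lambda>x. indicator A x *\<^sub>R h' x)" using i by (simp add: set_integrable_def)
  have bl: "bounded_linear (\<lambda>w. Re (\<i> / 2 * w))"
    by (intro bounded_linear_compose[OF bounded_linear_Re] bounded_linear_mult_right)
  have pt: "(indicator A x *\<^sub>R g x) \<bullet> (indicator A x *\<^sub>R (\<i> * y x)) = Re (\<i> / 2 * (indicator A x *\<^sub>R h' x))" for x
    by (auto simp: h'_def inner_complex_def field_simps split: split_indicator)
  have "L2_class A g \<bullet> (\<i> *\<^sub>C L2_class A y)
      = integral\<^sup>L lebesgue (\<lambda>x. Re (\<i> / 2 * (indicator A x *\<^sub>R h' x)))"
    using l2 by (simp only: L2_class_scaleC inner_L2_class L2_fun_cmult pt)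
  also have "\<dots> = Re (\<i> / 2 * integral\<^sup>L lebesgue (\<lambda>x. indicator A x *\<^sub>R h' x))"
    by (rule integral_bounded_linear[OF bl i'])
  finally show ?thesis by (simp add: 0 g_def)
qed

text \<open>
  The operators on the line and on the half lines in one form, so that their
  linearity is proved once; \<open>P\<close> is the boundary condition.
\<close>
definition SL_graph :: "real set \<Rightarrow> (real \<Rightarrow> real) \<Rightarrow> ((real \<Rightarrow> complex) \<Rightarrow> bool) \<Rightarrow> L2_operator" where
  "SL_graph A Q P = {(L2_class A y, L2_class A (\<lambda>x. - y'' x + of_real (Q x) * y x)) | y y' y''.
     SL_fun A Q y y' y'' \<and> P y}"

lemma SL_fun_add:
  assumes "SL_fun A Q y y' y''" "SL_fun A Q u u' u''"
  shows "SL_fun A Q (\<lambda>x. y x + u x) (\<lambda>x. y' x + u' x) (\<lambda>x. y'' x + u'' x)"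
proof -
  have "L2_fun A (\<lambda>x. - y'' x + of_real (Q x) * y x)" "L2_fun A (\<lambda>x. - u'' x + of_real (Q x) * u x)"
    using assms by (simp_all add: SL_fun_def)
  from L2_fun_add[OF this] have "L2_fun A (\<lambda>x. - (y'' x + u'' x) + of_real (Q x) * (y x + u x))"
    by (simp add: algebra_simps)
  then show ?thesis using assms
    by (auto simp: SL_fun_def intro: has_ac_derivative_add L2_fun_add)
qed

lemma SL_fun_cmult:
  assumes "SL_fun A Q y y' y''"
  shows "SL_fun A Q (\<lambda>x. c * y x) (\<lambda>x. c * y' x) (\<lambda>x. c * y'' x)"
proof -
  have "L2_fun A (\<lambda>x. c * (- y'' x + of_real (Q x) * y x))"
    using assms by (intro L2_fun_cmult) (auto simp: SL_fun_def)
  then have "L2_fun A (\<lambda>x. - (c * y'' x) + of_real (Q x) * (c * y x))"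
    by (simp add: algebra_simps)
  then show ?thesis using assms
    by (auto simp: SL_fun_def intro: has_ac_derivative_cmult L2_fun_cmult)
qed

lemma SL_graphI:
  "SL_fun A Q y y' y'' \<Longrightarrow> P y \<Longrightarrow>
    (L2_class A y, L2_class A (\<lambda>x. - y'' x + of_real (Q x) * y x)) \<in> SL_graph A Q P"
  unfolding SL_graph_def by blast

lemma SL_graph_subspace:
  assumes P: "P (\<lambda>x. 0)" "\<And>u v. P u \<Longrightarrow> P v \<Longrightarrow> P (\<lambda>x. u x + v x)" "\<And>u c. P u \<Longrightarrow> P (\<lambda>x. c * u x)"
  shows "subspace (SL_graph A Q P)"
proof (rule subspaceI)
  have "SL_fun A Q (\<lambda>x. 0) (\<lambda>x. 0) (\<lambda>x. 0)"
    using square_integrable_zero by (simp add: SL_fun_def has_ac_derivative_def L2_fun_def)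
  from SL_graphI[of A Q _ _ _ P, OF this P(1)] show "0 \<in> SL_graph A Q P" by (simp add: L2_class_zero zero_prod_def)
next
  fix p q assume "p \<in> SL_graph A Q P" "q \<in> SL_graph A Q P"
  then obtain y y' y'' u u' u'' where
    p: "p = (L2_class A y, L2_class A (\<lambda>x. - y'' x + of_real (Q x) * y x))" "SL_fun A Q y y' y''" "P y"
    and q: "q = (L2_class A u, L2_class A (\<lambda>x. - u'' x + of_real (Q x) * u x))" "SL_fun A Q u u' u''" "P u"
    unfolding SL_graph_def by blast
  have "p + q = (L2_class A (\<lambda>x. y x + u x), L2_class A (\<lambda>x. (- y'' x + of_real (Q x) * y x) + (- u'' x + of_real (Q x) * u x)))"
    using p(2) q(2) by (simp add: p(1) q(1) SL_fun_def L2_class_add)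
  also have "(\<lambda>x. (- y'' x + of_real (Q x) * y x) + (- u'' x + of_real (Q x) * u x))
      = (\<lambda>x. - (y'' x + u'' x) + of_real (Q x) * (y x + u x))" by (simp add: algebra_simps)
  finally show "p + q \<in> SL_graph A Q P"
    using SL_graphI[of A Q _ _ _ P, OF SL_fun_add[OF p(2) q(2)] P(2)[OF p(3) q(3)]] by (simp only:)
next
  fix r :: real and p assume "p \<in> SL_graph A Q P"
  then obtain y y' y'' where
    p: "p = (L2_class A y, L2_class A (\<lambda>x. - y'' x + of_real (Q x) * y x))" "SL_fun A Q y y' y''" "P y"
    unfolding SL_graph_def by blast
  have "r *\<^sub>R p = (L2_class A (\<lambda>x. of_real r * y x), L2_class A (\<lambda>x. of_real r * (- y'' x + of_real (Q x) * y x)))"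
    using p(2) by (simp add: p(1) SL_fun_def L2_class_scaleR)
  also have "(\<lambda>x. of_real r * (- y'' x + of_real (Q x) * y x))
      = (\<lambda>x. - (of_real r * y'' x) + of_real (Q x) * (of_real r * y x))" by (simp add: algebra_simps)
  finally show "r *\<^sub>R p \<in> SL_graph A Q P"
    using SL_graphI[of A Q _ _ _ P, OF SL_fun_cmult[OF p(2)] P(3)[OF p(3)], of "of_real r"] by (simp only:)
qed

lemma schroedinger_eq_SL_graph: "schroedinger Q = SL_graph UNIV Q (\<lambda>_. True)"
  by (simp add: schroedinger_def SL_graph_def)

lemma SL_fun_free: "SL_fun A (\<lambda>_. 0) y y' y'' \<longleftrightarrow> W22_fun A y y' y''"
proof -
  have "L2_fun A (\<lambda>x. - y'' x) \<longleftrightarrow> L2_fun A y''"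
    using L2_fun_cmult[of A y'' "-1"] L2_fun_cmult[of A "\<lambda>x. - y'' x" "-1"] by auto
  then show ?thesis by (simp add: SL_fun_def W22_fun_def)
qed

lemma S_minus_eq_SL_graph: "S_minus = SL_graph {..<0} (\<lambda>_. 0) (\<lambda>y. (y \<longlongrightarrow> 0) (at_left 0))"
  unfolding S_minus_def SL_graph_def SL_fun_free by simp

lemma S_plus_eq_SL_graph: "S_plus = SL_graph {0<..} (\<lambda>_. 0) (\<lambda>y. (y \<longlongrightarrow> 0) (at_right 0))"
  unfolding S_plus_def SL_graph_def SL_fun_free by simp

lemma SL_fun_wronskian_integrable:
  assumes "SL_fun A Q y y' y''" "B \<subseteq> A" "B \<in> sets lebesgue"
  shows "set_integrable lebesgue B (\<lambda>x. y' x * cnj (y x) - y x * cnj (y' x))"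
  using assms by (intro set_integral_diff set_integrable_mult_L2_fun L2_fun_cnj)
    (auto simp: SL_fun_def intro: L2_fun_subset)

lemma symmetric_schroedinger: "symmetric_graph (schroedinger Q)"
  unfolding symmetric_graph_def
proof (intro conjI ballI, unfold schroedinger_eq_SL_graph)
  show "subspace (SL_graph UNIV Q (\<lambda>_. True))" by (rule SL_graph_subspace) auto
  fix p assume "p \<in> SL_graph UNIV Q (\<lambda>_. True)"
  then obtain y y' y'' where p: "p = (L2_class UNIV y, L2_class UNIV (\<lambda>x. - y'' x + of_real (Q x) * y x))"
    and y: "SL_fun UNIV Q y y' y''" unfolding SL_graph_def by blast
  let ?h = "\<lambda>x. y' x * cnj (y x) - y x * cnj (y' x)"
  obtain b :: "nat \<Rightarrow> real" where b: "\<And>n. b n \<ge> real n" "\<And>n. b n > 0" "(\<lambda>n. ?h (b n)) \<longlonglongrightarrow> 0"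
    using integrable_small_values[OF SL_fun_wronskian_integrable[OF y, of "{0<..}"]] by auto
  obtain a :: "nat \<Rightarrow> real" where a: "\<And>n. a n \<le> - real n" "\<And>n. a n < 0" "(\<lambda>n. ?h (a n)) \<longlonglongrightarrow> 0"
    using integrable_small_values_left[OF SL_fun_wronskian_integrable[OF y, of "{..<0}"]] by auto
  have "L2_class UNIV (\<lambda>x. - y'' x + of_real (Q x) * y x) \<bullet> (\<i> *\<^sub>C L2_class UNIV y) = 0"
  proof (rule SL_fun_energy[OF y, of a b])
    fix x :: real
    show "\<forall>\<^sub>F n in sequentially. x \<in> {a n..b n}"
    proof (rule eventually_sequentiallyI)
      fix n assume "nat \<lceil>\<bar>x\<bar>\<rceil> \<le> n"
      then have "\<bar>x\<bar> \<le> real n" by linarith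
      then show "x \<in> {a n..b n}" using a(1)[of n] b(1)[of n] by auto
    qed
  next
    show "a n \<le> b n" for n using a(2)[of n] b(2)[of n] by simp
  qed (use a(3) b(3) in auto)
  then show "case p of (u, g) \<Rightarrow> g \<bullet> (\<i> *\<^sub>C u) = 0" by (simp add: p)
qed

text \<open>
  On a bounded interval the square integrable \<open>y''\<close> is integrable, hence \<open>y'\<close> is bounded up to
  the end point where the Dirichlet condition is imposed.
\<close>
lemma tendsto_wronskian_dirichlet:
  assumes y: "SL_fun A (\<lambda>_. 0) y y' y''" and J: "is_interval J" "J \<subseteq> A" "J \<in> lmeasurable"
    and s: "\<And>n::nat. s n \<in> J" "(\<lambda>n. y (s n)) \<longlonglongrightarrow> 0"
  shows "(\<lambda>n. y' (s n) * cnj (y (s n)) - y (s n) * cnj (y' (s n))) \<longlonglongrightarrow> 0"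
proof -
  have "L2_fun A y''" and ac: "has_ac_derivative y' y'' A"
    using y unfolding SL_fun_free W22_fun_def by auto
  then have "set_integrable lebesgue J y''" using J by (intro L2_fun_set_integrable_bounded)
  then obtain B where B: "\<And>x. x \<in> J \<Longrightarrow> norm (y' x) \<le> B" using has_ac_derivative_bounded[OF ac J(1,2)] by blast
  show ?thesis
  proof (rule Lim_null_comparison)
    show "(\<lambda>n. 2 * B * norm (y (s n))) \<longlonglongrightarrow> 0"
      by (rule tendsto_mult_right_zero[OF tendsto_norm_zero[OF s(2)]])
    show "\<forall>\<^sub>F n in sequentially. norm (y' (s n) * cnj (y (s n)) - y (s n) * cnj (y' (s n))) \<le> 2 * B * norm (y (s n))"
    proof (rule always_eventually, rule allI)
      fix n
      have "norm (y' (s n) * cnj (y (s n)) - y (s n) * cnj (y' (s n)))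
          \<le> norm (y' (s n)) * norm (y (s n)) + norm (y (s n)) * norm (y' (s n))"
        by (rule order_trans[OF norm_triangle_ineq4]) (simp add: norm_mult)
      also have "\<dots> \<le> 2 * B * norm (y (s n))"
        using mult_right_mono[OF B[OF s(1)[of n]], of "norm (y (s n))"] by (simp add: algebra_simps)
      finally show "norm (y' (s n) * cnj (y (s n)) - y (s n) * cnj (y' (s n))) \<le> 2 * B * norm (y (s n))" .
    qed
  qed
qed

lemma inverse_Suc_tendsto_at_right: "filterlim (\<lambda>n. 1 / (real n + 1)) (at_right 0) sequentially"
  unfolding filterlim_at
  using LIMSEQ_inverse_real_of_nat by (auto simp: inverse_eq_divide add.commute)

lemma symmetric_S_plus: "symmetric_graph S_plus"
  unfolding symmetric_graph_def
proof (intro conjI ballI, unfold S_plus_eq_SL_graph)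
  let ?P = "\<lambda>y::real \<Rightarrow> complex. (y \<longlongrightarrow> 0) (at_right 0)"
  show "subspace (SL_graph {0<..} (\<lambda>_. 0) ?P)"
    by (rule SL_graph_subspace) (auto intro: tendsto_add_zero tendsto_mult_right_zero)
  fix p assume "p \<in> SL_graph {0<..} (\<lambda>_. 0) ?P"
  then obtain y y' y'' where p: "p = (L2_class {0<..} y, L2_class {0<..} (\<lambda>x. - y'' x + of_real 0 * y x))"
    and y: "SL_fun {0<..} (\<lambda>_. 0) y y' y''" and y0: "?P y" unfolding SL_graph_def by blast
  let ?h = "\<lambda>x. y' x * cnj (y x) - y x * cnj (y' x)"
  obtain b :: "nat \<Rightarrow> real" where b: "\<And>n. b n \<ge> real n" "\<And>n. b n > 1" "(\<lambda>n. ?h (b n)) \<longlonglongrightarrow> 0"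
    using integrable_small_values[OF SL_fun_wronskian_integrable[OF y, of "{1<..}"]] by auto
  define a where "a = (\<lambda>n. 1 / (real n + 1))"
  have a: "0 < a n" "a n \<le> 1" for n by (auto simp: a_def)
  have ya: "(\<lambda>n. y (a n)) \<longlonglongrightarrow> 0"
    unfolding a_def by (rule filterlim_compose[OF y0 inverse_Suc_tendsto_at_right])
  have a0: "a \<longlonglongrightarrow> 0" unfolding a_def using inverse_Suc_tendsto_at_right by (simp add: filterlim_at)
  have ha: "(\<lambda>n. ?h (a n)) \<longlonglongrightarrow> 0"
    by (rule tendsto_wronskian_dirichlet[OF y, of "{0<..1}"]) (use a ya in \<open>auto simp: is_interval_1 intro: bounded_set_imp_lmeasurable\<close>)
  have "L2_class {0<..} (\<lambda>x. - y'' x + of_real 0 * y x) \<bullet> (\<i> *\<^sub>C L2_class {0<..} y) = 0"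
  proof (rule SL_fun_energy[OF y, of a b])
    fix x :: real assume x: "x \<in> {0<..}"
    have "\<forall>\<^sub>F n in sequentially. a n < x" using order_tendstoD(2)[OF a0] x by simp
    moreover have "\<forall>\<^sub>F n in sequentially. x \<le> b n"
    proof (rule eventually_sequentiallyI)
      fix n assume "nat \<lceil>x\<rceil> \<le> n"
      then have "x \<le> real n" by linarith
      then show "x \<le> b n" using b(1)[of n] by simp
    qed
    ultimately show "\<forall>\<^sub>F n in sequentially. x \<in> {a n..b n}" by eventually_elim simp
  next
    show "a n \<le> b n" for n using a(2)[of n] b(2)[of n] by simp
    show "{a n..b n} \<subseteq> {0<..}" for n using a(1)[of n] by auto
  qed (use ha b(3) in auto)
  then show "case p of (u, g) \<Rightarrow> g \<bullet> (\<i> *\<^sub>C u) = 0" by (simp add: p)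
qed

lemma symmetric_S_minus: "symmetric_graph S_minus"
  unfolding symmetric_graph_def
proof (intro conjI ballI, unfold S_minus_eq_SL_graph)
  let ?P = "\<lambda>y::real \<Rightarrow> complex. (y \<longlongrightarrow> 0) (at_left 0)"
  show "subspace (SL_graph {..<0} (\<lambda>_. 0) ?P)"
    by (rule SL_graph_subspace) (auto intro: tendsto_add_zero tendsto_mult_right_zero)
  fix p assume "p \<in> SL_graph {..<0} (\<lambda>_. 0) ?P"
  then obtain y y' y'' where p: "p = (L2_class {..<0} y, L2_class {..<0} (\<lambda>x. - y'' x + of_real 0 * y x))"
    and y: "SL_fun {..<0} (\<lambda>_. 0) y y' y''" and y0: "?P y" unfolding SL_graph_def by blast
  let ?h = "\<lambda>x. y' x * cnj (y x) - y x * cnj (y' x)"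
  obtain a :: "nat \<Rightarrow> real" where a: "\<And>n. a n \<le> - real n" "\<And>n. a n < -1" "(\<lambda>n. ?h (a n)) \<longlonglongrightarrow> 0"
    using integrable_small_values_left[OF SL_fun_wronskian_integrable[OF y, of "{..<-1}"]] by auto
  define b where "b = (\<lambda>n. - (1 / (real n + 1)))"
  have b: "b n < 0" "-1 \<le> b n" for n by (auto simp: b_def)
  have bl: "filterlim b (at_left 0) sequentially"
    using inverse_Suc_tendsto_at_right tendsto_minus[of "\<lambda>n. 1 / (real n + 1)" 0 sequentially]
    by (auto simp: filterlim_at b_def)
  have yb: "(\<lambda>n. y (b n)) \<longlonglongrightarrow> 0" by (rule filterlim_compose[OF y0 bl])
  have b0: "b \<longlonglongrightarrow> 0" using bl by (simp add: filterlim_at)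
  have hb: "(\<lambda>n. ?h (b n)) \<longlonglongrightarrow> 0"
    by (rule tendsto_wronskian_dirichlet[OF y, of "{-1..<0}"]) (use b yb in \<open>auto simp: is_interval_1 intro: bounded_set_imp_lmeasurable\<close>)
  have "L2_class {..<0} (\<lambda>x. - y'' x + of_real 0 * y x) \<bullet> (\<i> *\<^sub>C L2_class {..<0} y) = 0"
  proof (rule SL_fun_energy[OF y, of a b])
    fix x :: real assume x: "x \<in> {..<0}"
    have "\<forall>\<^sub>F n in sequentially. x < b n" using order_tendstoD(1)[OF b0] x by simp
    moreover have "\<forall>\<^sub>F n in sequentially. a n \<le> x"
    proof (rule eventually_sequentiallyI)
      fix n assume "nat \<lceil>- x\<rceil> \<le> n"
      then have "- x \<le> real n" by linarith
      then show "a n \<le> x" using a(1)[of n] by simp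
    qed
    ultimately show "\<forall>\<^sub>F n in sequentially. x \<in> {a n..b n}" by eventually_elim simp
  next
    show "a n \<le> b n" for n using a(2)[of n] b(2)[of n] by simp
    show "{a n..b n} \<subseteq> {..<0}" for n using b(1)[of n] by auto
  qed (use hb a(3) in auto)
  then show "case p of (u, g) \<Rightarrow> g \<bullet> (\<i> *\<^sub>C u) = 0" by (simp add: p)
qed

lemma symmetric_direct_sum: "symmetric_graph (direct_sum S_minus S_plus)"
  unfolding symmetric_graph_def
proof (intro conjI ballI)
  have s: "subspace S_minus" "subspace S_plus"
    using symmetric_S_minus symmetric_S_plus by (auto simp: symmetric_graph_def)
  have "direct_sum S_minus S_plus = {x + y |x y. x \<in> S_minus \<and> y \<in> S_plus}"
    unfolding direct_sum_def by (fastforce simp: plus_prod_def)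
  then show "subspace (direct_sum S_minus S_plus)" using subspace_sums[OF s] by simp
  fix p assume "p \<in> direct_sum S_minus S_plus"
  then obtain u v f g where p: "p = (u + v, f + g)" and uf: "(u, f) \<in> S_minus" and vg: "(v, g) \<in> S_plus"
    unfolding direct_sum_def by blast
  have "f \<bullet> (\<i> *\<^sub>C u) = 0" "g \<bullet> (\<i> *\<^sub>C v) = 0"
    using symmetric_S_minus symmetric_S_plus uf vg by (auto simp: symmetric_graph_def)
  moreover have "f \<bullet> (\<i> *\<^sub>C v) = 0" "g \<bullet> (\<i> *\<^sub>C u) = 0"
    using uf vg unfolding S_minus_eq_SL_graph S_plus_eq_SL_graph SL_graph_def SL_fun_def
    by (auto simp: L2_class_scaleC L2_fun_cmult intro!: inner_L2_class_disjoint)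
  ultimately show "case p of (u, g) \<Rightarrow> g \<bullet> (\<i> *\<^sub>C u) = 0"
    by (simp add: p scaleC_add_right inner_add_left inner_add_right)
qed


section \<open>The free resolvent on the line\<close>

lemma square_integrable_exp_tail:
  fixes k :: complex and x :: real
  assumes k: "Re k > 0"
  defines "K \<equiv> \<lambda>s. indicator {x..} s *\<^sub>R exp (- (k * of_real (s - x)))"
  shows "square_integrable K" "(norm (L2_class UNIV K))\<^sup>2 = 1 / (2 * Re k)"
proof -
  have sq: "(\<lambda>s. (norm (K s))\<^sup>2) = (\<lambda>s. indicator {x..} s *\<^sub>R (exp (2 * Re k * x) * exp (- (2 * Re k) * s)))"
    by (auto simp: fun_eq_iff K_def power2_eq_square exp_add[symmetric] algebra_simps split: split_indicator)
  have "((\<lambda>s. exp (- (2 * Re k) * s)) has_integral exp (- (2 * Re k) * x) / (2 * Re k)) {x..}"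
    by (rule has_integral_exp_minus_to_infinity) (use k in simp)
  from has_integral_mult_right[OF this, of "exp (2 * Re k * x)"]
  have hi: "((\<lambda>s. exp (2 * Re k * x) * exp (- (2 * Re k) * s)) has_integral 1 / (2 * Re k)) {x..}"
    by (simp add: exp_add[symmetric])
  then have ai: "set_integrable lebesgue {x..} (\<lambda>s. exp (2 * Re k * x) * exp (- (2 * Re k) * s))"
    by (intro nonnegative_absolutely_integrable_1) (auto intro: has_integral_integrable)
  have "continuous_on UNIV (\<lambda>s. exp (- (k * of_real (s - x))))" by (intro continuous_intros)
  then have "(\<lambda>s. exp (- (k * of_real (s - x)))) \<in> borel_measurable lborel"
    by (simp add: borel_measurable_continuous_onI)
  then have m: "K \<in> borel_measurable lebesgue"
    unfolding K_def by (intro measurable_completion borel_measurable_scaleR) auto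
  show K: "square_integrable K"
    using ai m unfolding square_integrable_def sq by (simp add: set_integrable_def)
  show "(norm (L2_class UNIV K))\<^sup>2 = 1 / (2 * Re k)"
    unfolding norm_L2_class_UNIV[OF K] sq
    using set_lebesgue_integral_eq_integral(2)[OF ai] integral_unique[OF hi]
    by (simp only: set_lebesgue_integral_def)
qed

text \<open>
  The solution of \<open>B' = k B - f\<close> that does not grow at infinity. It inverts one factor of
  \<open>k\<^sup>2 - d\<^sup>2/dx\<^sup>2 = (k - d/dx) (k + d/dx)\<close>.
\<close>
definition tail_transform :: "complex \<Rightarrow> (real \<Rightarrow> complex) \<Rightarrow> real \<Rightarrow> complex" where
  "tail_transform k f x = integral\<^sup>L lebesgue (\<lambda>s. indicator {x..} s *\<^sub>R exp (- (k * of_real (s - x))) * f s)"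

lemma tail_transform_bound:
  assumes k: "Re k > 0" and f: "square_integrable f"
  shows "norm (tail_transform k f x) \<le> norm (L2_class UNIV f) / sqrt (2 * Re k)"
proof -
  let ?K = "\<lambda>s. indicator {x..} s *\<^sub>R exp (- (k * of_real (s - x)))"
  note K = square_integrable_exp_tail[OF k, of x]
  have "norm (L2_class UNIV ?K) = sqrt (1 / (2 * Re k))"
    using K(2) by (metis norm_ge_zero real_sqrt_unique)
  then have n: "norm (L2_class UNIV ?K) = 1 / sqrt (2 * Re k)" by (simp add: real_sqrt_divide)
  have "norm (tail_transform k f x) \<le> integral\<^sup>L lebesgue (\<lambda>s. norm (?K s * f s))"
    unfolding tail_transform_def by (rule integral_norm_bound)
  also have "\<dots> = integral\<^sup>L lebesgue (\<lambda>s. norm (?K s) * norm (f s))"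
    by (simp only: norm_mult)
  also have "\<dots> \<le> norm (L2_class UNIV ?K) * norm (L2_class UNIV f)"
    by (rule integral_Cauchy_Schwarz[OF K(1) f])
  finally show ?thesis by (simp only: n) simp
qed

lemma tail_transform_ac:
  assumes k: "Re k > 0" and f: "square_integrable f"
  shows "has_ac_derivative (tail_transform k f) (\<lambda>x. k * tail_transform k f x - f x) UNIV"
proof -
  define m where "m = (\<lambda>s. exp (- (k * of_real s)) * f s)"
  define E where "E = (\<lambda>x. integral\<^sup>L lebesgue (\<lambda>s. indicator {x..} s *\<^sub>R m s))"
  have ex: "exp (k * of_real x) * (indicator {x..} s *\<^sub>R m s)
      = indicator {x..} s *\<^sub>R exp (- (k * of_real (s - x))) * f s" for x s
    by (auto simp: m_def exp_add[symmetric] algebra_simps split: split_indicator)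
  have BE: "tail_transform k f x = exp (k * of_real x) * E x" for x
    unfolding tail_transform_def E_def ex[symmetric] by (rule integral_mult_right_zero)
  have i: "integrable lebesgue (\<lambda>s. indicator {x..} s *\<^sub>R m s)" for x
  proof -
    have "integrable lebesgue (\<lambda>s. exp (- (k * of_real x)) * (indicator {x..} s *\<^sub>R exp (- (k * of_real (s - x))) * f s))"
      by (rule integrable_mult_right, rule integrable_mult_square_integrable[OF square_integrable_exp_tail(1)[OF k] f])
    moreover have "(\<lambda>s. exp (- (k * of_real x)) * (indicator {x..} s *\<^sub>R exp (- (k * of_real (s - x))) * f s))
        = (\<lambda>s. indicator {x..} s *\<^sub>R m s)"
      unfolding ex[symmetric] by (simp add: fun_eq_iff mult.assoc[symmetric] exp_add[symmetric])
    ultimately show ?thesis by simp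
  qed
  have "has_ac_derivative E (\<lambda>s. - m s) UNIV"
  proof (rule has_ac_derivativeI)
    fix a b :: real assume ab: "a \<le> b"
    have mab: "m absolutely_integrable_on {a..b}"
      by (rule set_integrable_subset[of _ "{a..}"]) (use i[of a] in \<open>auto simp: set_integrable_def\<close>)
    show "(\<lambda>s. - m s) absolutely_integrable_on {a..b}"
      using set_integrable_mult_right[OF mab, of "-1"] by simp
    have mab': "m absolutely_integrable_on {a..<b}"
      by (rule set_integrable_subset[OF mab]) auto
    have "E a - E b = integral\<^sup>L lebesgue (\<lambda>s. indicator {a..} s *\<^sub>R m s - indicator {b..} s *\<^sub>R m s)"
      unfolding E_def using i by simp
    also have "(\<lambda>s. indicator {a..} s *\<^sub>R m s - indicator {b..} s *\<^sub>R m s) = (\<lambda>s. indicator {a..<b} s *\<^sub>R m s)"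
      using ab by (auto simp: fun_eq_iff split: split_indicator)
    also have "integral\<^sup>L lebesgue (\<lambda>s. indicator {a..<b} s *\<^sub>R m s) = integral {a..<b} m"
      using set_lebesgue_integral_eq_integral(2)[OF mab'] by (simp add: set_lebesgue_integral_def)
    also have "\<dots> = integral {a..b} m"
      by (rule integral_spike_set) (auto intro: negligible_subset[of "{b}"])
    finally show "E b - E a = integral {a..b} (\<lambda>s. - m s)" by (simp add: algebra_simps)
  qed
  moreover have "has_ac_derivative (\<lambda>x. exp (k * of_real x)) (\<lambda>x. k * exp (k * of_real x)) UNIV"
    by (rule has_ac_derivative_exp)
  ultimately have "has_ac_derivative (\<lambda>x. exp (k * of_real x) * E x)
      (\<lambda>x. k * exp (k * of_real x) * E x + exp (k * of_real x) * (- m x)) UNIV"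
    by (intro has_ac_derivative_mult)
  then show ?thesis
    by (rule has_ac_derivative_cong) (auto simp: BE m_def mult.assoc[symmetric] exp_add[symmetric])
qed

text \<open>
  An energy estimate. From \<open>B' = k B - f\<close> one gets \<open>(|B|\<^sup>2)' = 2 Re k |B|\<^sup>2 - 2 Re (f B\<^sup>*)\<close>;
  since \<open>|B|\<close> is bounded, integrating over \<open>[-c, c]\<close> and absorbing the last term bounds the
  integral of \<open>|B|\<^sup>2\<close> independently of \<open>c\<close>.
\<close>
lemma tail_transform_square_integrable:
  assumes k: "Re k > 0" and f: "square_integrable f"
  shows "square_integrable (tail_transform k f)"
proof -
  let ?B = "tail_transform k f"
  define M where "M = norm (L2_class UNIV f) / sqrt (2 * Re k)"
  have M: "norm (?B x) \<le> M" for x unfolding M_def by (rule tail_transform_bound[OF k f])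
  note B = tail_transform_ac[OF k f]
  have cB: "continuous_on S ?B" for S
    using has_ac_derivative_continuous_UNIV[OF B] continuous_on_subset by blast
  define F where "F = integral\<^sup>L lebesgue (\<lambda>x. (norm (f x))\<^sup>2)"
  have fi: "(\<lambda>x. (norm (f x))\<^sup>2) integrable_on UNIV" "integral UNIV (\<lambda>x. (norm (f x))\<^sup>2) = F"
    using f set_lebesgue_integral_eq_integral[of UNIV "\<lambda>x. (norm (f x))\<^sup>2"]
    by (auto simp: square_integrable_def set_integrable_def set_lebesgue_integral_def F_def)
  have bound: "integral {-c..c} (\<lambda>x. (norm (?B x))\<^sup>2) \<le> (M\<^sup>2 + F / Re k) / Re k" if c: "c \<ge> 0" for c :: real
  proof -
    let ?D = "\<lambda>x. (k * ?B x - f x) * cnj (?B x) + ?B x * cnj (k * ?B x - f x)"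
    have "(?D has_integral (?B c * cnj (?B c) - ?B (-c) * cnj (?B (-c)))) {-c..c}"
      using has_ac_derivativeD(2)[OF has_ac_derivative_mult[OF B has_ac_derivative_cnj[OF B]], of "-c" c] c by simp
    from has_integral_linear[OF this bounded_linear_Re]
    have I: "((\<lambda>x. Re (?D x)) has_integral Re (?B c * cnj (?B c) - ?B (-c) * cnj (?B (-c)))) {-c..c}"
      by (simp only: o_def)
    have re: "Re (w * cnj w) = (norm w)\<^sup>2" for w
      by (simp add: cmod_power2) (simp add: power2_eq_square)
    have D: "((\<lambda>x. Re (?D x)) has_integral ((norm (?B c))\<^sup>2 - (norm (?B (-c)))\<^sup>2)) {-c..c}"
      using I by (simp only: minus_complex.sel re)
    have fc: "(\<lambda>x. (norm (f x))\<^sup>2) integrable_on {-c..c}"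
      using fi(1) integrable_on_subinterval by blast
    have fc': "(\<lambda>x. (norm (f x))\<^sup>2 / Re k) integrable_on {-c..c}"
      using integrable_cmul[OF fc, of "1 / Re k"] by simp
    have "Re k * integral {-c..c} (\<lambda>x. (norm (?B x))\<^sup>2) = integral {-c..c} (\<lambda>x. Re k * (norm (?B x))\<^sup>2)"
      by simp
    also have "\<dots> \<le> integral {-c..c} (\<lambda>x. Re (?D x) + (norm (f x))\<^sup>2 / Re k)"
    proof (rule integral_le)
      show "(\<lambda>x. Re k * (norm (?B x))\<^sup>2) integrable_on {-c..c}"
        by (intro integrable_continuous_real continuous_intros cB)
      show "(\<lambda>x. Re (?D x) + (norm (f x))\<^sup>2 / Re k) integrable_on {-c..c}"
        by (intro integrable_add fc' has_integral_integrable[OF D])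
      fix x
      let ?b = "?B x" and ?f = "f x"
      have "Re (?D x) = 2 * Re k * (norm ?b)\<^sup>2 - 2 * Re (?f * cnj ?b)"
        unfolding cmod_power2 by (simp add: power2_eq_square algebra_simps)
      \<comment> \<open>This weighting leaves \<open>Re k |B|\<^sup>2\<close> of the \<open>2 Re k |B|\<^sup>2\<close> available.\<close>
      moreover have "2 * Re (?f * cnj ?b) \<le> (norm ?f)\<^sup>2 / Re k + Re k * (norm ?b)\<^sup>2"
      proof -
        have "Re (?f * cnj ?b) \<le> norm ?f * norm ?b"
          using complex_Re_le_cmod[of "?f * cnj ?b"] by (simp add: norm_mult)
        moreover have "2 * (norm ?f * norm ?b) \<le> (norm ?f)\<^sup>2 / Re k + Re k * (norm ?b)\<^sup>2"
        proof -
          have "0 \<le> (norm ?f - Re k * norm ?b)\<^sup>2 / Re k" using k by simp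
          also have "\<dots> = (norm ?f)\<^sup>2 / Re k + Re k * (norm ?b)\<^sup>2 - 2 * (norm ?f * norm ?b)"
            using k by (simp add: power2_eq_square field_simps)
          finally show ?thesis by simp
        qed
        ultimately show ?thesis by linarith
      qed
      ultimately show "Re k * (norm ?b)\<^sup>2 \<le> Re (?D x) + (norm ?f)\<^sup>2 / Re k" by linarith
    qed
    also have "\<dots> = ((norm (?B c))\<^sup>2 - (norm (?B (-c)))\<^sup>2) + integral {-c..c} (\<lambda>x. (norm (f x))\<^sup>2) / Re k"
      using integral_add[OF has_integral_integrable[OF D] fc'] integral_unique[OF D] by simp
    also have "\<dots> \<le> M\<^sup>2 + F / Re k"
    proof (rule add_mono)
      have "(norm (?B c))\<^sup>2 \<le> M\<^sup>2" by (intro power_mono M) simp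
      then show "(norm (?B c))\<^sup>2 - (norm (?B (-c)))\<^sup>2 \<le> M\<^sup>2" using zero_le_power2[of "norm (?B (-c))"] by linarith
      show "integral {-c..c} (\<lambda>x. (norm (f x))\<^sup>2) / Re k \<le> F / Re k"
        unfolding fi(2)[symmetric] using k by (intro divide_right_mono integral_subset_le fc fi(1)) auto
    qed
    finally show ?thesis using k by (simp add: field_simps)
  qed
  let ?g = "\<lambda>(n::nat) x. if x \<in> {-real n..real n} then (norm (?B x))\<^sup>2 else 0"
  have "(\<lambda>x. (norm (?B x))\<^sup>2) integrable_on UNIV"
  proof (rule conjunct1[OF monotone_convergence_increasing[where f = ?g]])
    show "?g n integrable_on UNIV" for n
      by (simp only: integrable_restrict_UNIV) (intro integrable_continuous_real continuous_intros cB)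
    show "?g n x \<le> ?g (Suc n) x" for n x by auto
    show "(\<lambda>n. ?g n x) \<longlonglongrightarrow> (norm (?B x))\<^sup>2" for x
    proof (rule tendsto_eventually, rule eventually_sequentiallyI)
      fix n assume "nat \<lceil>\<bar>x\<bar>\<rceil> \<le> n"
      then have "\<bar>x\<bar> \<le> real n" by linarith
      then show "?g n x = (norm (?B x))\<^sup>2" by auto
    qed
    show "bounded (range (\<lambda>n. integral UNIV (?g n)))"
    proof (rule boundedI)
      fix r assume "r \<in> range (\<lambda>n. integral UNIV (?g n))"
      then obtain n where n: "r = integral UNIV (?g n)" by blast
      have "r = integral {-real n..real n} (\<lambda>x. (norm (?B x))\<^sup>2)" unfolding n by (simp only: integral_restrict_UNIV)
      moreover have "0 \<le> integral {-real n..real n} (\<lambda>x. (norm (?B x))\<^sup>2)"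
        by (intro integral_nonneg integrable_continuous_real continuous_intros cB) simp
      ultimately show "norm r \<le> (M\<^sup>2 + F / Re k) / Re k" using bound[of "real n"] by simp
    qed
  qed
  then have "set_integrable lebesgue UNIV (\<lambda>x. (norm (?B x))\<^sup>2)"
    by (intro nonnegative_absolutely_integrable_1) auto
  then have "integrable lebesgue (\<lambda>x. (norm (?B x))\<^sup>2)" by (simp add: set_integrable_def)
  moreover have "?B \<in> borel_measurable lebesgue"
    using cB[of UNIV] by (intro measurable_completion) (simp add: borel_measurable_continuous_onI)
  ultimately show ?thesis by (simp add: square_integrable_def)
qed

text \<open>
  The tail transform \<open>B\<close> of \<open>f\<close> and its mirror image \<open>A\<close> satisfy \<open>B' = k B - f\<close> and
  \<open>A' = f - k A\<close>, so \<open>y = (A + B) / (2 k)\<close> has \<open>y' = (B - A) / 2\<close> and \<open>y'' = k\<^sup>2 y - f\<close>.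
\<close>
lemma free_resolvent_exists:
  assumes k: "Re k > 0" and f: "square_integrable f"
  obtains y y' where "has_ac_derivative y y' UNIV" "has_ac_derivative y' (\<lambda>x. k\<^sup>2 * y x - f x) UNIV"
    "square_integrable y" "square_integrable y'"
    "\<And>x. norm (k * y x) \<le> norm (L2_class UNIV f) / sqrt (2 * Re k)"
    "\<And>x. norm (y' x) \<le> norm (L2_class UNIV f) / sqrt (2 * Re k)"
proof -
  define A where "A = (\<lambda>x. tail_transform k (\<lambda>s. f (- s)) (- x))"
  define B where "B = tail_transform k f"
  have f': "square_integrable (\<lambda>s. f (- s))" by (rule square_integrable_reflect[OF f])
  have k0: "k \<noteq> 0" using k by auto
  have "has_ac_derivative A (\<lambda>x. - (k * A x - f x)) UNIV"
    using has_ac_derivative_reflect[OF tail_transform_ac[OF k f']] by (simp add: A_def)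
  then have A: "has_ac_derivative A (\<lambda>x. f x - k * A x) UNIV" by simp
  have B: "has_ac_derivative B (\<lambda>x. k * B x - f x) UNIV" unfolding B_def by (rule tail_transform_ac[OF k f])
  have AB2: "square_integrable A" "square_integrable B"
    unfolding A_def B_def
    by (rule square_integrable_reflect[OF tail_transform_square_integrable[OF k f']],
        rule tail_transform_square_integrable[OF k f])
  let ?M = "norm (L2_class UNIV f) / sqrt (2 * Re k)"
  have bd: "norm (A x) \<le> ?M" "norm (B x) \<le> ?M" for x
    using tail_transform_bound[OF k f', of "-x"] tail_transform_bound[OF k f, of x]
    by (auto simp: A_def B_def norm_L2_class_reflect[OF f])
  define y where "y = (\<lambda>x. 1 / (2 * k) * (A x + B x))"
  define y' where "y' = (\<lambda>x. 1 / 2 * (B x - A x))"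
  show thesis
  proof (rule that[of y y'])
    have "has_ac_derivative y (\<lambda>x. 1 / (2 * k) * ((f x - k * A x) + (k * B x - f x))) UNIV"
      unfolding y_def by (intro has_ac_derivative_cmult has_ac_derivative_add A B)
    then show "has_ac_derivative y y' UNIV"
      by (rule has_ac_derivative_cong) (use k0 in \<open>auto simp: y'_def field_simps\<close>)
    have "has_ac_derivative y' (\<lambda>x. 1 / 2 * ((k * B x - f x) - (f x - k * A x))) UNIV"
      unfolding y'_def by (intro has_ac_derivative_cmult has_ac_derivative_diff A B)
    then show "has_ac_derivative y' (\<lambda>x. k\<^sup>2 * y x - f x) UNIV"
      by (rule has_ac_derivative_cong) (use k0 in \<open>auto simp: y_def field_simps power2_eq_square\<close>)
    show "square_integrable y" "square_integrable y'"
      unfolding y_def y'_def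
      by (intro square_integrable_cmult square_integrable_add square_integrable_diff AB2)+
    fix x
    have "norm (A x + B x) \<le> 2 * ?M" "norm (B x - A x) \<le> 2 * ?M"
      using norm_triangle_ineq[of "A x" "B x"] norm_triangle_ineq4[of "B x" "A x"] bd[of x] by linarith+
    then show "norm (k * y x) \<le> ?M" "norm (y' x) \<le> ?M"
      using k0 by (auto simp: y_def y'_def norm_mult norm_divide mult.commute)
  qed
qed


section \<open>Continuation by decaying exponentials\<close>

text \<open>
  Two regimes with separate constants, because the difference of the resolvents is small
  inside \<open>[-e, e]\<close> only through the length of the interval, but outside through its coefficient.
\<close>
lemma decaying_square_integrable:
  fixes d :: "real \<Rightarrow> complex" and k :: complex
  assumes k: "Re k > 0" and m: "d \<in> borel_measurable lebesgue" and e: "e \<ge> 0"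
    and 1: "\<And>x. \<bar>x\<bar> \<le> e \<Longrightarrow> norm (d x) \<le> C" and 2: "\<And>x. \<bar>x\<bar> > e \<Longrightarrow> norm (d x) \<le> D * exp (- (Re k * \<bar>x\<bar>))"
  shows "square_integrable d" "(norm (L2_class UNIV d))\<^sup>2 \<le> 2 * e * C\<^sup>2 + D\<^sup>2 / Re k"
proof -
  let ?K = "\<lambda>s. indicator {0..} s *\<^sub>R exp (- (k * of_real (s - 0)))"
  let ?K' = "\<lambda>s. ?K (- s)"
  note K = square_integrable_exp_tail[OF k, of 0]
  have K': "square_integrable ?K'" by (rule square_integrable_reflect[OF K(1)])
  have nK': "(norm (L2_class UNIV ?K'))\<^sup>2 = 1 / (2 * Re k)"
    using norm_L2_class_reflect[OF K(1)] K(2) by simp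
  let ?g = "\<lambda>x. C\<^sup>2 * indicator {-e..e} x + D\<^sup>2 * ((norm (?K x))\<^sup>2 + (norm (?K' x))\<^sup>2)"
  have ind: "integrable lebesgue (indicat_real {-e..e})"
    by (intro lmeasurable_iff_integrable[THEN iffD1] bounded_set_imp_lmeasurable) auto
  have iK: "integrable lebesgue (\<lambda>x. (norm (?K x))\<^sup>2)" "integrable lebesgue (\<lambda>x. (norm (?K' x))\<^sup>2)"
    using K(1) K' unfolding square_integrable_def by blast+
  have g: "integrable lebesgue ?g"
    by (intro Bochner_Integration.integrable_add integrable_mult_right ind iK)
  have le: "(norm (d x))\<^sup>2 \<le> ?g x" for x
  proof (cases "\<bar>x\<bar> \<le> e")
    case True
    have "(norm (d x))\<^sup>2 \<le> C\<^sup>2" by (rule power_mono[OF 1[OF True]]) simp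
    then show ?thesis using True by (simp add: indicator_def abs_le_iff add_increasing2)
  next
    case False
    then have "(norm (d x))\<^sup>2 \<le> (D * exp (- (Re k * \<bar>x\<bar>)))\<^sup>2" by (intro power_mono 2) auto
    also have "\<dots> = D\<^sup>2 * (exp (- (Re k * \<bar>x\<bar>)))\<^sup>2" by (simp add: power_mult_distrib)
    also have "\<dots> \<le> D\<^sup>2 * ((norm (?K x))\<^sup>2 + (norm (?K' x))\<^sup>2)"
      by (intro mult_left_mono) (auto simp: abs_if split: split_indicator)
    also have "\<dots> \<le> ?g x" by simp
    finally show ?thesis .
  qed
  show d: "square_integrable d"
    unfolding square_integrable_def
  proof
    show "integrable lebesgue (\<lambda>x. (norm (d x))\<^sup>2)"
    proof (rule Bochner_Integration.integrable_bound[OF g])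
      show "(\<lambda>x. (norm (d x))\<^sup>2) \<in> borel_measurable lebesgue" using m by measurable
      show "AE x in lebesgue. norm ((norm (d x))\<^sup>2) \<le> norm (?g x)"
      proof (rule AE_I2)
        show "norm ((norm (d x))\<^sup>2) \<le> norm (?g x)" for x
          using le[of x] zero_le_power2[of "norm (d x)"] unfolding real_norm_def by linarith
      qed
    qed
  qed (rule m)
  have "(norm (L2_class UNIV d))\<^sup>2 \<le> integral\<^sup>L lebesgue ?g"
    unfolding norm_L2_class_UNIV[OF d] using d le by (intro integral_mono g) (auto simp: square_integrable_def)
  also have "\<dots> = C\<^sup>2 * integral\<^sup>L lebesgue (indicat_real {-e..e})
      + D\<^sup>2 * (integral\<^sup>L lebesgue (\<lambda>x. (norm (?K x))\<^sup>2) + integral\<^sup>L lebesgue (\<lambda>x. (norm (?K' x))\<^sup>2))"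
    by (simp only: Bochner_Integration.integral_add Bochner_Integration.integrable_add integrable_mult_right integral_mult_right_zero ind iK)
  also have "\<dots> = C\<^sup>2 * (2 * e) + D\<^sup>2 * (1 / (2 * Re k) + 1 / (2 * Re k))"
    unfolding K(2)[unfolded norm_L2_class_UNIV[OF K(1)]] nK'[unfolded norm_L2_class_UNIV[OF K']]
    using e by simp
  also have "\<dots> = 2 * e * C\<^sup>2 + D\<^sup>2 / Re k" using k by (simp add: field_simps)
  finally show "(norm (L2_class UNIV d))\<^sup>2 \<le> 2 * e * C\<^sup>2 + D\<^sup>2 / Re k" .
qed

lemma continuous_decaying_square_integrable:
  fixes w :: "real \<Rightarrow> complex"
  assumes k: "Re k > 0" and c: "continuous_on UNIV w" and e: "e \<ge> 0"
    and 2: "\<And>x. \<bar>x\<bar> > e \<Longrightarrow> norm (w x) \<le> D * exp (- (Re k * \<bar>x\<bar>))"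
  shows "square_integrable w"
proof -
  have "compact (w ` {-e..e})"
    by (intro compact_continuous_image continuous_on_subset[OF c]) auto
  then obtain B where B: "\<And>x. x \<in> {-e..e} \<Longrightarrow> norm (w x) \<le> B"
    by (meson bounded_iff compact_imp_bounded imageI)
  have "w \<in> borel_measurable lebesgue"
    using c by (intro measurable_completion) (simp add: borel_measurable_continuous_onI)
  then show ?thesis
    by (rule decaying_square_integrable(1)[OF k _ e _ 2, where C = B]) (auto intro!: B)
qed

lemma continuous_not_AE_zero:
  fixes f :: "real \<Rightarrow> complex"
  assumes f: "continuous_on {a..b} f" and ab: "a < b" and fa: "f a \<noteq> 0"
  shows "\<not> (AE x in lebesgue. x \<in> {a..b} \<longrightarrow> f x = 0)"
proof
  assume "AE x in lebesgue. x \<in> {a..b} \<longrightarrow> f x = 0"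
  then have neg: "negligible {x. \<not> (x \<in> {a..b} \<longrightarrow> f x = 0)}"
    unfolding eventually_ae_filter_negligible using negligible_subset by blast
  obtain r where r: "r > 0" "\<And>x. x \<in> {a..b} \<Longrightarrow> dist x a < r \<Longrightarrow> dist (f x) (f a) < norm (f a)"
    using f[unfolded continuous_on_iff, rule_format, of a "norm (f a)"] ab fa by auto
  have "{a<..<min b (a + r)} \<subseteq> {x. \<not> (x \<in> {a..b} \<longrightarrow> f x = 0)}"
  proof
    fix x assume x: "x \<in> {a<..<min b (a + r)}"
    then have "dist (f x) (f a) < norm (f a)" by (intro r) (auto simp: dist_real_def)
    then have "f x \<noteq> 0" by auto
    then show "x \<in> {x. \<not> (x \<in> {a..b} \<longrightarrow> f x = 0)}" using x by auto
  qed
  then have "negligible {a<..<min b (a + r)}" using neg negligible_subset by blast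
  moreover have "{a<..<min b (a + r)} \<noteq> {}" using ab r(1) by simp
  ultimately show False using open_not_negligible[of "{a<..<min b (a + r)}"] by simp
qed

text \<open>
  A solution \<open>m\<close> on \<open>[-e, e]\<close> is continued by \<open>y\<close> plus a multiple of the decaying exponential.
  The multiple is determined by continuity of the function, and continuity of the derivative is
  then exactly the Robin condition.
\<close>
lemma glue_decaying_tails:
  fixes m m' y y' f :: "real \<Rightarrow> complex" and Q :: "real \<Rightarrow> real"
  assumes k: "Re k > 0" and e: "e > 0" and Q: "\<And>x. \<bar>x\<bar> > e \<Longrightarrow> Q x = 0"
    and y: "has_ac_derivative y y' UNIV" "has_ac_derivative y' (\<lambda>x. k\<^sup>2 * y x - f x) UNIV"
      "square_integrable y" "square_integrable y'"
    and m: "has_ac_derivative m m' {-e..e}" "has_ac_derivative m' (\<lambda>x. (of_real (Q x) + k\<^sup>2) * m x - f x) {-e..e}"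
    and right: "m' e + k * m e = y' e + k * y e"
    and left: "m' (-e) - k * m (-e) = y' (-e) - k * y (-e)"
  obtains u u' where "has_ac_derivative u u' UNIV" "has_ac_derivative u' (\<lambda>x. (of_real (Q x) + k\<^sup>2) * u x - f x) UNIV"
    "square_integrable u" "square_integrable u'"
    "\<And>x. x \<in> {-e..e} \<Longrightarrow> u x = m x" "\<And>x. x \<in> {-e..e} \<Longrightarrow> u' x = m' x"
    "\<And>x. x \<ge> e \<Longrightarrow> u x = y x + (m e - y e) * exp (- (k * of_real (x - e)))"
    "\<And>x. x \<le> - e \<Longrightarrow> u x = y x + (m (-e) - y (-e)) * exp (k * of_real (x + e))"
proof -
  define a where "a = (m e - y e) * exp (k * of_real e)"
  define b where "b = (m (-e) - y (-e)) * exp (k * of_real e)"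
  define R where "R = (\<lambda>x. y x + a * exp ((-k) * of_real x))"
  define R' where "R' = (\<lambda>x. y' x + a * ((-k) * exp ((-k) * of_real x)))"
  define L where "L = (\<lambda>x. y x + b * exp (k * of_real x))"
  define L' where "L' = (\<lambda>x. y' x + b * (k * exp (k * of_real x)))"
  define u where "u = (\<lambda>x. if x < -e then L x else if x \<le> e then m x else R x)"
  define u' where "u' = (\<lambda>x. if x < -e then L' x else if x \<le> e then m' x else R' x)"
  define u'' where "u'' = (\<lambda>x. (of_real (Q x) + k\<^sup>2) * u x - f x)"
  have ee: "exp (k * of_real e) * exp (- (k * of_real e)) = 1" by (simp add: exp_minus_inverse)
  have Re: "R e = m e" using ee by (simp add: R_def a_def mult.assoc)
  have Le: "L (-e) = m (-e)" using ee by (simp add: L_def b_def mult.assoc)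
  have ae: "a * exp ((-k) * of_real e) = m e - y e" using Re by (simp add: R_def algebra_simps)
  have be: "b * exp (k * of_real (-e)) = m (-e) - y (-e)" using Le by (simp add: L_def algebra_simps)
  have R'e: "R' e = m' e"
  proof -
    have "R' e = y' e - k * (a * exp ((-k) * of_real e))" by (simp add: R'_def)
    also have "\<dots> = m' e" unfolding ae using right by (simp add: algebra_simps)
    finally show ?thesis .
  qed
  have L'e: "L' (-e) = m' (-e)"
  proof -
    have "L' (-e) = y' (-e) + k * (b * exp (k * of_real (-e)))" by (simp add: L'_def)
    also have "\<dots> = m' (-e)" unfolding be using left by (simp add: algebra_simps)
    finally show ?thesis .
  qed
  have R: "has_ac_derivative R R' UNIV" "has_ac_derivative R' (\<lambda>x. (k\<^sup>2 * y x - f x) + a * ((-k) * ((-k) * exp ((-k) * of_real x)))) UNIV"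
    unfolding R_def R'_def by (intro has_ac_derivative_add has_ac_derivative_cmult has_ac_derivative_exp y)+
  have L: "has_ac_derivative L L' UNIV" "has_ac_derivative L' (\<lambda>x. (k\<^sup>2 * y x - f x) + b * (k * (k * exp (k * of_real x)))) UNIV"
    unfolding L_def L'_def by (intro has_ac_derivative_add has_ac_derivative_cmult has_ac_derivative_exp y)+
  have uR: "u x = R x" "u' x = R' x" if "x \<ge> e" for x using that e Re R'e by (auto simp: u_def u'_def)
  have uL: "u x = L x" "u' x = L' x" if "x \<le> -e" for x using that e Le L'e by (auto simp: u_def u'_def)
  have um: "u x = m x" "u' x = m' x" if "x \<in> {-e..e}" for x using that by (auto simp: u_def u'_def)
  have glue: "has_ac_derivative g h UNIV"
    if "has_ac_derivative g h {..-e}" "has_ac_derivative g h {-e..e}" "has_ac_derivative g h {e..}" for g h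
  proof (rule has_ac_derivative_glue[where c = "-e"])
    have eq: "UNIV \<inter> {-e..} \<inter> {..e} = {-e..e}" "UNIV \<inter> {-e..} \<inter> {e..} = {e..}" using e by auto
    show "has_ac_derivative g h (UNIV \<inter> {-e..})"
      by (rule has_ac_derivative_glue[where c = e]) (simp_all only: eq that)
  qed (use that in simp)
  have ac1: "has_ac_derivative u u' UNIV"
  proof (rule glue)
    show "has_ac_derivative u u' {..-e}"
      by (rule has_ac_derivative_cong[OF has_ac_derivative_subset[OF L(1)]]) (auto simp: uL)
    show "has_ac_derivative u u' {-e..e}"
      by (rule has_ac_derivative_cong[OF m(1)]) (auto simp: um)
    show "has_ac_derivative u u' {e..}"
      by (rule has_ac_derivative_cong[OF has_ac_derivative_subset[OF R(1)]]) (auto simp: uR)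
  qed
  have ac2: "has_ac_derivative u' u'' UNIV"
  proof (rule glue)
    show "has_ac_derivative u' u'' {..-e}"
    \<comment> \<open>\<open>Q\<close> is only known to vanish strictly outside \<open>[-e, e]\<close>.\<close>
    proof (rule has_ac_derivative_spike[where N = "{-e}"])
      show "has_ac_derivative u' (\<lambda>x. (k\<^sup>2 * y x - f x) + b * (k * (k * exp (k * of_real x)))) {..-e}"
        by (rule has_ac_derivative_cong[OF has_ac_derivative_subset[OF L(2)]]) (auto simp: uL)
      show "u'' x = (k\<^sup>2 * y x - f x) + b * (k * (k * exp (k * of_real x)))" if "x \<in> {..-e} - {-e}" for x
        using that Q[of x] e by (auto simp: u''_def uL L_def power2_eq_square algebra_simps)
    qed simp
    show "has_ac_derivative u' u'' {-e..e}"
      by (rule has_ac_derivative_cong[OF m(2)]) (auto simp: um u''_def)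
    show "has_ac_derivative u' u'' {e..}"
    proof (rule has_ac_derivative_spike[where N = "{e}"])
      show "has_ac_derivative u' (\<lambda>x. (k\<^sup>2 * y x - f x) + a * ((-k) * ((-k) * exp ((-k) * of_real x)))) {e..}"
        by (rule has_ac_derivative_cong[OF has_ac_derivative_subset[OF R(2)]]) (auto simp: uR)
      show "u'' x = (k\<^sup>2 * y x - f x) + a * ((-k) * ((-k) * exp ((-k) * of_real x)))" if "x \<in> {e..} - {e}" for x
        using that Q[of x] e by (auto simp: u''_def uR R_def power2_eq_square algebra_simps)
    qed simp
  qed
  let ?D = "max (norm a) (norm b)"
  have expn: "norm (exp (k * of_real x)) = exp (Re k * x)" "norm (exp ((-k) * of_real x)) = exp (- (Re k * x))" for x
    by (simp_all add: norm_exp_eq_Re)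
  have sq1: "square_integrable (\<lambda>x. u x - y x)"
  proof (rule continuous_decaying_square_integrable[OF k])
    show "continuous_on UNIV (\<lambda>x. u x - y x)"
      by (intro continuous_on_diff has_ac_derivative_continuous_UNIV[OF ac1] has_ac_derivative_continuous_UNIV[OF y(1)])
    fix x assume x: "\<bar>x\<bar> > e"
    then consider "x \<ge> e" "\<bar>x\<bar> = x" | "x \<le> -e" "\<bar>x\<bar> = - x" using e by linarith
    then show "norm (u x - y x) \<le> ?D * exp (- (Re k * \<bar>x\<bar>))"
    proof cases
      case 1 then show ?thesis by (simp only: uR R_def add_diff_cancel_left' norm_mult expn) (simp add: mult_right_mono)
    next
      case 2 then show ?thesis by (simp only: uL L_def add_diff_cancel_left' norm_mult expn) (simp add: mult_right_mono)
    qed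
  qed (use e in simp)
  have sq2: "square_integrable (\<lambda>x. u' x - y' x)"
  proof (rule continuous_decaying_square_integrable[OF k])
    show "continuous_on UNIV (\<lambda>x. u' x - y' x)"
      by (intro continuous_on_diff has_ac_derivative_continuous_UNIV[OF ac2] has_ac_derivative_continuous_UNIV[OF y(2)])
    fix x assume x: "\<bar>x\<bar> > e"
    then consider "x \<ge> e" "\<bar>x\<bar> = x" | "x \<le> -e" "\<bar>x\<bar> = - x" using e by linarith
    then show "norm (u' x - y' x) \<le> (?D * norm k) * exp (- (Re k * \<bar>x\<bar>))"
    proof cases
      case 1 then show ?thesis
        by (simp only: uR R'_def add_diff_cancel_left' norm_mult norm_minus_cancel expn mult.assoc[symmetric])
          (simp add: mult_right_mono)
    next
      case 2 then show ?thesis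
        by (simp only: uL L'_def add_diff_cancel_left' norm_mult expn mult.assoc[symmetric])
          (simp add: mult_right_mono)
    qed
  qed (use e in simp)
  show thesis
  proof (rule that[of u u'])
    show "has_ac_derivative u' (\<lambda>x. (of_real (Q x) + k\<^sup>2) * u x - f x) UNIV"
      using ac2 by (simp add: u''_def)
    show "square_integrable u" using square_integrable_add[OF sq1 y(3)] by simp
    show "square_integrable u'" using square_integrable_add[OF sq2 y(4)] by simp
    show "u x = y x + (m e - y e) * exp (- (k * of_real (x - e)))" if "x \<ge> e" for x
      using uR(1)[OF that] by (simp add: R_def a_def exp_add[symmetric] algebra_simps)
    show "u x = y x + (m (-e) - y (-e)) * exp (k * of_real (x + e))" if "x \<le> -e" for x
      using uL(1)[OF that] by (simp add: L_def b_def exp_add[symmetric] algebra_simps)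
  qed (use ac1 um in auto)
qed


section \<open>Construction of the two resolvents\<close>

lemma schroedinger_graphI:
  assumes "has_ac_derivative u u' UNIV" "has_ac_derivative u' (\<lambda>x. (of_real (Q x) + k\<^sup>2) * u x - f x) UNIV"
    and sq: "square_integrable u" "square_integrable u'" "square_integrable f"
  shows "(L2_class UNIV u, L2_class UNIV f + (- k\<^sup>2) *\<^sub>C L2_class UNIV u) \<in> schroedinger Q"
proof -
  define u'' where "u'' = (\<lambda>x. (of_real (Q x) + k\<^sup>2) * u x - f x)"
  have eq: "(\<lambda>x. - u'' x + of_real (Q x) * u x) = (\<lambda>x. f x + (- k\<^sup>2) * u x)"
    by (simp add: u''_def fun_eq_iff algebra_simps)
  have "square_integrable (\<lambda>x. f x + (- k\<^sup>2) * u x)"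
    by (intro square_integrable_add square_integrable_cmult sq)
  then have "SL_fun UNIV Q u u' u''"
    unfolding SL_fun_def L2_fun_UNIV eq using assms by (simp add: u''_def)
  from SL_graphI[where P = "\<lambda>_. True", OF this TrueI]
  have "(L2_class UNIV u, L2_class UNIV (\<lambda>x. f x + (- k\<^sup>2) * u x)) \<in> schroedinger Q"
    unfolding schroedinger_eq_SL_graph eq .
  also have "L2_class UNIV (\<lambda>x. f x + (- k\<^sup>2) * u x) = L2_class UNIV f + (- k\<^sup>2) *\<^sub>C L2_class UNIV u"
    by (rule L2_class_add_scaleC[OF sq(3,1)])
  finally show ?thesis .
qed

text \<open>
  Otherwise \<open>m\<close>, continued by decaying exponentials, would be an eigenfunction of a symmetric
  operator with the non-real eigenvalue \<open>- k\<^sup>2\<close>.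
\<close>
lemma outgoing_solution_nonzero:
  fixes Q :: "real \<Rightarrow> real"
  assumes k: "Re k > 0" "Im (k\<^sup>2) \<noteq> 0" and e: "e > 0" and Q: "\<And>x. \<bar>x\<bar> > e \<Longrightarrow> Q x = 0"
    and m: "has_ac_derivative m m' {-e..e}" "has_ac_derivative m' (\<lambda>x. (of_real (Q x) + k\<^sup>2) * m x) {-e..e}"
    and m0: "m (-e) = 1" "m' (-e) = k"
  shows "m' e + k * m e \<noteq> 0"
proof
  assume 0: "m' e + k * m e = 0"
  have z: "has_ac_derivative (\<lambda>x. 0) (\<lambda>x. 0) UNIV" by (simp add: has_ac_derivative_def)
  obtain u u' where u: "has_ac_derivative u u' UNIV" "has_ac_derivative u' (\<lambda>x. (of_real (Q x) + k\<^sup>2) * u x - 0) UNIV"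
    "square_integrable u" "square_integrable u'" "\<And>x. x \<in> {-e..e} \<Longrightarrow> u x = m x"
  proof (rule glue_decaying_tails[OF k(1) e, of Q "\<lambda>_. 0" "\<lambda>_. 0" "\<lambda>_. 0" m m'])
    show "has_ac_derivative m' (\<lambda>x. (of_real (Q x) + k\<^sup>2) * m x - 0) {-e..e}" using m(2) by simp
  qed (use Q z m(1) m0 0 square_integrable_zero in auto)
  have A: "(L2_class UNIV u, 0 + (- k\<^sup>2) *\<^sub>C L2_class UNIV u) \<in> schroedinger Q"
    using schroedinger_graphI[OF u(1-4) square_integrable_zero] by (simp only: L2_class_zero)
  have "L2_class UNIV u = 0"
    using symmetric_graph_lower_bound[OF symmetric_schroedinger A, of "- k\<^sup>2"] k(2)
    by (simp add: mult_le_0_iff)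
  then have "L2_class UNIV u = L2_class UNIV (\<lambda>x. 0)" by (simp only: L2_class_zero)
  then have "AE x in lebesgue. u x = 0"
    using u(3) by (simp add: L2_class_eq_iff L2_fun_UNIV square_integrable_zero)
  then have "AE x in lebesgue. x \<in> {-e..e} \<longrightarrow> u x = 0" by (rule eventually_mono) simp
  moreover have "u (-e) \<noteq> 0" using u(5)[of "-e"] m0 e by simp
  ultimately show False
    using continuous_not_AE_zero[of "-e" e u] e has_ac_derivative_continuous_on_Icc[OF u(1)] by simp
qed

text \<open>
  Inside \<open>[-e, e]\<close>, start from a particular solution \<open>p\<close> with the initial data of \<open>y\<close> at
  \<open>-e\<close> and add a multiple of the homogeneous solution \<open>\<phi>\<close> with data \<open>(1, k)\<close>. The left Robin
  condition then holds automatically, and the right one fixes the multiple, because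
  \<open>\<phi>\<close> violates its homogeneous form.
\<close>
lemma schroedinger_solution:
  fixes Q :: "real \<Rightarrow> real"
  assumes k: "Re k > 0" "Im (k\<^sup>2) \<noteq> 0" and e: "e > 0" and Q: "\<And>x. \<bar>x\<bar> > e \<Longrightarrow> Q x = 0" "integrable lebesgue Q"
    and f: "square_integrable f"
    and y: "has_ac_derivative y y' UNIV" "has_ac_derivative y' (\<lambda>x. k\<^sup>2 * y x - f x) UNIV"
      "square_integrable y" "square_integrable y'"
  obtains u u' where "has_ac_derivative u u' UNIV" "has_ac_derivative u' (\<lambda>x. (of_real (Q x) + k\<^sup>2) * u x - f x) UNIV"
    "square_integrable u" "square_integrable u'"
    "u' e + k * u e = y' e + k * y e" "u' (-e) - k * u (-e) = y' (-e) - k * y (-e)"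
    "\<And>x. x \<ge> e \<Longrightarrow> u x = y x + (u e - y e) * exp (- (k * of_real (x - e)))"
    "\<And>x. x \<le> - e \<Longrightarrow> u x = y x + (u (-e) - y (-e)) * exp (k * of_real (x + e))"
proof -
  define q where "q = (\<lambda>x. complex_of_real (Q x) + k\<^sup>2)"
  have "set_integrable lebesgue {-e..e} Q"
    by (rule set_integrable_subset[of _ UNIV]) (use Q(2) in \<open>auto simp: set_integrable_def\<close>)
  then have "set_integrable lebesgue {-e..e} (\<lambda>x. complex_of_real (Q x))"
    using absolutely_integrable_linear[OF _ bounded_linear_of_real] by (simp add: o_def)
  moreover have "set_integrable lebesgue {-e..e} (\<lambda>x. k\<^sup>2)"
    by (intro absolutely_integrable_continuous_real) auto
  ultimately have q: "q absolutely_integrable_on {-e..e}"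
    unfolding q_def by (rule set_integral_add)
  have fi: "f absolutely_integrable_on {-e..e}"
    by (rule L2_fun_set_integrable_bounded[of UNIV]) (use f in \<open>auto simp: L2_fun_UNIV intro: bounded_set_imp_lmeasurable\<close>)
  have fi': "(\<lambda>x. - f x) absolutely_integrable_on {-e..e}"
    using set_integrable_mult_right[OF fi, of "-1"] by simp
  obtain \<phi> \<phi>' where \<phi>: "has_ac_derivative \<phi> \<phi>' {-e..e}" "has_ac_derivative \<phi>' (\<lambda>x. q x * \<phi> x + 0) {-e..e}"
    and \<phi>0: "\<phi> (-e) = 1" "\<phi>' (-e) = k"
    by (rule initial_value_exists[OF q, of "\<lambda>_. 0" 1 k]) (use e in auto)
  obtain p p' where p: "has_ac_derivative p p' {-e..e}" "has_ac_derivative p' (\<lambda>x. q x * p x + - f x) {-e..e}"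
    and p0: "p (-e) = y (-e)" "p' (-e) = y' (-e)"
    by (rule initial_value_exists[OF q fi', of "y (-e)" "y' (-e)"]) (use e in auto)
  have nz: "\<phi>' e + k * \<phi> e \<noteq> 0"
    by (rule outgoing_solution_nonzero[OF k e Q(1) \<phi>(1)]) (use \<phi>(2) \<phi>0 in \<open>auto simp: q_def\<close>)
  define c where "c = (y' e + k * y e - (p' e + k * p e)) / (\<phi>' e + k * \<phi> e)"
  have c: "c * (\<phi>' e + k * \<phi> e) = y' e + k * y e - (p' e + k * p e)" using nz by (simp add: c_def)
  define m where "m = (\<lambda>x. p x + c * \<phi> x)"
  define m' where "m' = (\<lambda>x. p' x + c * \<phi>' x)"
  have m: "has_ac_derivative m m' {-e..e}" unfolding m_def m'_def
    by (intro has_ac_derivative_add has_ac_derivative_cmult p \<phi>)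
  have "has_ac_derivative m' (\<lambda>x. (q x * p x + - f x) + c * (q x * \<phi> x + 0)) {-e..e}" unfolding m'_def
    by (intro has_ac_derivative_add has_ac_derivative_cmult p \<phi>)
  then have m': "has_ac_derivative m' (\<lambda>x. (of_real (Q x) + k\<^sup>2) * m x - f x) {-e..e}"
    by (rule has_ac_derivative_cong) (auto simp: m_def q_def algebra_simps)
  have right: "m' e + k * m e = y' e + k * y e"
    using c by (simp add: m_def m'_def algebra_simps)
  have left: "m' (-e) - k * m (-e) = y' (-e) - k * y (-e)"
    by (simp add: m_def m'_def p0 \<phi>0 algebra_simps)
  have ends: "e \<in> {-e..e}" "-e \<in> {-e..e}" using e by auto
  obtain u u' where u: "has_ac_derivative u u' UNIV" "has_ac_derivative u' (\<lambda>x. (of_real (Q x) + k\<^sup>2) * u x - f x) UNIV"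
    "square_integrable u" "square_integrable u'"
    "\<And>x. x \<in> {-e..e} \<Longrightarrow> u x = m x" "\<And>x. x \<in> {-e..e} \<Longrightarrow> u' x = m' x"
    "\<And>x. x \<ge> e \<Longrightarrow> u x = y x + (m e - y e) * exp (- (k * of_real (x - e)))"
    "\<And>x. x \<le> - e \<Longrightarrow> u x = y x + (m (-e) - y (-e)) * exp (k * of_real (x + e))"
    by (rule glue_decaying_tails[OF k(1) e Q(1) y m m' right left]) blast+
  show thesis
    by (rule that[OF u(1-4)]) (use right left u(7,8) in \<open>simp_all add: u(5,6)[OF ends(1)] u(5,6)[OF ends(2)]\<close>)
qed

text \<open>
  On each half line \<open>v\<close> differs from \<open>y\<close> by a decaying solution of the homogeneous equation,
  chosen so that \<open>v 0 = 0\<close>.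
\<close>
lemma dirichlet_solution:
  assumes k: "Re k > 0" and f: "square_integrable f"
    and y: "has_ac_derivative y y' UNIV" "has_ac_derivative y' (\<lambda>x. k\<^sup>2 * y x - f x) UNIV"
      "square_integrable y" "square_integrable y'"
  defines "v \<equiv> \<lambda>x. y x - y 0 * exp (- (k * of_real \<bar>x\<bar>))"
  shows "continuous_on UNIV v" "square_integrable v"
    "(L2_class UNIV v, L2_class UNIV f + (- k\<^sup>2) *\<^sub>C L2_class UNIV v) \<in> direct_sum S_minus S_plus"
proof -
  have cy: "continuous_on UNIV y" by (rule has_ac_derivative_continuous_UNIV[OF y(1)])
  show cv: "continuous_on UNIV v" unfolding v_def by (intro continuous_intros cy)
  have n: "norm (exp (- (k * of_real \<bar>x\<bar>))) = exp (- (Re k * \<bar>x\<bar>))" for x by (simp add: norm_exp_eq_Re)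
  have E: "square_integrable (\<lambda>x. exp (- (k * of_real \<bar>x\<bar>)))"
    by (rule continuous_decaying_square_integrable[OF k, of _ 0 1]) (auto simp: n intro!: continuous_intros)
  show v: "square_integrable v"
    unfolding v_def by (intro square_integrable_diff square_integrable_cmult y E)
  define g where "g = (\<lambda>x. f x + (- k\<^sup>2) * v x)"
  have g: "square_integrable g" unfolding g_def by (intro square_integrable_add square_integrable_cmult f v)
  have sub: "L2_fun A h" if "square_integrable h" "A \<in> sets lebesgue" for A h
    by (rule L2_fun_subset[of UNIV]) (use that in \<open>auto simp: L2_fun_UNIV\<close>)
  have half: "(L2_class A v, L2_class A g) \<in> SL_graph A (\<lambda>_. 0) P"
    if A: "A \<in> sets lebesgue" and s: "\<And>x. x \<in> A \<Longrightarrow> \<bar>x\<bar> = s * x" "s\<^sup>2 = 1" and P: "P v" for A s P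
  proof -
    \<comment> \<open>Here \<open>s\<close> is the sign of the points of \<open>A\<close>, so that \<open>e\<^bsup>-k|x|\<^esup> = e\<^bsup>b x\<^esup>\<close> on \<open>A\<close>.\<close>
    define b where "b = - (k * complex_of_real s)"
    have b2: "b * (b * w) = k\<^sup>2 * w" for w
    proof -
      have "b * b = k\<^sup>2 * (of_real (s\<^sup>2))" by (simp add: b_def power2_eq_square)
      then show ?thesis using s(2) by (simp add: mult.assoc[symmetric])
    qed
    have vA: "v x = y x - y 0 * exp (b * of_real x)" if "x \<in> A" for x
      using s(1)[OF that] by (simp add: v_def b_def mult.assoc)
    define v' where "v' = (\<lambda>x. y' x - y 0 * (b * exp (b * of_real x)))"
    define v'' where "v'' = (\<lambda>x. (k\<^sup>2 * y x - f x) - y 0 * (b * (b * exp (b * of_real x))))"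
    have "has_ac_derivative (\<lambda>x. y x - y 0 * exp (b * of_real x)) v' A"
      unfolding v'_def
      by (rule has_ac_derivative_subset[of _ _ UNIV])
        (intro has_ac_derivative_diff has_ac_derivative_cmult has_ac_derivative_exp y, simp)
    then have ac1: "has_ac_derivative v v' A"
      by (rule has_ac_derivative_cong) (auto simp: vA)
    have ac2: "has_ac_derivative v' v'' A"
      unfolding v'_def v''_def
      by (rule has_ac_derivative_subset[of _ _ UNIV])
        (intro has_ac_derivative_diff has_ac_derivative_cmult has_ac_derivative_exp y, simp)
    have "L2_fun A (\<lambda>x. y' x - y 0 * (b * exp (- (k * of_real \<bar>x\<bar>))))"
      by (intro sub square_integrable_diff square_integrable_cmult y E A)
    also have "L2_fun A (\<lambda>x. y' x - y 0 * (b * exp (- (k * of_real \<bar>x\<bar>)))) = L2_fun A v'"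
      by (rule L2_fun_cong) (simp add: v'_def s(1) b_def mult.assoc)
    finally have l2: "L2_fun A v'" .
    have eq: "- v'' x + of_real 0 * v x = g x" if "x \<in> A" for x
      by (simp add: v''_def g_def vA[OF that] b2 algebra_simps)
    have "L2_fun A (\<lambda>x. - v'' x + of_real 0 * v x)"
      using L2_fun_cong[of A "\<lambda>x. - v'' x + of_real 0 * v x" g] eq sub[OF g A] by blast
    then have "SL_fun A (\<lambda>_. 0) v v' v''"
      unfolding SL_fun_def using ac1 ac2 l2 sub[OF v A] by blast
    from SL_graphI[where P = P, OF this P] show ?thesis
      using L2_class_cong[of A "\<lambda>x. - v'' x + of_real 0 * v x" g] eq by simp
  qed
  have lim: "(v \<longlongrightarrow> 0) (at 0)"
  proof -
    have "isCont v 0" using cv by (simp add: continuous_on_eq_continuous_at)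
    moreover have "v 0 = 0" by (simp add: v_def)
    ultimately show ?thesis by (simp add: isCont_def)
  qed
  have "(L2_class {..<0} v, L2_class {..<0} g) \<in> S_minus"
    unfolding S_minus_eq_SL_graph
    by (rule half[of _ "-1"]) (use lim in \<open>auto intro: filterlim_at_within_not_equal tendsto_within_subset\<close>)
  moreover have "(L2_class {0<..} v, L2_class {0<..} g) \<in> S_plus"
    unfolding S_plus_eq_SL_graph
    by (rule half[of _ 1]) (use lim in \<open>auto intro: tendsto_within_subset\<close>)
  ultimately have "(L2_class {..<0} v + L2_class {0<..} v, L2_class {..<0} g + L2_class {0<..} g) \<in> direct_sum S_minus S_plus"
    unfolding direct_sum_def by blast
  moreover have "L2_class {..<0} h + L2_class {0<..} h = L2_class UNIV h" if h: "square_integrable h" for h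
  proof -
    have "L2_class {..<0} h + L2_class {0<..} h = L2_class ({..<0} \<union> {0<..}) h"
      by (intro L2_class_disjoint_add sub h) auto
    also have "\<dots> = L2_class UNIV h"
    proof (rule L2_class_eq_iff[THEN iffD2])
      have "negligible {0::real}" by simp
      then show "AE x in lebesgue. indicator ({..<0} \<union> {0<..}) x *\<^sub>R h x = indicator UNIV x *\<^sub>R h x"
        unfolding eventually_ae_filter_negligible by (intro exI[of _ "{0}"]) (auto split: split_indicator)
    qed (auto intro!: sub h)
    finally show ?thesis .
  qed
  moreover have "L2_class UNIV g = L2_class UNIV f + (- k\<^sup>2) *\<^sub>C L2_class UNIV v"
    unfolding g_def by (rule L2_class_add_scaleC[OF f v])
  ultimately show "(L2_class UNIV v, L2_class UNIV f + (- k\<^sup>2) *\<^sub>C L2_class UNIV v) \<in> direct_sum S_minus S_plus"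
    using v g by simp
qed


section \<open>Smallness of the solution on the shrinking interval\<close>

text \<open>
  Otherwise \<open>\<phi>\<close> would be an eigenfunction for the eigenvalue \<open>0\<close>.
\<close>
lemma neumann_no_zero_mode:
  assumes "\<not> eigenvalue (neumann V) 0"
    and \<phi>: "has_ac_derivative \<phi> \<phi>' {-1..1}" "has_ac_derivative \<phi>' (\<lambda>x. of_real (V x) * \<phi> x) {-1..1}"
    and 0: "\<phi> (-1) = 1" "\<phi>' (-1) = 0"
  shows "\<phi>' 1 \<noteq> 0"
proof
  assume 1: "\<phi>' 1 = 0"
  have l2: "L2_fun {-1..1} h" if h: "continuous_on {-1..1} h" for h :: "real \<Rightarrow> complex"
  proof -
    have i: "set_integrable lebesgue {-1..1} h" "set_integrable lebesgue {-1..1} (\<lambda>x. (norm (h x))\<^sup>2)"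
      by (intro absolutely_integrable_continuous_real continuous_intros h)+
    have "(\<lambda>x. (norm (indicat_real {-1..1} x *\<^sub>R h x))\<^sup>2) = (\<lambda>x. indicator {-1..1} x *\<^sub>R (norm (h x))\<^sup>2)"
      by (auto simp: fun_eq_iff split: split_indicator)
    then show ?thesis
      using i borel_measurable_integrable[of lebesgue "\<lambda>x. indicat_real {-1..1} x *\<^sub>R h x"]
      by (simp add: L2_fun_def square_integrable_def set_integrable_def)
  qed
  have c: "continuous_on {-1..1} \<phi>" "continuous_on {-1..1} \<phi>'"
    using has_ac_derivative_continuous_on_Icc[OF \<phi>(1) order_refl] has_ac_derivative_continuous_on_Icc[OF \<phi>(2) order_refl] by auto
  have z: "(\<lambda>x. - (of_real (V x) * \<phi> x) + of_real (V x) * \<phi> x) = (\<lambda>x. 0)" by simp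
  have "SL_fun {-1..1} V \<phi> \<phi>' (\<lambda>x. of_real (V x) * \<phi> x)"
    unfolding SL_fun_def z using \<phi> l2 c by (auto intro: l2)
  then have "(L2_class {-1..1} \<phi>, L2_class {-1..1} (\<lambda>x. - (of_real (V x) * \<phi> x) + of_real (V x) * \<phi> x)) \<in> neumann V"
    unfolding neumann_def using 0 1
    by (intro CollectI exI[of _ \<phi>] exI[of _ \<phi>'] exI[of _ "\<lambda>x. of_real (V x) * \<phi> x"]) simp
  then have "(L2_class {-1..1} \<phi>, 0 *\<^sub>C L2_class {-1..1} \<phi>) \<in> neumann V"
    unfolding z using l2[OF c(1)] by (simp add: L2_class_scaleC)
  moreover have "L2_class {-1..1} \<phi> \<noteq> 0"
  proof
    assume "L2_class {-1..1} \<phi> = 0"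
    then have "L2_class {-1..1} \<phi> = L2_class {-1..1} (\<lambda>x. 0)" by (simp only: L2_class_zero)
    then have "AE x in lebesgue. indicat_real {-1..1} x *\<^sub>R \<phi> x = indicat_real {-1..1} x *\<^sub>R 0"
      using l2[OF c(1)] l2[of "\<lambda>_. 0"] by (simp only: L2_class_eq_iff continuous_on_const)
    then have "AE x in lebesgue. x \<in> {-1..1} \<longrightarrow> \<phi> x = 0"
      by (rule eventually_mono) (auto split: split_indicator_asm)
    with continuous_not_AE_zero[OF c(1)] 0 show False by simp
  qed
  ultimately show False using assms(1) unfolding eigenvalue_def by blast
qed

text \<open>
  The Neumann estimate is applied to \<open>Y t = u (e t)\<close>, for which \<open>Y'' = V Y + r\<close> with
  \<open>r = e\<^sup>2 (k\<^sup>2 Y - f (e t))\<close> and \<open>Y' (\<plusminus>1) = e u' (\<plusminus>e)\<close>. With \<open>S = sup |Y|\<close> it yields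
  \<open>S \<le> 2 C e (P + \<parallel>f\<parallel>) + C e (2 |k| + 2 |k|\<^sup>2) S\<close>, and the smallness condition absorbs the last
  term.
\<close>
lemma inner_solution_bound:
  fixes V :: "real \<Rightarrow> real" and q :: "real \<Rightarrow> complex"
  defines "q \<equiv> \<lambda>x. of_real (V x)"
  assumes q: "q absolutely_integrable_on {-1..1}"
    and C: "C > 0" "neumann_estimate q C"
    and e: "0 < e" "e \<le> 1" and small: "C * e * (2 * norm k + 2 * (norm k)\<^sup>2) \<le> 1/2"
    and f: "square_integrable f"
    and u: "has_ac_derivative u u' UNIV"
      "has_ac_derivative u' (\<lambda>x. (of_real (1 / e\<^sup>2 * V (x / e)) + k\<^sup>2) * u x - f x) UNIV"
    and P: "norm (u' e + k * u e) \<le> P" "norm (u' (-e) - k * u (-e)) \<le> P"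
    and x: "x \<in> {-e..e}"
  shows "norm (u x) \<le> 4 * C * e * (P + norm (L2_class UNIV f))"
proof -
  let ?F = "norm (L2_class UNIV f)"
  define Y where "Y = (\<lambda>t. u (e * t))"
  define Y' where "Y' = (\<lambda>t. of_real e * u' (e * t))"
  define r where "r = (\<lambda>t. of_real (e\<^sup>2) * (k\<^sup>2 * Y t - f (e * t)))"
  have e0: "complex_of_real e \<noteq> 0" using e by simp
  have Y: "has_ac_derivative Y Y' {-1..1}"
    unfolding Y_def Y'_def by (rule has_ac_derivative_scale[OF u(1) e(1)]) auto
  have "has_ac_derivative Y' (\<lambda>t. of_real e * (of_real e *
      ((of_real (1 / e\<^sup>2 * V (e * t / e)) + k\<^sup>2) * u (e * t) - f (e * t)))) {-1..1}"
    unfolding Y'_def by (intro has_ac_derivative_cmult has_ac_derivative_scale[OF u(2) e(1)]) auto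
  then have Y': "has_ac_derivative Y' (\<lambda>t. q t * Y t + r t) {-1..1}"
    by (rule has_ac_derivative_cong) (use e0 in \<open>auto simp: r_def Y_def q_def power2_eq_square field_simps\<close>)
  have cY: "continuous_on {-1..1} Y" by (rule has_ac_derivative_continuous_on_Icc[OF Y order_refl])
  have "(\<lambda>t. (q t * Y t + r t) - Y t * q t) absolutely_integrable_on {-1..1}"
    by (intro set_integral_diff(1) has_ac_derivative_absolutely_integrable[OF Y' order_refl]
        absolutely_integrable_continuous_mult cY q)
  then have r: "r absolutely_integrable_on {-1..1}" by (simp add: mult.commute)
  have "\<exists>t\<in>{-1..1}. \<forall>s\<in>{-1..1}. norm (Y s) \<le> norm (Y t)"
    by (intro continuous_attains_sup continuous_intros cY) auto
  then obtain t where t: "t \<in> {-1..1}" "\<And>s. s \<in> {-1..1} \<Longrightarrow> norm (Y s) \<le> norm (Y t)" by blast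
  define S where "S = norm (Y t)"
  have im: "(\<lambda>x. x / e) ` {-e..e} = {-1..1}" using e by simp
  have fi: "(\<lambda>t. norm (f (e * t))) integrable_on {-1..1}"
    "integral {-1..1} (\<lambda>t. norm (f (e * t))) = 1 / e * integral {-e..e} (\<lambda>x. norm (f x))"
    using integrable_stretch_real[of "\<lambda>x. norm (f x)" "-e" e e] integral_stretch_real[of e "-e" e "\<lambda>x. norm (f x)"]
      integral_norm_symmetric_interval_le(1)[OF f, of e] e
    unfolding im by auto
  have ri: "(\<lambda>t. norm (r t)) integrable_on {-1..1}" using r by (simp add: absolutely_integrable_on_def)
  have "integral {-1..1} (\<lambda>t. norm (r t)) \<le> integral {-1..1} (\<lambda>t. e\<^sup>2 * (norm k)\<^sup>2 * S + e\<^sup>2 * norm (f (e * t)))"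
  proof (rule integral_le[OF ri])
    show "(\<lambda>t. e\<^sup>2 * (norm k)\<^sup>2 * S + e\<^sup>2 * norm (f (e * t))) integrable_on {-1..1}"
      using integrable_cmul[OF fi(1), of "e\<^sup>2"] by (intro integrable_add) auto
    fix s :: real assume s: "s \<in> {-1..1}"
    have "norm (k\<^sup>2 * Y s - f (e * s)) \<le> (norm k)\<^sup>2 * S + norm (f (e * s))"
      using norm_triangle_ineq4[of "k\<^sup>2 * Y s" "f (e * s)"] mult_left_mono[OF t(2)[OF s], of "(norm k)\<^sup>2"]
      by (simp add: norm_mult norm_power S_def)
    then have "e\<^sup>2 * norm (k\<^sup>2 * Y s - f (e * s)) \<le> e\<^sup>2 * ((norm k)\<^sup>2 * S + norm (f (e * s)))"
      by (rule mult_left_mono) simp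
    moreover have "norm (r s) = e\<^sup>2 * norm (k\<^sup>2 * Y s - f (e * s))"
      by (simp add: r_def norm_mult norm_power)
    ultimately show "norm (r s) \<le> e\<^sup>2 * (norm k)\<^sup>2 * S + e\<^sup>2 * norm (f (e * s))"
      by (simp add: distrib_left mult.assoc)
  qed
  also have "\<dots> = 2 * (e\<^sup>2 * (norm k)\<^sup>2 * S) + e\<^sup>2 * (1 / e * integral {-e..e} (\<lambda>x. norm (f x)))"
    using integral_add[OF integrable_const_ivl integrable_cmul[OF fi(1), of "e\<^sup>2"], of "e\<^sup>2 * (norm k)\<^sup>2 * S"]
    by (simp add: fi(2) mult.assoc)
  also have "\<dots> = 2 * e\<^sup>2 * (norm k)\<^sup>2 * S + e * integral {-e..e} (\<lambda>x. norm (f x))"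
    using e by (simp add: power2_eq_square)
  also have "\<dots> \<le> 2 * e * (norm k)\<^sup>2 * S + e * (2 * ?F)"
  proof (rule add_mono)
    have "e\<^sup>2 \<le> e" using e by (simp add: power2_eq_square mult_left_le)
    then show "2 * e\<^sup>2 * (norm k)\<^sup>2 * S \<le> 2 * e * (norm k)\<^sup>2 * S"
      by (intro mult_right_mono mult_left_mono) (auto simp: S_def)
    have "sqrt (2 * e) \<le> sqrt 4" using e by (intro real_sqrt_le_mono) simp
    then have "sqrt (2 * e) * ?F \<le> 2 * ?F" by (intro mult_right_mono) auto
    then show "e * integral {-e..e} (\<lambda>x. norm (f x)) \<le> e * (2 * ?F)"
      using integral_norm_symmetric_interval_le(2)[OF f, of e] e by (intro mult_left_mono) auto
  qed
  finally have R: "integral {-1..1} (\<lambda>t. norm (r t)) \<le> 2 * e * (norm k)\<^sup>2 * S + e * (2 * ?F)" .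
  have S: "norm (u (e * s)) \<le> S" if "s \<in> {-1..1}" for s using t(2)[OF that] by (simp add: S_def Y_def)
  \<comment> \<open>The Robin conditions trade the unknown derivatives for the unknown values.\<close>
  have ends: "norm (u' e) \<le> P + norm k * S" "norm (u' (-e)) \<le> P + norm k * S"
  proof -
    have "norm (k * u e) \<le> norm k * S" "norm (k * u (-e)) \<le> norm k * S"
      using mult_left_mono[OF S[of 1], of "norm k"] mult_left_mono[OF S[of "-1"], of "norm k"] by (auto simp: norm_mult)
    then show "norm (u' e) \<le> P + norm k * S" "norm (u' (-e)) \<le> P + norm k * S"
      using P norm_triangle_ineq4[of "u' e + k * u e" "k * u e"] norm_triangle_ineq[of "u' (-e) - k * u (-e)" "k * u (-e)"]
      by auto
  qed
  have Ye: "norm (Y' (-1)) \<le> e * (P + norm k * S)" "norm (Y' 1) \<le> e * (P + norm k * S)"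
    using mult_left_mono[OF ends(1), of e] mult_left_mono[OF ends(2), of e] e by (auto simp: Y'_def norm_mult)
  have "S \<le> C * (norm (Y' (-1)) + norm (Y' 1) + integral {-1..1} (\<lambda>t. norm (r t)))"
    unfolding S_def using C(2) Y Y' r t(1) unfolding neumann_estimate_def by blast
  also have "\<dots> \<le> C * (e * (P + norm k * S) + e * (P + norm k * S) + (2 * e * (norm k)\<^sup>2 * S + e * (2 * ?F)))"
    using C(1) Ye R by (intro mult_left_mono add_mono) auto
  also have "\<dots> = 2 * C * e * (P + ?F) + C * e * (2 * norm k + 2 * (norm k)\<^sup>2) * S"
    by (simp add: algebra_simps)
  also have "\<dots> \<le> 2 * C * e * (P + ?F) + 1/2 * S"
    using mult_right_mono[OF small, of S] by (simp add: S_def)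
  finally have "S \<le> 4 * C * e * (P + ?F)" by simp
  moreover have "norm (u x) \<le> S"
    using S[of "x / e"] x e by (simp add: divide_le_eq le_divide_eq)
  ultimately show ?thesis by simp
qed


section \<open>Convergence of the resolvents\<close>

lemma square_root_right_half_plane:
  assumes "z \<notin> \<real>"
  obtains k where "Re k > 0" "- k\<^sup>2 = z" "Im (k\<^sup>2) \<noteq> 0"
proof -
  define k where "k = csqrt (- z)"
  have k2: "k\<^sup>2 = - z" by (simp add: k_def)
  have im: "Im (k\<^sup>2) \<noteq> 0" using assms by (simp add: k2 complex_is_Real_iff)
  have "Re k \<noteq> 0"
  proof
    assume "Re k = 0"
    then have "Im (k\<^sup>2) = 0" by (simp add: power2_eq_square)
    with im show False by simp
  qed
  moreover have "Re k \<ge> 0" using csqrt_principal[of "- z"] by (auto simp: k_def)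
  ultimately show thesis using im k2 by (intro that[of k]) auto
qed

lemma rescaled_potential:
  fixes V :: "real \<Rightarrow> real"
  assumes V: "integrable lebesgue V" "closure {x. V x \<noteq> 0} \<subseteq> {-1..1}" and e: "e > 0"
  shows "integrable lebesgue (\<lambda>x. 1 / e\<^sup>2 * V (x / e))" "\<bar>x\<bar> > e \<Longrightarrow> 1 / e\<^sup>2 * V (x / e) = 0"
proof -
  have "integrable lebesgue (\<lambda>x. V (0 + 1 / e * x))"
    by (rule lebesgue_integrable_real_affine[OF V(1)]) (use e in simp)
  then show "integrable lebesgue (\<lambda>x. 1 / e\<^sup>2 * V (x / e))" by simp
  assume "\<bar>x\<bar> > e"
  then have "x / e \<notin> {-1..1}" using e by (auto simp: field_simps abs_if split: if_splits)
  then have "x / e \<notin> {x. V x \<noteq> 0}" using V(2) closure_subset[of "{x. V x \<noteq> 0}"] by blast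
  then show "1 / e\<^sup>2 * V (x / e) = 0" by simp
qed

lemma schroedinger_resolvent_set:
  fixes Q :: "real \<Rightarrow> real"
  assumes z: "z \<notin> \<real>" and e: "e > 0" and Q: "\<And>x. \<bar>x\<bar> > e \<Longrightarrow> Q x = 0" "integrable lebesgue Q"
  shows "z \<in> resolvent_set (schroedinger Q)"
proof (rule symmetric_graph_resolvent_set[OF symmetric_schroedinger])
  show "Im z \<noteq> 0" using z by (simp add: complex_is_Real_iff)
  fix F
  obtain k where k: "Re k > 0" "- k\<^sup>2 = z" "Im (k\<^sup>2) \<noteq> 0" using square_root_right_half_plane[OF z] .
  obtain f where f: "square_integrable f" "F = L2_class UNIV f" by (rule L2_cases)
  obtain y y' where y: "has_ac_derivative y y' UNIV" "has_ac_derivative y' (\<lambda>x. k\<^sup>2 * y x - f x) UNIV"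
    "square_integrable y" "square_integrable y'"
    by (rule free_resolvent_exists[OF k(1) f(1)])
  obtain u u' where u: "has_ac_derivative u u' UNIV" "has_ac_derivative u' (\<lambda>x. (of_real (Q x) + k\<^sup>2) * u x - f x) UNIV"
    "square_integrable u" "square_integrable u'"
    by (rule schroedinger_solution[OF k(1,3) e Q f(1) y])
  from schroedinger_graphI[OF u f(1)] show "\<exists>u. (u, F + z *\<^sub>C u) \<in> schroedinger Q"
    unfolding k(2) f(2)[symmetric] by blast
qed

lemma dirichlet_resolvent_set:
  assumes z: "z \<notin> \<real>"
  shows "z \<in> resolvent_set (direct_sum S_minus S_plus)"
proof (rule symmetric_graph_resolvent_set[OF symmetric_direct_sum])
  show "Im z \<noteq> 0" using z by (simp add: complex_is_Real_iff)
  fix F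
  obtain k where k: "Re k > 0" "- k\<^sup>2 = z" "Im (k\<^sup>2) \<noteq> 0" using square_root_right_half_plane[OF z] .
  obtain f where f: "square_integrable f" "F = L2_class UNIV f" by (rule L2_cases)
  obtain y y' where y: "has_ac_derivative y y' UNIV" "has_ac_derivative y' (\<lambda>x. k\<^sup>2 * y x - f x) UNIV"
    "square_integrable y" "square_integrable y'"
    by (rule free_resolvent_exists[OF k(1) f(1)])
  from dirichlet_solution(3)[OF k(1) f(1) y] show "\<exists>u. (u, F + z *\<^sub>C u) \<in> direct_sum S_minus S_plus"
    unfolding k(2) f(2)[symmetric] by blast
qed

text \<open>
  With \<open>\<parallel>f\<parallel> = n\<close>, the difference \<open>d = u - v\<close> is at most \<open>D1 n\<close> on \<open>[-e, e]\<close> and at most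
  \<open>e D2 n e\<^bsup>- Re k |x|\<^esup>\<close> outside. The first contributes the order \<open>\<surd>e\<close> to the norm, the second
  the order \<open>e\<close>.
\<close>
lemma resolvent_difference_bound:
  fixes V :: "real \<Rightarrow> real"
  assumes V: "integrable lebesgue V" "closure {x. V x \<noteq> 0} \<subseteq> {-1..1}"
    and no_mode: "\<not> eigenvalue (neumann V) 0" and z: "z \<notin> \<real>"
  obtains K e0 where "e0 > 0"
    "\<And>e F. 0 < e \<Longrightarrow> e \<le> e0 \<Longrightarrow>
      norm (resolvent (S_eps V e) z F - resolvent (direct_sum S_minus S_plus) z F) \<le> K * sqrt e * norm F"
proof -
  obtain k where k: "Re k > 0" "- k\<^sup>2 = z" "Im (k\<^sup>2) \<noteq> 0" using square_root_right_half_plane[OF z] .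
  have k0: "k \<noteq> 0" using k(1) by auto
  have "set_integrable lebesgue {-1..1} V"
    by (rule set_integrable_subset[of _ UNIV]) (use V(1) in \<open>auto simp: set_integrable_def\<close>)
  then have q: "(\<lambda>x. complex_of_real (V x)) absolutely_integrable_on {-1..1}"
    using absolutely_integrable_linear[OF _ bounded_linear_of_real] by (simp add: o_def)
  obtain C where C: "C > 0" "neumann_estimate (\<lambda>x. of_real (V x)) C"
    by (rule neumann_data_bound[OF q]) (use neumann_no_zero_mode[OF no_mode] in blast)+
  define c where "c = 1 / sqrt (2 * Re k)"
  have c0: "c > 0" using k(1) by (simp add: c_def)
  define C1 where "C1 = 4 * C * (2 * c + 1)"
  have C1: "C1 \<ge> 0" using C(1) c0 by (simp add: C1_def)
  define D1 where "D1 = C1 + 2 * c / norm k"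
  define D2 where "D2 = exp (Re k) * (C1 + 2 * c)"
  define K where "K = sqrt (2 * D1\<^sup>2 + D2\<^sup>2 / Re k)"
  define a where "a = 2 * norm k + 2 * (norm k)\<^sup>2"
  have a: "a > 0" using k0 by (simp add: a_def add_pos_pos)
  define e0 where "e0 = min 1 (1 / (2 * C * a))"
  show thesis
  proof (rule that[of e0 K])
    show "e0 > 0" using C(1) a by (simp add: e0_def)
    fix e :: real and F assume e: "0 < e" "e \<le> e0"
    have e1: "e \<le> 1" using e by (simp add: e0_def)
    have "e \<le> 1 / (2 * C * a)" using e by (simp add: e0_def)
    then have small: "C * e * (2 * norm k + 2 * (norm k)\<^sup>2) \<le> 1/2"
      using C(1) a unfolding a_def[symmetric] by (simp add: field_simps)
    let ?Q = "\<lambda>x. 1 / e\<^sup>2 * V (x / e)"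
    note Q = rescaled_potential[OF V e(1)]
    obtain f where f: "square_integrable f" and F: "F = L2_class UNIV f" by (rule L2_cases)
    define n where "n = norm F"
    have n0: "n \<ge> 0" by (simp add: n_def)
    obtain y y' where y: "has_ac_derivative y y' UNIV" "has_ac_derivative y' (\<lambda>x. k\<^sup>2 * y x - f x) UNIV"
      "square_integrable y" "square_integrable y'"
      and "\<And>x. norm (k * y x) \<le> norm (L2_class UNIV f) / sqrt (2 * Re k)"
      "\<And>x. norm (y' x) \<le> norm (L2_class UNIV f) / sqrt (2 * Re k)"
      by (rule free_resolvent_exists[OF k(1) f]) blast
    then have yb: "norm (k * y x) \<le> c * n" "norm (y' x) \<le> c * n" for x by (simp_all add: c_def n_def F)
    obtain u u' where u: "has_ac_derivative u u' UNIV" "has_ac_derivative u' (\<lambda>x. (of_real (?Q x) + k\<^sup>2) * u x - f x) UNIV"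
      "square_integrable u" "square_integrable u'"
      and bc: "u' e + k * u e = y' e + k * y e" "u' (-e) - k * u (-e) = y' (-e) - k * y (-e)"
      and ur: "\<And>x. x \<ge> e \<Longrightarrow> u x = y x + (u e - y e) * exp (- (k * of_real (x - e)))"
      and ul: "\<And>x. x \<le> - e \<Longrightarrow> u x = y x + (u (-e) - y (-e)) * exp (k * of_real (x + e))"
      by (rule schroedinger_solution[OF k(1,3) e(1) Q(2,1) f y]) blast+
    define v where "v = (\<lambda>x. y x - y 0 * exp (- (k * of_real \<bar>x\<bar>)))"
    note v = dirichlet_solution[OF k(1) f y, folded v_def]
    have ru: "resolvent (S_eps V e) z F = L2_class UNIV u"
      unfolding S_eps_def F k(2)[symmetric]
      by (rule symmetric_graph_resolvent_eq[OF symmetric_schroedinger _ schroedinger_graphI[OF u f]])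
        (use k(3) in simp)
    have rv: "resolvent (direct_sum S_minus S_plus) z F = L2_class UNIV v"
      unfolding F k(2)[symmetric]
      by (rule symmetric_graph_resolvent_eq[OF symmetric_direct_sum _ v(3)]) (use k(3) in simp)
    have P: "norm (u' e + k * u e) \<le> 2 * c * n" "norm (u' (-e) - k * u (-e)) \<le> 2 * c * n"
      unfolding bc using norm_triangle_ineq[of "y' e" "k * y e"] norm_triangle_ineq4[of "y' (-e)" "k * y (-e)"]
        yb[of e] yb[of "-e"] by linarith+
    have ub: "norm (u x) \<le> e * C1 * n" if "x \<in> {-e..e}" for x
    proof -
      have "norm (u x) \<le> 4 * C * e * (2 * c * n + norm (L2_class UNIV f))"
        by (rule inner_solution_bound[where V = V and k = k and u = u and u' = u' and f = f and e = e,
              OF q C e(1) e1 small f u(1,2) P that])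
      also have "\<dots> = e * C1 * n" by (simp add: C1_def n_def F algebra_simps)
      finally show ?thesis .
    qed
    have yk: "norm (y x) \<le> c * n / norm k" for x
      using yb(1)[of x] k0 by (simp add: norm_mult field_simps)
    define d where "d = (\<lambda>x. u x - v x)"
    have d1: "norm (d x) \<le> D1 * n" if "\<bar>x\<bar> \<le> e" for x
    proof -
      have "norm (exp (- (k * of_real \<bar>x\<bar>))) \<le> 1" using k(1) by (simp add: norm_exp_eq_Re)
      then have "norm (y 0 * exp (- (k * of_real \<bar>x\<bar>))) \<le> c * n / norm k * 1"
        unfolding norm_mult using yk[of 0] c0 n0 by (intro mult_mono) auto
      then have "norm (v x) \<le> c * n / norm k + c * n / norm k"
        unfolding v_def using norm_triangle_ineq4[of "y x" "y 0 * exp (- (k * of_real \<bar>x\<bar>))"] yk[of x] by linarith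
      moreover have "norm (u x) \<le> 1 * C1 * n"
        using ub[of x] that mult_right_mono[OF e1, of "C1 * n"] C1 n0 by (auto simp: abs_le_iff mult.assoc)
      ultimately show ?thesis
        unfolding d_def D1_def using norm_triangle_ineq4[of "u x" "v x"] by (simp add: algebra_simps)
    qed
    \<comment> \<open>The value of \<open>d\<close> at the end point \<open>s\<close>: besides \<open>u s\<close> it only contains the variation of \<open>y\<close> and of the exponential between \<open>0\<close> and \<open>s\<close>.\<close>
    have jump: "norm (u s - y s + y 0 * exp (- (k * of_real e))) \<le> e * (C1 + 2 * c) * n" if s: "\<bar>s\<bar> = e" for s
    proof -
      have s': "s \<in> {-e..e}" using s by (auto simp: abs_if split: if_splits)
      have dec: "u s - y s + y 0 * exp (- (k * of_real e))
          = u s - ((y s - y 0) + y 0 * (1 - exp (- (k * of_real e))))" by (simp add: algebra_simps)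
      have "norm (y s - y 0) \<le> c * n * e"
      proof (cases "s \<ge> 0")
        case True
        have "norm (y s - y 0) \<le> integral {0..s} (\<lambda>_. c * n)"
          by (rule has_ac_derivative_norm_le[OF y(1)]) (use yb True in auto)
        then show ?thesis using True s by (simp add: mult_ac)
      next
        case False
        have "norm (y 0 - y s) \<le> integral {s..0} (\<lambda>_. c * n)"
          by (rule has_ac_derivative_norm_le[OF y(1)]) (use yb False in auto)
        moreover have "s = - e" using False s by simp
        ultimately show ?thesis using e by (simp add: mult_ac norm_minus_commute)
      qed
      moreover have "norm (y 0 * (1 - exp (- (k * of_real e)))) \<le> c * n * e"
      proof -
        have "norm (y 0 * (1 - exp (- (k * of_real e)))) \<le> norm (y 0) * (norm k * e)"
          unfolding norm_mult by (intro mult_left_mono norm_one_minus_exp_le) (use k(1) e in auto)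
        also have "\<dots> = norm (k * y 0) * e" by (simp add: norm_mult)
        also have "\<dots> \<le> c * n * e" using yb(1)[of 0] e by (intro mult_right_mono) auto
        finally show ?thesis .
      qed
      ultimately have "norm (u s - y s + y 0 * exp (- (k * of_real e))) \<le> norm (u s) + (c * n * e + c * n * e)"
        unfolding dec using norm_triangle_ineq4[of "u s" "(y s - y 0) + y 0 * (1 - exp (- (k * of_real e)))"]
          norm_triangle_ineq[of "y s - y 0" "y 0 * (1 - exp (- (k * of_real e)))"] by linarith
      also have "\<dots> \<le> e * C1 * n + (c * n * e + c * n * e)" using ub[OF s'] by simp
      finally show ?thesis by (simp add: algebra_simps)
    qed
    \<comment> \<open>Moving the base point of the exponential from \<open>e\<close> to \<open>0\<close> costs a factor \<open>e\<^bsup>Re k\<^esup>\<close>, as \<open>e \<le> 1\<close>.\<close>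
    have tail: "norm (exp (- (k * of_real (t - e))) * w) \<le> (e * D2 * n) * exp (- (Re k * t))"
      if "norm w \<le> e * (C1 + 2 * c) * n" for t w
    proof -
      have "norm (exp (- (k * of_real (t - e)))) = exp (Re k * e) * exp (- (Re k * t))"
        by (simp add: norm_exp_eq_Re exp_add[symmetric] algebra_simps)
      then have "norm (exp (- (k * of_real (t - e))) * w) = exp (Re k * e) * exp (- (Re k * t)) * norm w"
        by (simp only: norm_mult)
      also have "\<dots> \<le> exp (Re k) * exp (- (Re k * t)) * (e * (C1 + 2 * c) * n)"
        using e1 k(1) e by (intro mult_mono that) auto
      finally show ?thesis by (simp add: D2_def mult_ac)
    qed
    have d2: "norm (d x) \<le> (e * D2 * n) * exp (- (Re k * \<bar>x\<bar>))" if "\<bar>x\<bar> > e" for x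
    proof (cases "x \<ge> 0")
      case True
      then have xe: "x \<ge> e" and ax: "\<bar>x\<bar> = x" using that by auto
      have "d x = exp (- (k * of_real (x - e))) * (u e - y e + y 0 * exp (- (k * of_real e)))"
        unfolding d_def v_def ax ur[OF xe] by (simp add: algebra_simps exp_add[symmetric])
      then show ?thesis using tail[OF jump[of e], of x] e ax by simp
    next
      case False
      then have xe: "x \<le> - e" and ax: "\<bar>x\<bar> = - x" using that by auto
      have "d x = exp (- (k * of_real (- x - e))) * (u (-e) - y (-e) + y 0 * exp (- (k * of_real e)))"
        unfolding d_def v_def ax ul[OF xe] by (simp add: algebra_simps exp_add[symmetric])
      then show ?thesis using tail[OF jump[of "-e"], of "-x"] e ax by simp
    qed
    have dm: "d \<in> borel_measurable lebesgue"
      using square_integrable_diff[OF u(3) v(2)] by (simp add: d_def square_integrable_def)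
    have "(norm (L2_class UNIV d))\<^sup>2 \<le> 2 * e * (D1 * n)\<^sup>2 + (e * D2 * n)\<^sup>2 / Re k"
      by (rule decaying_square_integrable(2)[OF k(1) dm _ d1 d2]) (use e in auto)
    also have "\<dots> \<le> 2 * e * (D1 * n)\<^sup>2 + e * (D2 * n)\<^sup>2 / Re k"
    proof -
      have "e\<^sup>2 \<le> e" using e e1 by (simp add: power2_eq_square mult_left_le)
      then have "(e * D2 * n)\<^sup>2 \<le> e * (D2 * n)\<^sup>2" by (simp add: power_mult_distrib mult_right_mono mult.assoc)
      then show ?thesis using k(1) by (simp add: divide_right_mono)
    qed
    also have "\<dots> = (2 * D1\<^sup>2 + D2\<^sup>2 / Re k) * e * n\<^sup>2" by (simp add: power_mult_distrib algebra_simps)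
    also have "\<dots> = (K * sqrt e * n)\<^sup>2"
      using e k(1) by (simp add: K_def power_mult_distrib)
    finally have "norm (L2_class UNIV d) \<le> K * sqrt e * n"
      by (rule power2_le_imp_le) (use n0 e k(1) in \<open>auto simp: K_def\<close>)
    then show "norm (resolvent (S_eps V e) z F - resolvent (direct_sum S_minus S_plus) z F) \<le> K * sqrt e * norm F"
      unfolding ru rv d_def using u(3) v(2) by (simp add: L2_class_diff L2_fun_UNIV n_def)
  qed
qed

theorem theorem3p1:
  fixes V :: "real \<Rightarrow> real"
  assumes "integrable lebesgue V"
    and "compact (closure {x. V x \<noteq> 0})"
    and "closure {x. V x \<noteq> 0} \<subseteq> {-1..1}"
    and "\<not> eigenvalue (neumann V) 0"
  shows "norm_resolvent_convergent (S_eps V) (direct_sum S_minus S_plus)"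
  unfolding norm_resolvent_convergent_def
proof (intro allI impI conjI)
  fix z :: complex assume z: "z \<notin> \<real>"
  show R0: "z \<in> resolvent_set (direct_sum S_minus S_plus)" by (rule dirichlet_resolvent_set[OF z])
  show R: "z \<in> resolvent_set (S_eps V e)" if "e > 0" for e
    unfolding S_eps_def
    by (rule schroedinger_resolvent_set[OF z that]) (use rescaled_potential[OF assms(1,3) that] in auto)
  let ?D = "\<lambda>e F. resolvent (S_eps V e) z F - resolvent (direct_sum S_minus S_plus) z F"
  obtain K e0 where e0: "e0 > 0"
    and K: "\<And>e F. 0 < e \<Longrightarrow> e \<le> e0 \<Longrightarrow> norm (?D e F) \<le> K * sqrt e * norm F"
    by (rule resolvent_difference_bound[OF assms(1,3,4) z]) blast
  show "((\<lambda>e. onorm (?D e)) \<longlongrightarrow> 0) (at_right 0)"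
  proof (rule Lim_null_comparison)
    have "((\<lambda>e. \<bar>K\<bar> * sqrt e) \<longlongrightarrow> \<bar>K\<bar> * sqrt 0) (at_right 0)"
      by (intro tendsto_intros)
    then show "((\<lambda>e. \<bar>K\<bar> * sqrt e) \<longlongrightarrow> 0) (at_right 0)" by simp
    have "\<forall>\<^sub>F e in at_right 0. e < e0" using e0 by (rule eventually_at_rightI[of 0, rotated]) simp
    moreover have "\<forall>\<^sub>F e in at_right 0. (0::real) < e" by (rule eventually_at_right_less)
    ultimately show "\<forall>\<^sub>F e in at_right 0. norm (onorm (?D e)) \<le> \<bar>K\<bar> * sqrt e"
    proof eventually_elim
      case (elim e)
      have b: "norm (?D e F) \<le> \<bar>K\<bar> * sqrt e * norm F" for F
        by (rule order_trans[OF K]) (use elim in \<open>auto intro!: mult_right_mono\<close>)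
      have "onorm (?D e) \<le> \<bar>K\<bar> * sqrt e"
        by (rule onorm_bound) (use b elim in auto)
      moreover have "0 \<le> onorm (?D e)"
        by (intro onorm_pos_le bounded_linear_sub) (use R0 R elim in \<open>auto simp: resolvent_set_def\<close>)
      ultimately show ?case by simp
    qed
  qed
qed

end
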